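(* Let $\varepsilon>0$ be fixed, let $p$ be a fixed odd prime, and let $Q(x,y,z)=ax^2+bxy+cy^2+dxz+eyz+fz^2$ be a fixed quadratic form with $a,b,c,d,e,f\in\mathbb{Z}$ such that $p$ does not divide $a(4ac-b^2)\cdot 4\Delta$, where $\Delta$ is the determinant of the matrix $$A_Q=\begin{pmatrix} a & \frac{b}{2} & \frac{d}{2}\\ \frac{b}{2} & c & \frac{e}{2}\\ \frac{d}{2} & \frac{e}{2} & f\end{pmatrix}.$$ Let $(x_0,y_0,z_0)\in\mathbb{Z}^3$ be a fixed point and let $\Phi:\mathbb{R}\to\mathbb{R}_{\ge 0}$ be a Schwartz class function. Set $q:=p^n$. Then, as $n\to\infty$, $$\sum_{\substack{(x,y,z)\in\mathbb{Z}^3\\ (z,p)=1\\ Q(x,y,z)\equiv 0 \bmod q}} \Phi\left(\frac{x-x_0}{N}\right)\Phi\left(\frac{y-y_0}{N}\right)\Phi\left(\frac{z-z_0}{N}\right)\sim \hat{\Phi}(0)^3\cdot C_p(Q)\cdot\frac{N^3}{q},$$ provided that $N\ge q^{1/2+\varepsilon}$.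
   Context: $\hat\Phi$ denotes the Fourier transform of $\Phi$, so $\hat\Phi(0)=\int_{\mathbb{R}}\Phi(x)\,dx$. The constant is $C_p(Q):=\frac{(p-s_p(Q))(p-1)}{p^2}$, where $s_p(Q):=\left(\frac{b^2-4ac}{p}\right)$ is the Legendre symbol. Here $N=N(n)$ may depend on $n$; the asymptotic means the ratio of the two sides tends to $1$ as $n\to\infty$ whenever $N\ge q^{1/2+\varepsilon}$. Since $p$ is odd, the condition that $p$ does not divide $4\Delta\in\mathbb{Z}$ is the paper's condition $(\Delta,p)=1$. *)

theory Defs
  imports
    "HOL-Analysis.Analysis"
    "HOL-Number_Theory.Number_Theory"
    "HOL-Library.Landau_Symbols"
begin

definition ternary_form :: "int \<Rightarrow> int \<Rightarrow> int \<Rightarrow> int \<Rightarrow> int \<Rightarrow> int \<Rightarrow> int \<Rightarrow> int \<Rightarrow> int \<Rightarrow> int" where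
  "ternary_form a b c d e f x y z = a*x^2 + b*x*y + c*y^2 + d*x*z + e*y*z + f*z^2"

definition form_matrix :: "int \<Rightarrow> int \<Rightarrow> int \<Rightarrow> int \<Rightarrow> int \<Rightarrow> int \<Rightarrow> real^3^3" where
  "form_matrix a b c d e f = vector
     [vector [of_int a,     of_int b / 2, of_int d / 2],
      vector [of_int b / 2, of_int c,     of_int e / 2],
      vector [of_int d / 2, of_int e / 2, of_int f]]"

definition form_det :: "int \<Rightarrow> int \<Rightarrow> int \<Rightarrow> int \<Rightarrow> int \<Rightarrow> int \<Rightarrow> real" where
  "form_det a b c d e f = det (form_matrix a b c d e f)"

text \<open>Four times the determinant is an integer, so taking its floor changes nothing but the type.\<close>

lemma four_form_det:
  "4 * form_det a b c d e f = of_int (4*a*c*f + b*d*e - a*e^2 - c*d^2 - f*b^2)"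
  by (simp add: form_det_def form_matrix_def det_3 field_simps power2_eq_square)

lemma of_int_floor_four_form_det:
  "of_int \<lfloor>4 * form_det a b c d e f\<rfloor> = 4 * form_det a b c d e f"
  unfolding four_form_det by simp

definition legendre_disc :: "nat \<Rightarrow> int \<Rightarrow> int \<Rightarrow> int \<Rightarrow> int" where
  "legendre_disc p a b c = Legendre (b^2 - 4*a*c) (int p)"

definition density_const :: "nat \<Rightarrow> int \<Rightarrow> int \<Rightarrow> int \<Rightarrow> real" where
  "density_const p a b c =
     (real p - of_int (legendre_disc p a b c)) * (real p - 1) / real p ^ 2"

text \<open>The first conjunct is smoothness: it makes every iterate of \<open>deriv\<close> a true derivative.\<close>

definition schwartz :: "(real \<Rightarrow> real) \<Rightarrow> bool" where
  "schwartz g \<longleftrightarrow>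
     (\<forall>k x. (deriv ^^ k) g differentiable at x) \<and>
     (\<forall>j k. \<exists>C. \<forall>x. \<bar>x ^ j * (deriv ^^ k) g x\<bar> \<le> C)"

definition fourier_transform :: "(real \<Rightarrow> real) \<Rightarrow> real \<Rightarrow> complex" where
  "fourier_transform g t = (LINT x|lborel. of_real (g x) * cis (- 2 * pi * x * t))"

definition zero_set_mod :: "nat \<Rightarrow> nat \<Rightarrow> (int \<Rightarrow> int \<Rightarrow> int \<Rightarrow> int) \<Rightarrow> (int \<times> int \<times> int) set" where
  "zero_set_mod p q Q = {(x, y, z). coprime z (int p) \<and> [Q x y z = 0] (mod int q)}"

end

theory Submission
  imports Defs "HOL-Computational_Algebra.Nth_Powers" "HOL-Real_Asymp.Real_Asymp"
begin

text \<open>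
  Expand the indicator function of the solution set modulo \<open>q = p ^ n\<close> into additive characters. The
  coefficient at the frequency \<open>\<xi>\<close> is an exponential sum over the solutions, which is averaged over the
  maps \<open>v \<mapsto> v + p ^ m (\<nabla>Q(v) \<times> t)\<close> with \<open>m = \<lceil>n / 2\<rceil>\<close> and over the scalings \<open>v \<mapsto> (1 + p u) v\<close>, all of
  which preserve the solution set. Only solutions whose gradient is parallel to \<open>\<xi>\<close> modulo \<open>p ^ (n - m)\<close>
  and for which \<open>p ^ (n - 1)\<close> divides \<open>\<xi> \<cdot> v\<close> survive. Hence the sum has size about \<open>q powr (3/2)\<close>, and it
  vanishes unless \<open>p ^ (n - 1)\<close> divides the dual form at \<open>\<xi>\<close>; for \<open>|\<xi>| \<le> M\<close> with \<open>M\<close> slightly smaller than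
  \<open>sqrt q\<close> this forces the dual form to vanish, which happens for only \<open>O(M log M)\<close> frequencies. An iterated
  average over an interval of length slightly larger than \<open>sqrt q\<close> damps all larger frequencies, so the
  solutions are equidistributed in translates of such weighted boxes, and \<open>\<Phi>\<close> at scale \<open>N\<close> is nearly
  constant on them.
\<close>

section \<open>Additive characters modulo \<open>q\<close>\<close>

text \<open>The error budget dictates the shape. The zero frequency gives a density of order 1/q. If
  all M^3 low frequencies carried a sum of size q^(3/2), the normalisation q^3 would leave M^3
  q^(-3/2), far above 1/q for M near sqrt q; with about M of them, and M = q^(1/2-\<delta>/2), what
  remains is q^(-1-\<delta>/2) up to logarithms. Frequencies divisible by p^j have sums larger by
  p^j, but they are rarer by the same factor, so each j costs the same and only a factor n is lost.
  For the high frequencies only trivial bounds are available: up to q^3 frequencies, each with a sum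
  of size up to q^3. One interval average saves just q^(-\<delta>/2), hence the r-fold iteration
  with r at least 10/\<delta>. Averaging over boxes takes the place of Poisson summation for \<Phi>,
  so that only quadratic decay of \<Phi> and of its derivative enters. The condition on N leaves
  room for boxes of side about q^(1/2+\<delta>) that are still much shorter than N.\<close>

definition add_char :: "nat \<Rightarrow> int \<Rightarrow> complex" where
  "add_char q x = cis (2 * pi * of_int x / of_nat q)"

lemma add_char_0 [simp]: "add_char q 0 = 1"
  by (simp add: add_char_def)

lemma add_char_add: "add_char q (x + y) = add_char q x * add_char q y"
  by (simp add: add_char_def cis_mult add_divide_distrib distrib_left)

lemma norm_add_char [simp]: "norm (add_char q x) = 1"
  by (simp add: add_char_def)

lemma add_char_eq_1_iff:
  assumes "q > 0" shows "add_char q x = 1 \<longleftrightarrow> int q dvd x"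
proof
  assume "add_char q x = 1"
  then have "cos (2 * pi * of_int x / of_nat q) = 1"
    unfolding add_char_def by (simp add: complex_eq_iff)
  then obtain k :: int where "2 * pi * of_int x / of_nat q = of_int k * 2 * pi"
    using cos_one_2pi_int by blast
  then have "(of_int x :: real) = of_int (k * int q)"
    using assms by (simp add: field_simps)
  then have "x = k * int q" by (simp only: of_int_eq_iff)
  then show "int q dvd x" by simp
next
  assume "int q dvd x"
  then obtain k where "x = int q * k" by (elim dvdE)
  then have "2 * pi * of_int x / of_nat q = 2 * pi * of_int k" using assms by simp
  then show "add_char q x = 1" unfolding add_char_def
    by (metis cis_multiple_2pi Ints_of_int)
qed

lemma add_char_cong:
  assumes "int q dvd x - y" shows "add_char q x = add_char q y"
proof (cases "q = 0")
  case True
  then show ?thesis using assms by simp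
next
  case False
  then have "add_char q (x - y) = 1" using add_char_eq_1_iff assms by blast
  then show ?thesis using add_char_add[of q "x - y" y] by simp
qed

lemma add_char_cancel:
  assumes "m > 0" shows "add_char (m * q) (int m * x) = add_char q x"
  using assms by (simp add: add_char_def mult.assoc)

lemma add_char_power: "add_char q x ^ n = add_char q (int n * x)"
  by (induction n) (simp_all add: add_char_add distrib_right)

lemma sum_int_lessThan: "(\<Sum>t\<in>{0..<int q}. g t) = (\<Sum>t<q. g (int t))"
  by (rule sum.reindex_bij_witness[of _ int nat]) auto

lemma sum_add_char:
  assumes "q > 0"
  shows "(\<Sum>t\<in>{0..<int q}. add_char q (t * x)) = (if int q dvd x then of_nat q else 0)"
proof -
  have *: "(\<Sum>t\<in>{0..<int q}. add_char q (t * x)) = (\<Sum>t<q. add_char q x ^ t)"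
    unfolding sum_int_lessThan by (simp add: add_char_power)
  show ?thesis
  proof (cases "int q dvd x")
    case True
    then have "add_char q x = 1" using assms by (simp add: add_char_eq_1_iff)
    then show ?thesis unfolding * using True by simp
  next
    case False
    then have "add_char q x \<noteq> 1" using assms by (simp add: add_char_eq_1_iff)
    moreover have "add_char q x ^ q = 1"
      unfolding add_char_power using assms by (simp add: add_char_eq_1_iff)
    ultimately show ?thesis unfolding * using False by (simp add: geometric_sum)
  qed
qed

definition cube :: "nat \<Rightarrow> (int \<times> int \<times> int) set" where
  "cube q = {0..<int q} \<times> {0..<int q} \<times> {0..<int q}"

definition red :: "nat \<Rightarrow> int \<times> int \<times> int \<Rightarrow> int \<times> int \<times> int" where
  "red q = (\<lambda>(x, y, z). (x mod int q, y mod int q, z mod int q))"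

lemma red_simp [simp]: "red q (x, y, z) = (x mod int q, y mod int q, z mod int q)"
  by (simp add: red_def)

lemma finite_cube [simp]: "finite (cube q)"
  by (simp add: cube_def)

lemma card_cube [simp]: "card (cube q) = q ^ 3"
  by (simp add: cube_def card_cartesian_product power3_eq_cube)

lemma red_in_cube: "q > 0 \<Longrightarrow> red q v \<in> cube q"
  by (cases v) (simp add: cube_def)

lemma red_id: "v \<in> cube q \<Longrightarrow> red q v = v"
  by (cases v) (auto simp: cube_def)

lemma red_eq_iff:
  "red q (x, y, z) = red q (x', y', z') \<longleftrightarrow>
    int q dvd x - x' \<and> int q dvd y - y' \<and> int q dvd z - z'"
  by (auto simp: mod_eq_dvd_iff)

lemma sum_cube_prod:
  fixes g1 g2 g3 :: "int \<Rightarrow> complex"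
  shows "(\<Sum>(x, y, z)\<in>cube q. g1 x * g2 y * g3 z) =
    (\<Sum>x\<in>{0..<int q}. g1 x) * (\<Sum>x\<in>{0..<int q}. g2 x) * (\<Sum>x\<in>{0..<int q}. g3 x)"
proof -
  have "(\<Sum>(x, y, z)\<in>cube q. g1 x * g2 y * g3 z) =
      (\<Sum>x\<in>{0..<int q}. g1 x * (\<Sum>y\<in>{0..<int q}. g2 y * (\<Sum>z\<in>{0..<int q}. g3 z)))"
    unfolding cube_def by (simp add: sum.cartesian_product[symmetric] sum_distrib_left mult.assoc)
  then show ?thesis by (simp only: sum_distrib_right[symmetric] mult.assoc)
qed

lemma sum_add_char_cube:
  assumes "q > 0"
  shows "(\<Sum>(x, y, z)\<in>cube q. add_char q (x * u + y * v + z * w)) =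
    (if int q dvd u \<and> int q dvd v \<and> int q dvd w then of_nat (q ^ 3) else 0)"
  unfolding add_char_add sum_cube_prod sum_add_char[OF assms] by (auto simp: power3_eq_cube)

definition wave :: "nat \<Rightarrow> int \<times> int \<times> int \<Rightarrow> int \<times> int \<times> int \<Rightarrow> complex" where
  "wave q = (\<lambda>(r, s, t) (x, y, z). add_char q (r * x + s * y + t * z))"

lemma wave_simp [simp]: "wave q (r, s, t) (x, y, z) = add_char q (r * x + s * y + t * z)"
  by (simp add: wave_def)

lemma wave_red: "wave q \<xi> (red q v) = wave q \<xi> v"
proof (cases \<xi>; cases v)
  fix r s t x y z assume *: "\<xi> = (r, s, t)" "v = (x, y, z)"
  have d: "int q dvd u mod int q - u" for u by (simp add: mod_eq_dvd_iff[symmetric])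
  have "int q dvd r * (x mod int q - x) + s * (y mod int q - y) + t * (z mod int q - z)"
    using d by (intro dvd_add dvd_mult)
  also have "r * (x mod int q - x) + s * (y mod int q - y) + t * (z mod int q - z) =
     (r * (x mod int q) + s * (y mod int q) + t * (z mod int q)) - (r * x + s * y + t * z)"
    by (simp add: algebra_simps)
  finally show ?thesis unfolding * red_simp wave_simp by (rule add_char_cong)
qed

lemma norm_wave [simp]: "norm (wave q \<xi> v) = 1"
  by (cases \<xi>; cases v) simp

text \<open>Each \<open>\<phi> t\<close> induces an injective self-map of a finite set of residue
  vectors, hence a permutation, so replacing \<open>g\<close> by its average over \<open>T\<close>
  along \<open>\<phi>\<close> does not change the sum. In the average a point with \<open>R\<close>
  reproduces its own term and every other point contributes 0. Injectivity is required only after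
  reduction because the maps act on integer vectors.\<close>

lemma sum_averaging:
  fixes g :: "int \<times> int \<times> int \<Rightarrow> complex"
  assumes "q > 0" and "finite T" and "T \<noteq> {}"
    and P_red: "\<And>v. P (red q v) = P v" and g_red: "\<And>v. g (red q v) = g v"
    and P_\<phi>: "\<And>t v. t \<in> T \<Longrightarrow> P v \<Longrightarrow> P (\<phi> t v)"
    and inj: "\<And>t v v'. t \<in> T \<Longrightarrow> P v \<Longrightarrow> P v' \<Longrightarrow> red q (\<phi> t v) = red q (\<phi> t v') \<Longrightarrow> red q v = red q v'"
    and fixd: "\<And>t v. P v \<Longrightarrow> R v \<Longrightarrow> t \<in> T \<Longrightarrow> g (\<phi> t v) = g v"
    and cancel: "\<And>v. P v \<Longrightarrow> \<not> R v \<Longrightarrow> (\<Sum>t\<in>T. g (\<phi> t v)) = 0"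
  shows "(\<Sum>v\<in>{v \<in> cube q. P v}. g v) = (\<Sum>v\<in>{v \<in> cube q. P v \<and> R v}. g v)"
proof -
  let ?V = "{v \<in> cube q. P v}"
  have fin: "finite ?V" by simp
  have reindex: "(\<Sum>v\<in>?V. g (\<phi> t v)) = (\<Sum>v\<in>?V. g v)" if t: "t \<in> T" for t
  proof -
    have inj_on: "inj_on (red q \<circ> \<phi> t) ?V"
    proof (rule inj_onI)
      fix v v' assume v: "v \<in> ?V" "v' \<in> ?V" "(red q \<circ> \<phi> t) v = (red q \<circ> \<phi> t) v'"
      then have "red q v = red q v'" using inj[OF t] by simp
      then show "v = v'" using v red_id by auto
    qed
    have sub: "(red q \<circ> \<phi> t) ` ?V \<subseteq> ?V"
    proof (rule image_subsetI)
      fix v assume "v \<in> ?V"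
      then have "P (\<phi> t v)" using P_\<phi>[OF t] by simp
      then show "(red q \<circ> \<phi> t) v \<in> ?V"
        using red_in_cube[OF \<open>q > 0\<close>] P_red by simp
    qed
    have "(red q \<circ> \<phi> t) ` ?V = ?V"
      using endo_inj_surj[OF fin sub inj_on] .
    then have "(\<Sum>v\<in>?V. g v) = (\<Sum>v\<in>?V. g ((red q \<circ> \<phi> t) v))"
      using sum.reindex[OF inj_on, of g] by simp
    then show ?thesis by (simp add: g_red)
  qed
  have "of_nat (card T) * (\<Sum>v\<in>?V. g v) = (\<Sum>t\<in>T. \<Sum>v\<in>?V. g (\<phi> t v))"
    using reindex by simp
  also have "\<dots> = (\<Sum>v\<in>?V. \<Sum>t\<in>T. g (\<phi> t v))" by (rule sum.swap)
  also have "\<dots> = (\<Sum>v\<in>?V. if R v then of_nat (card T) * g v else 0)"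
    by (intro sum.cong refl) (auto simp: fixd cancel)
  also have "\<dots> = of_nat (card T) * (\<Sum>v\<in>{v \<in> cube q. P v \<and> R v}. g v)"
    by (subst sum.inter_filter[OF fin, symmetric]) (auto simp: sum_distrib_left intro!: sum.cong)
  finally show ?thesis using assms(2,3) by simp
qed

section \<open>The quadratic form and its dual\<close>

locale form_mod_prime =
  fixes p :: nat and a b c d e f :: int
  assumes prime_p: "prime p" and odd_p: "odd p"
    and a_unit: "\<not> int p dvd a"
    and disc_unit: "\<not> int p dvd 4*a*c - b^2"
    and det_unit: "\<not> int p dvd 4*a*c*f + b*d*e - a*e^2 - c*d^2 - f*b^2"
begin

text \<open>\<open>D\<close> is minus the discriminant of the binary form Q(x, y, 0), and
  \<open>D4\<close> is four times the determinant of Q. The Hessian H of Q has determinant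
  \<open>2 * D4\<close>, so it is invertible modulo the odd prime p.\<close>

abbreviation D :: int where "D \<equiv> 4*a*c - b^2"
abbreviation D4 :: int where "D4 \<equiv> 4*a*c*f + b*d*e - a*e^2 - c*d^2 - f*b^2"
abbreviation Q :: "int \<Rightarrow> int \<Rightarrow> int \<Rightarrow> int" where "Q \<equiv> ternary_form a b c d e f"

definition Qx :: "int \<Rightarrow> int \<Rightarrow> int \<Rightarrow> int" where "Qx x y z = 2*a*x + b*y + d*z"
definition Qy :: "int \<Rightarrow> int \<Rightarrow> int \<Rightarrow> int" where "Qy x y z = b*x + 2*c*y + e*z"
definition Qz :: "int \<Rightarrow> int \<Rightarrow> int \<Rightarrow> int" where "Qz x y z = d*x + e*y + 2*f*z"

text \<open>The form of the adjugate matrix, which is dual to \<open>Q\<close>.\<close>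

definition dual :: "int \<Rightarrow> int \<Rightarrow> int \<Rightarrow> int" where
  "dual r s t = (4*c*f - e^2)*r^2 + (4*a*f - d^2)* s^2 + (4*a*c - b^2)*t^2
     + 2*(d*e - 2*b*f)*r* s + 2*(b*e - 2*c*d)*r*t + 2*(b*d - 2*a*e)* s*t"

lemma prime_int_p: "prime (int p)"
  using prime_p by simp

lemma two_unit: "\<not> int p dvd 2"
  using prime_p odd_p
  by (metis even_of_nat prime_int_p primes_dvd_imp_eq two_is_prime_nat prime_nat_int_transfer of_nat_numeral dvd_refl)

lemma dvd_mult_iff: "int p dvd u * v \<longleftrightarrow> int p dvd u \<or> int p dvd v"
  using prime_int_p by (simp add: prime_dvd_mult_iff)

lemma coprime_p_iff: "coprime z (int p) \<longleftrightarrow> \<not> int p dvd z"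
  using prime_int_p
  by (metis coprime_commute prime_imp_coprime coprime_absorb_left not_prime_unit)

lemma power_dvd_cancel:
  assumes "\<not> int p dvd u" "int p ^ n dvd u * v"
  shows "int p ^ n dvd v"
  using assms coprime_p_iff[of u]
  by (metis coprime_commute coprime_dvd_mult_right_iff coprime_power_left_iff)

lemma euler: "x * Qx x y z + y * Qy x y z + z * Qz x y z = 2 * Q x y z"
  by (simp add: Qx_def Qy_def Qz_def ternary_form_def power2_eq_square algebra_simps)

text \<open>The gradient is H v for the Hessian H, and adj(H) H = det(H) = 2 *
  \<open>D4\<close>.\<close>

lemma adjugate:
  "(4*c*f - e^2) * Qx x y z + (d*e - 2*b*f) * Qy x y z + (b*e - 2*c*d) * Qz x y z = 2 * D4 * x"
  "(d*e - 2*b*f) * Qx x y z + (4*a*f - d^2) * Qy x y z + (b*d - 2*a*e) * Qz x y z = 2 * D4 * y"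
  "(b*e - 2*c*d) * Qx x y z + (b*d - 2*a*e) * Qy x y z + (4*a*c - b^2) * Qz x y z = 2 * D4 * z"
  by (simp_all add: Qx_def Qy_def Qz_def power2_eq_square algebra_simps)

text \<open>If both partial derivatives vanished modulo p, Euler's identity and the invertibility of
  z would kill the third one as well, and inverting the Hessian would give p | z. So at every
  solution the equation can be solved for x or for y.\<close>

lemma gradient_unit:
  assumes "\<not> int p dvd z" "int p dvd Q x y z"
  shows "\<not> int p dvd Qx x y z \<or> \<not> int p dvd Qy x y z"
proof (rule ccontr)
  assume "\<not> ?thesis"
  then have xy: "int p dvd Qx x y z" "int p dvd Qy x y z" by auto
  have "z * Qz x y z = 2 * Q x y z - x * Qx x y z - y * Qy x y z"
    using euler[of x y z] by linarith
  then have "int p dvd z * Qz x y z" using xy assms by simp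
  then have "int p dvd Qz x y z" using assms(1) dvd_mult_iff by blast
  with xy have "int p dvd 2 * D4 * z"
    unfolding adjugate(3)[symmetric, of z x y] by (intro dvd_add dvd_mult)
  then show False using assms(1) det_unit two_unit by (simp only: dvd_mult_iff) blast
qed

text \<open>With g = H v this is g^T adj(H) g = det(H) v^T H v, where v^T H v = 2 Q(v). Hence the
  dual form vanishes on gradients at zeros of Q.\<close>

lemma dual_gradient: "dual (Qx x y z) (Qy x y z) (Qz x y z) = 4 * D4 * Q x y z"
  by (simp add: dual_def Qx_def Qy_def Qz_def ternary_form_def power2_eq_square algebra_simps)

lemma dual_add:
  "dual (l * g1 + m * u1) (l * g2 + m * u2) (l * g3 + m * u3) =
    l^2 * dual g1 g2 g3
    + 2 * l * m * (u1 * ((4*c*f - e^2) * g1 + (d*e - 2*b*f) * g2 + (b*e - 2*c*d) * g3)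
      + u2 * ((d*e - 2*b*f) * g1 + (4*a*f - d^2) * g2 + (b*d - 2*a*e) * g3)
      + u3 * ((b*e - 2*c*d) * g1 + (b*d - 2*a*e) * g2 + (4*a*c - b^2) * g3))
    + m^2 * dual u1 u2 u3"
  by (simp add: dual_def power2_eq_square algebra_simps)

lemma dual_combination:
  "dual (l * Qx x y z + m * u1) (l * Qy x y z + m * u2) (l * Qz x y z + m * u3) =
    l^2 * (4 * D4 * Q x y z) + 4 * l * m * D4 * (u1 * x + u2 * y + u3 * z) + m^2 * dual u1 u2 u3"
proof -
  have *: "2 * l * m * (u1 * (2 * w * x) + u2 * (2 * w * y) + u3 * (2 * w * z)) =
      4 * l * m * w * (u1 * x + u2 * y + u3 * z)" for w
    by (simp add: algebra_simps)
  show ?thesis unfolding dual_add adjugate dual_gradient * by (rule refl)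
qed

text \<open>The frequency \<open>(r, s, t)\<close> is \<open>p\<close>-adically close to a multiple of the gradient, on which
  the dual form vanishes.\<close>

lemma dual_vanishes_aux:
  assumes w: "\<not> int p dvd w"
    and w_def: "w = w1 * Qx x y z + w2 * Qy x y z + w3 * Qz x y z"
    and Q0: "int p ^ n dvd Q x y z"
    and par: "int p ^ k dvd s * Qz x y z - t * Qy x y z"
      "int p ^ k dvd t * Qx x y z - r * Qz x y z"
      "int p ^ k dvd r * Qy x y z - s * Qx x y z"
    and orth: "int p ^ (n - 1) dvd r * x + s * y + t * z"
    and k: "n - 1 \<le> 2 * k"
  shows "int p ^ (n - 1) dvd dual r s t"
proof -
  let ?q = "int p ^ (n - 1)" and ?P = "int p ^ k"
  \<comment> \<open>\<open>w\<close> is a linear form of the gradient that is a unit. Pairing the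
    parallelism of frequency and gradient with (w1, w2, w3) solves it: w times the frequency equals
    l times the gradient plus p^k u.\<close>
  define l where "l = w1 * r + w2 * s + w3 * t"
  obtain A1 where A1: "s * Qz x y z - t * Qy x y z = ?P * A1" using par(1) by (elim dvdE)
  obtain A2 where A2: "t * Qx x y z - r * Qz x y z = ?P * A2" using par(2) by (elim dvdE)
  obtain A3 where A3: "r * Qy x y z - s * Qx x y z = ?P * A3" using par(3) by (elim dvdE)
  define u1 where "u1 = w2 * A3 - w3 * A2"
  define u2 where "u2 = w3 * A1 - w1 * A3"
  define u3 where "u3 = w1 * A2 - w2 * A1"
  have wr: "w * r = l * Qx x y z + ?P * u1"
  proof -
    have "?P * u1 = w2 * (r * Qy x y z - s * Qx x y z) - w3 * (t * Qx x y z - r * Qz x y z)"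
      unfolding A2 A3 by (simp add: u1_def algebra_simps)
    then show ?thesis by (simp add: w_def l_def algebra_simps)
  qed
  have ws: "w * s = l * Qy x y z + ?P * u2"
  proof -
    have "?P * u2 = w3 * (s * Qz x y z - t * Qy x y z) - w1 * (r * Qy x y z - s * Qx x y z)"
      unfolding A1 A3 by (simp add: u2_def algebra_simps)
    then show ?thesis by (simp add: w_def l_def algebra_simps)
  qed
  have wt: "w * t = l * Qz x y z + ?P * u3"
  proof -
    have "?P * u3 = w1 * (t * Qx x y z - r * Qz x y z) - w2 * (s * Qz x y z - t * Qy x y z)"
      unfolding A1 A2 by (simp add: u3_def algebra_simps)
    then show ?thesis by (simp add: w_def l_def algebra_simps)
  qed
  have qQ: "?q dvd Q x y z" using Q0 by (meson le_imp_power_dvd diff_le_self dvd_trans)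
  \<comment> \<open>The cross term of the expanded dual form contains p^k (u . v). Pairing the
    decomposition with v and applying Euler's identity expresses it through \<open>orth\<close> and
    Q(v), both divisible by p^(n-1).\<close>
  have "?P * (u1 * x + u2 * y + u3 * z) =
      (w * r) * x + (w * s) * y + (w * t) * z - l * (x * Qx x y z + y * Qy x y z + z * Qz x y z)"
    unfolding wr ws wt by (simp add: algebra_simps)
  also have "\<dots> = w * (r * x + s * y + t * z) - l * (2 * Q x y z)"
    unfolding euler by (simp add: algebra_simps)
  finally have "?P * (u1 * x + u2 * y + u3 * z) = w * (r * x + s * y + t * z) - l * (2 * Q x y z)" .
  then have qu: "?q dvd ?P * (u1 * x + u2 * y + u3 * z)"
    using orth qQ by simp
  \<comment> \<open>This is where 2 k has to reach n - 1: the term quadratic in u has no other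
    source of divisibility.\<close>
  have qP: "?q dvd ?P^2"
    using k by (metis le_imp_power_dvd mult.commute power_mult)
  have d1: "?q dvd l^2 * (4 * D4 * Q x y z)" by (rule dvd_mult[OF dvd_mult[OF qQ]])
  have d2: "?q dvd 4 * l * ?P * D4 * (u1 * x + u2 * y + u3 * z)"
    using dvd_mult[OF qu, of "4 * l * D4"] by (simp only: mult_ac)
  have d3: "?q dvd ?P^2 * dual u1 u2 u3" by (rule dvd_mult2[OF qP])
  have "?q dvd l^2 * (4 * D4 * Q x y z) + 4 * l * ?P * D4 * (u1 * x + u2 * y + u3 * z) + ?P^2 * dual u1 u2 u3"
    by (rule dvd_add[OF dvd_add[OF d1 d2] d3])
  also have "\<dots> = dual (w * r) (w * s) (w * t)"
    unfolding wr ws wt by (rule dual_combination[symmetric])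
  also have "\<dots> = w^2 * dual r s t" by (simp add: dual_def power2_eq_square algebra_simps)
  finally have *: "?q dvd w^2 * dual r s t" .
  have "\<not> int p dvd w^2" using w by (simp add: dvd_mult_iff power2_eq_square)
  from power_dvd_cancel[OF this *] show ?thesis .
qed

lemma dual_vanishes:
  assumes "\<not> int p dvd z" and Q0: "int p ^ n dvd Q x y z" and "n \<ge> 1"
    and "int p ^ k dvd s * Qz x y z - t * Qy x y z"
      "int p ^ k dvd t * Qx x y z - r * Qz x y z"
      "int p ^ k dvd r * Qy x y z - s * Qx x y z"
    and "int p ^ (n - 1) dvd r * x + s * y + t * z"
    and "n - 1 \<le> 2 * k"
  shows "int p ^ (n - 1) dvd dual r s t"
proof -
  have "int p dvd Q x y z"
    using Q0 \<open>n \<ge> 1\<close> by (metis dvd_power dvd_trans less_eq_Suc_le One_nat_def)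
  then consider "\<not> int p dvd Qx x y z" | "\<not> int p dvd Qy x y z"
    using gradient_unit assms(1) by blast
  then show ?thesis
  proof cases
    case 1
    then show ?thesis using dual_vanishes_aux[of "Qx x y z" 1 x y z 0 0] assms by simp
  next
    case 2
    then show ?thesis using dual_vanishes_aux[of "Qy x y z" 0 x y z 1 0] assms by simp
  qed
qed

text \<open>Completes the squares in t and then in s; the factor a D keeps the coefficients
  integral. Integer zeros of the dual form thereby become zeros of a diagonal form with non-zero
  coefficients.\<close>

lemma dual_diagonal:
  "a * D * dual r s t =
     a * (D * t + (b*e - 2*c*d) * r + (b*d - 2*a*e) * s)^2 + D4 * (2*a* s - b*r)^2 + D4 * D * r^2"
  by (simp add: dual_def power2_eq_square algebra_simps)

end

section \<open>Stationary phase for the exponential sums\<close>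

context form_mod_prime
begin

definition sol :: "nat \<Rightarrow> int \<times> int \<times> int \<Rightarrow> bool" where
  "sol n = (\<lambda>(x, y, z). \<not> int p dvd z \<and> int p ^ n dvd Q x y z)"

text \<open>The components of the cross product of frequency and gradient: the Lagrange condition,
  modulo p^k, for a critical point of the phase on the quadric.\<close>

definition stationary :: "nat \<Rightarrow> int \<times> int \<times> int \<Rightarrow> int \<times> int \<times> int \<Rightarrow> bool" where
  "stationary k = (\<lambda>(r, s, t) (x, y, z).
     int p ^ k dvd s * Qz x y z - t * Qy x y z \<and>
     int p ^ k dvd t * Qx x y z - r * Qz x y z \<and>
     int p ^ k dvd r * Qy x y z - s * Qx x y z)"

lemma sol_simp [simp]: "sol n (x, y, z) \<longleftrightarrow> \<not> int p dvd z \<and> int p ^ n dvd Q x y z"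
  by (simp add: sol_def)

lemma Q_shift:
  "Q (x + m * u) (y + m * v) (z + m * w) =
    Q x y z + m * (u * Qx x y z + v * Qy x y z + w * Qz x y z) + m^2 * Q u v w"
  by (simp add: Qx_def Qy_def Qz_def ternary_form_def power2_eq_square algebra_simps)

lemma gradient_scale:
  "Qx (m * u) (m * v) (m * w) = m * Qx u v w"
  "Qy (m * u) (m * v) (m * w) = m * Qy u v w"
  "Qz (m * u) (m * v) (m * w) = m * Qz u v w"
  by (simp_all add: Qx_def Qy_def Qz_def algebra_simps)

lemma Q_scale: "Q (m * x) (m * y) (m * z) = m^2 * Q x y z"
  by (simp add: ternary_form_def power2_eq_square algebra_simps)

lemma gradient_diff:
  "Qx (x - x') (y - y') (z - z') = Qx x y z - Qx x' y' z'"
  "Qy (x - x') (y - y') (z - z') = Qy x y z - Qy x' y' z'"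
  "Qz (x - x') (y - y') (z - z') = Qz x y z - Qz x' y' z'"
  by (simp_all add: Qx_def Qy_def Qz_def algebra_simps)

lemma gradient_dvd:
  assumes "m dvd x" "m dvd y" "m dvd z"
  shows "m dvd Qx x y z" "m dvd Qy x y z" "m dvd Qz x y z"
  using assms by (simp_all add: Qx_def Qy_def Qz_def)

lemma Q_cong:
  assumes "m dvd x - x'" "m dvd y - y'" "m dvd z - z'"
  shows "m dvd Q x y z \<longleftrightarrow> m dvd Q x' y' z'"
proof -
  obtain u v w where "x - x' = m * u" "y - y' = m * v" "z - z' = m * w"
    using assms by (elim dvdE)
  then have *: "x = x' + m * u" "y = y' + m * v" "z = z' + m * w" by simp_all
  have "Q x y z = Q x' y' z' + m * ((u * Qx x' y' z' + v * Qy x' y' z' + w * Qz x' y' z') + m * Q u v w)"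
    unfolding * Q_shift by (simp add: power2_eq_square distrib_left)
  then show ?thesis by (metis dvd_add_left_iff dvd_triv_left)
qed

lemma p_dvd_power: "n \<ge> 1 \<Longrightarrow> int p dvd int p ^ n"
  by (metis dvd_power less_eq_Suc_le One_nat_def)

lemma sol_cong:
  assumes n: "n \<ge> 1" and "int p ^ n dvd x - x'" "int p ^ n dvd y - y'" "int p ^ n dvd z - z'"
  shows "sol n (x, y, z) \<longleftrightarrow> sol n (x', y', z')"
proof -
  have "int p dvd z - z'" using assms(4) p_dvd_power[OF n] dvd_trans by blast
  then have "int p dvd z \<longleftrightarrow> int p dvd z'"
    by (metis dvd_diff_left_iff dvd_diff_right_iff)
  then show ?thesis using Q_cong[OF assms(2-4)] by simp
qed

lemma red_sol:
  assumes n: "n \<ge> 1" shows "sol n (red (p ^ n) v) \<longleftrightarrow> sol n v"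
proof (cases v)
  case (fields x y z)
  have *: "int p ^ n dvd u mod int (p ^ n) - u" for u by (simp add: mod_eq_dvd_iff[symmetric])
  show ?thesis unfolding fields red_simp by (rule sol_cong[OF n]) (rule *)+
qed

lemma dvd_diff_iff_cong:
  fixes u v m :: int
  assumes "m dvd u - v" shows "m dvd u \<longleftrightarrow> m dvd v"
  using assms by (metis dvd_diff_left_iff dvd_diff_right_iff)

lemma stationary_cong:
  assumes "int p ^ k dvd x - x'" "int p ^ k dvd y - y'" "int p ^ k dvd z - z'"
  shows "stationary k \<xi> (x, y, z) \<longleftrightarrow> stationary k \<xi> (x', y', z')"
proof (cases \<xi>)
  case (fields r s t)
  note g = gradient_dvd[OF assms, unfolded gradient_diff]
  have "int p ^ k dvd (s * Qz x y z - t * Qy x y z) - (s * Qz x' y' z' - t * Qy x' y' z')"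
    using dvd_diff[OF dvd_mult[OF g(3), of s] dvd_mult[OF g(2), of t]] by (simp add: algebra_simps)
  moreover have "int p ^ k dvd (t * Qx x y z - r * Qz x y z) - (t * Qx x' y' z' - r * Qz x' y' z')"
    using dvd_diff[OF dvd_mult[OF g(1), of t] dvd_mult[OF g(3), of r]] by (simp add: algebra_simps)
  moreover have "int p ^ k dvd (r * Qy x y z - s * Qx x y z) - (r * Qy x' y' z' - s * Qx x' y' z')"
    using dvd_diff[OF dvd_mult[OF g(2), of r] dvd_mult[OF g(1), of s]] by (simp add: algebra_simps)
  ultimately show ?thesis
    unfolding stationary_def fields by (simp only: prod.case) (metis dvd_diff_iff_cong)
qed

lemma red_stationary:
  assumes "k \<le> n" shows "stationary k \<xi> (red (p ^ n) v) \<longleftrightarrow> stationary k \<xi> v"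
proof (cases v)
  case (fields x y z)
  have *: "int p ^ k dvd u mod int (p ^ n) - u" for u
    using le_imp_power_dvd[OF assms, of "int p"] mod_eq_dvd_iff[of "u mod int (p ^ n)" "int (p^n)" u]
    by (metis dvd_trans mod_mod_trivial of_nat_power)
  show ?thesis unfolding fields red_simp by (rule stationary_cong) (rule *)+
qed

definition gradient_rotate :: "nat \<Rightarrow> int \<times> int \<times> int \<Rightarrow> int \<times> int \<times> int \<Rightarrow> int \<times> int \<times> int" where
  "gradient_rotate m = (\<lambda>(h, i, j) (x, y, z).
    (x + int p ^ m * (Qy x y z * j - Qz x y z * i),
     y + int p ^ m * (Qz x y z * h - Qx x y z * j),
     z + int p ^ m * (Qx x y z * i - Qy x y z * h)))"

text \<open>The cyclic symmetry of the scalar triple product moves the rotation parameter out of the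
  cross product, and the factor p^m lowers the modulus of the character from p^n to p^k.\<close>

lemma wave_gradient_rotate:
  assumes "k + m = n"
  shows "wave (p ^ n) (r, s, t) (gradient_rotate m (h, i, j) (x, y, z)) =
    wave (p ^ n) (r, s, t) (x, y, z) *
      add_char (p ^ k) (h * (s * Qz x y z - t * Qy x y z) + i * (t * Qx x y z - r * Qz x y z)
        + j * (r * Qy x y z - s * Qx x y z))"
proof -
  let ?w = "h * (s * Qz x y z - t * Qy x y z) + i * (t * Qx x y z - r * Qz x y z)
        + j * (r * Qy x y z - s * Qx x y z)"
  have "wave (p ^ n) (r, s, t) (gradient_rotate m (h, i, j) (x, y, z)) =
      add_char (p ^ n) ((r * x + s * y + t * z) + int (p ^ m) * ?w)"
    unfolding gradient_rotate_def prod.case wave_simp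
    by (rule arg_cong[where f = "add_char (p ^ n)"]) (simp add: algebra_simps)
  also have "\<dots> = wave (p ^ n) (r, s, t) (x, y, z) * add_char (p ^ m * p ^ k) (int (p ^ m) * ?w)"
  proof -
    have "p ^ m * p ^ k = p ^ n" using assms by (metis power_add add.commute)
    then show ?thesis by (simp only: add_char_add[of _ "r * x + s * y + t * z"] wave_simp)
  qed
  also have "add_char (p ^ m * p ^ k) (int (p ^ m) * ?w) = add_char (p ^ k) ?w"
    using prime_gt_0_nat[OF prime_p] by (intro add_char_cancel) simp
  finally show ?thesis .
qed

text \<open>The displacement p^m (gradient x t) is orthogonal to the gradient, so the first-order
  change of Q is exactly zero and the second-order change is divisible by p^(2m), hence by p^n.
  Summing the character over all t modulo p^k leaves precisely the points where its coefficient
  vector, the cross product, vanishes modulo p^k.\<close>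

lemma exp_sum_stationary:
  assumes n: "n \<ge> 1" and km: "k + m = n" "k \<le> m"
  shows "(\<Sum>v\<in>{v \<in> cube (p ^ n). sol n v}. wave (p ^ n) \<xi> v) =
    (\<Sum>v\<in>{v \<in> cube (p ^ n). sol n v \<and> stationary k \<xi> v}. wave (p ^ n) \<xi> v)"
proof (rule sum_averaging[where T = "cube (p ^ k)" and \<phi> = "gradient_rotate m"])
  have pos: "p > 0" using prime_gt_0_nat[OF prime_p] .
  have m1: "m \<ge> 1" using n km by linarith
  obtain r s t where \<xi>: "\<xi> = (r, s, t)" by (cases \<xi>)
  have two_m: "int p ^ n dvd int p ^ m * int p ^ m"
    using km by (metis le_imp_power_dvd power_add add_le_cancel_right)
  show "0 < p ^ n" using pos by simp
  show "finite (cube (p ^ k))" by simp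
  show "cube (p ^ k) \<noteq> {}" using red_in_cube[of "p ^ k" "(0,0,0)"] pos by auto
  show "sol n (red (p ^ n) v) = sol n v" for v using red_sol[OF n] .
  show "wave (p ^ n) \<xi> (red (p ^ n) v) = wave (p ^ n) \<xi> v" for v by (rule wave_red)
  show "sol n (gradient_rotate m \<tau> v)" if "sol n v" for \<tau> v
  proof (cases v; cases \<tau>)
    fix x y z h i j assume v: "v = (x, y, z)" and \<tau>: "\<tau> = (h, i, j)"
    define u1 where "u1 = Qy x y z * j - Qz x y z * i"
    define u2 where "u2 = Qz x y z * h - Qx x y z * j"
    define u3 where "u3 = Qx x y z * i - Qy x y z * h"
    have z: "u1 * Qx x y z + u2 * Qy x y z + u3 * Qz x y z = 0"
      by (simp add: u1_def u2_def u3_def algebra_simps)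
    have "Q (x + int p ^ m * u1) (y + int p ^ m * u2) (z + int p ^ m * u3) =
        Q x y z + (int p ^ m)^2 * Q u1 u2 u3"
      unfolding Q_shift z by simp
    moreover have "int p ^ n dvd (int p ^ m)^2 * Q u1 u2 u3"
      using two_m by (simp add: power2_eq_square)
    moreover have "int p dvd z + int p ^ m * u3 \<longleftrightarrow> int p dvd z"
      using p_dvd_power[OF m1] by (simp add: dvd_add_left_iff)
    ultimately have "sol n (x + int p ^ m * u1, y + int p ^ m * u2, z + int p ^ m * u3)"
      using that unfolding v by simp
    then show ?thesis unfolding v \<tau> gradient_rotate_def prod.case u1_def u2_def u3_def .
  qed
  show "red (p ^ n) v = red (p ^ n) v'"
    if "red (p ^ n) (gradient_rotate m \<tau> v) = red (p ^ n) (gradient_rotate m \<tau> v')" for \<tau> v v'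
  proof -
    obtain x y z x' y' z' h i j where v: "v = (x, y, z)" "v' = (x', y', z')" "\<tau> = (h, i, j)"
      by (metis prod_cases3)
    define X Y Z where "X = x - x'" "Y = y - y'" "Z = z - z'"
    have 1: "int p ^ n dvd X + int p ^ m * (Qy X Y Z * j - Qz X Y Z * i)"
      "int p ^ n dvd Y + int p ^ m * (Qz X Y Z * h - Qx X Y Z * j)"
      "int p ^ n dvd Z + int p ^ m * (Qx X Y Z * i - Qy X Y Z * h)"
      using that unfolding v gradient_rotate_def prod.case red_eq_iff X_Y_Z_def gradient_diff
      by (simp_all add: algebra_simps)
    \<comment> \<open>Bootstrapping: the displacement is p^m times something linear in the
      difference of the two points. First p^m divides this difference, then its gradient, so the
      displacement terms are divisible by p^(2m) and drop out.\<close>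
    have mn: "int p ^ m dvd int p ^ n" using km by (simp add: le_imp_power_dvd)
    have "int p ^ m dvd X" "int p ^ m dvd Y" "int p ^ m dvd Z"
      using 1[THEN dvd_trans[OF mn]] by (simp_all add: dvd_add_left_iff)
    note g = gradient_dvd[OF this]
    have 2: "int p ^ n dvd int p ^ m * (A * B - C * E)"
      if "int p ^ m dvd A" "int p ^ m dvd C" for A B C E
    proof -
      have "int p ^ m dvd A * B - C * E" using that by simp
      then have "int p ^ m * int p ^ m dvd int p ^ m * (A * B - C * E)" by (rule mult_dvd_mono[OF dvd_refl])
      then show ?thesis using two_m dvd_trans by blast
    qed
    have "int p ^ n dvd X" "int p ^ n dvd Y" "int p ^ n dvd Z"
      using 1 2 g by (simp_all add: dvd_add_left_iff)
    then show ?thesis unfolding v red_eq_iff X_Y_Z_def by simp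
  qed
  show "wave (p ^ n) \<xi> (gradient_rotate m \<tau> v) = wave (p ^ n) \<xi> v" if st: "stationary k \<xi> v" for \<tau> v
  proof -
    obtain x y z h i j where v: "v = (x, y, z)" "\<tau> = (h, i, j)" by (metis prod_cases3)
    have "int (p ^ k) dvd h * (s * Qz x y z - t * Qy x y z) + i * (t * Qx x y z - r * Qz x y z)
        + j * (r * Qy x y z - s * Qx x y z)"
      using st unfolding stationary_def \<xi> v by (intro dvd_add dvd_mult) simp_all
    then have "add_char (p ^ k) (h * (s * Qz x y z - t * Qy x y z) + i * (t * Qx x y z - r * Qz x y z)
        + j * (r * Qy x y z - s * Qx x y z)) = 1"
      using add_char_eq_1_iff[of "p ^ k"] pos by simp
    then show ?thesis unfolding \<xi> v wave_gradient_rotate[OF km(1)] by simp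
  qed
  show "(\<Sum>\<tau>\<in>cube (p ^ k). wave (p ^ n) \<xi> (gradient_rotate m \<tau> v)) = 0" if st: "\<not> stationary k \<xi> v" for v
  proof -
    obtain x y z where v: "v = (x, y, z)" by (metis prod_cases3)
    have "(\<Sum>\<tau>\<in>cube (p ^ k). wave (p ^ n) \<xi> (gradient_rotate m \<tau> v)) =
      wave (p ^ n) \<xi> v * (\<Sum>(h, i, j)\<in>cube (p ^ k).
        add_char (p ^ k) (h * (s * Qz x y z - t * Qy x y z) + i * (t * Qx x y z - r * Qz x y z)
        + j * (r * Qy x y z - s * Qx x y z)))"
      unfolding sum_distrib_left v \<xi>
      by (intro sum.cong refl) (simp only: split_paired_all prod.case wave_gradient_rotate[OF km(1)])
    also have "\<dots> = 0"
      using st pos unfolding stationary_def \<xi> v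
      by (subst sum_add_char_cube) auto
    finally show ?thesis .
  qed
qed

text \<open>Scaling by 1 + p u multiplies Q by a unit square and changes the phase by p u (\<xi> .
  v), that is, by a character modulo p^(n-1) evaluated at u (\<xi> . v). Using only units congruent
  to 1 modulo p lets u run through a complete residue system, which gives exact orthogonality at the
  price of one power of p.\<close>

lemma exp_sum_orthogonal:
  assumes n: "n \<ge> 1" and kn: "k \<le> n"
  shows "(\<Sum>v\<in>{v \<in> cube (p ^ n). sol n v \<and> stationary k (r, s, t) v}. wave (p ^ n) (r, s, t) v) =
    (\<Sum>v\<in>{v \<in> cube (p ^ n). (sol n v \<and> stationary k (r, s, t) v) \<and>
       (\<lambda>(x, y, z). int p ^ (n - 1) dvd r * x + s * y + t * z) v}. wave (p ^ n) (r, s, t) v)"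
proof (rule sum_averaging[where T = "{0..<int (p ^ (n - 1))}"
      and \<phi> = "\<lambda>u (x, y, z). ((1 + int p * u) * x, (1 + int p * u) * y, (1 + int p * u) * z)"])
  have pos: "p > 0" using prime_gt_0_nat[OF prime_p] .
  have unit: "\<not> int p dvd 1 + int p * u" for u
    using prime_int_p by (metis dvd_add_left_iff dvd_triv_left not_prime_unit)
  have wv: "wave (p ^ n) (r, s, t) ((1 + int p * u) * x, (1 + int p * u) * y, (1 + int p * u) * z) =
    wave (p ^ n) (r, s, t) (x, y, z) * add_char (p ^ (n - 1)) (u * (r * x + s * y + t * z))" for u x y z
  proof -
    have "wave (p ^ n) (r, s, t) ((1 + int p * u) * x, (1 + int p * u) * y, (1 + int p * u) * z) =
        add_char (p ^ n) ((r * x + s * y + t * z) + int p * (u * (r * x + s * y + t * z)))"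
      unfolding wave_simp
      by (rule arg_cong[where f = "add_char (p ^ n)"]) (simp add: algebra_simps)
    also have "\<dots> = wave (p ^ n) (r, s, t) (x, y, z) *
        add_char (p * p ^ (n - 1)) (int p * (u * (r * x + s * y + t * z)))"
    proof -
      have "p * p ^ (n - 1) = p ^ n" using n by (metis power_eq_if not_one_le_zero)
      then show ?thesis by (simp only: add_char_add[of _ "r * x + s * y + t * z"] wave_simp)
    qed
    also have "add_char (p * p ^ (n - 1)) (int p * (u * (r * x + s * y + t * z))) =
        add_char (p ^ (n - 1)) (u * (r * x + s * y + t * z))"
      using pos by (intro add_char_cancel) simp
    finally show ?thesis .
  qed
  show "0 < p ^ n" using pos by simp
  show "finite {0..<int (p ^ (n - 1))}" by simp
  show "{0..<int (p ^ (n - 1))} \<noteq> {}" using pos by simp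
  show "(sol n (red (p ^ n) v) \<and> stationary k (r, s, t) (red (p ^ n) v)) =
    (sol n v \<and> stationary k (r, s, t) v)" for v
    using red_sol[OF n] red_stationary[OF kn] by simp
  show "wave (p ^ n) (r, s, t) (red (p ^ n) v) = wave (p ^ n) (r, s, t) v" for v by (rule wave_red)
  show "sol n (case v of (x, y, z) \<Rightarrow> ((1 + int p * u) * x, (1 + int p * u) * y, (1 + int p * u) * z)) \<and>
     stationary k (r, s, t) (case v of (x, y, z) \<Rightarrow> ((1 + int p * u) * x, (1 + int p * u) * y, (1 + int p * u) * z))"
    if "sol n v \<and> stationary k (r, s, t) v" for u v
  proof (cases v)
    case (fields x y z)
    define l where "l = 1 + int p * u"
    have "sol n (l * x, l * y, l * z)"
      using that unit[of u] unfolding fields l_def[symmetric] by (simp add: Q_scale dvd_mult_iff)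
    moreover have "stationary k (r, s, t) (l * x, l * y, l * z)"
    proof -
      have "int p ^ k dvd A * (l * B) - C * (l * E)" if "int p ^ k dvd A * B - C * E" for A B C E
        using dvd_mult[OF that, of l] by (simp add: algebra_simps)
      then show ?thesis using that unfolding fields stationary_def prod.case gradient_scale by blast
    qed
    ultimately show ?thesis unfolding fields prod.case l_def by blast
  qed
  show "red (p ^ n) v = red (p ^ n) v'"
    if "red (p ^ n) (case v of (x, y, z) \<Rightarrow> ((1 + int p * u) * x, (1 + int p * u) * y, (1 + int p * u) * z)) =
      red (p ^ n) (case v' of (x, y, z) \<Rightarrow> ((1 + int p * u) * x, (1 + int p * u) * y, (1 + int p * u) * z))"
    for u v v'
  proof (cases v; cases v')
    fix x y z x' y' z' assume v: "v = (x, y, z)" "v' = (x', y', z')"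
    have "int p ^ n dvd X - X'" if "int p ^ n dvd (1 + int p * u) * X - (1 + int p * u) * X'" for X X'
      using that power_dvd_cancel[OF unit] by (simp only: right_diff_distrib[symmetric])
    then show ?thesis using that unfolding v prod.case red_eq_iff of_nat_power by blast
  qed
  show "wave (p ^ n) (r, s, t) (case v of (x, y, z) \<Rightarrow> ((1 + int p * u) * x, (1 + int p * u) * y, (1 + int p * u) * z)) =
    wave (p ^ n) (r, s, t) v"
    if R: "(\<lambda>(x, y, z). int p ^ (n - 1) dvd r * x + s * y + t * z) v" for u v
  proof (cases v)
    case (fields x y z)
    have "add_char (p ^ (n - 1)) (u * (r * x + s * y + t * z)) = 1"
      using R pos unfolding fields by (subst add_char_eq_1_iff) auto
    then show ?thesis unfolding fields prod.case wv by simp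
  qed
  show "(\<Sum>u\<in>{0..<int (p ^ (n - 1))}. wave (p ^ n) (r, s, t)
      (case v of (x, y, z) \<Rightarrow> ((1 + int p * u) * x, (1 + int p * u) * y, (1 + int p * u) * z))) = 0"
    if R: "\<not> (\<lambda>(x, y, z). int p ^ (n - 1) dvd r * x + s * y + t * z) v" for v
  proof (cases v)
    case (fields x y z)
    have "0 < p ^ (n - 1)" using pos by simp
    with R show ?thesis
      unfolding fields prod.case wv sum_distrib_left[symmetric] by (subst sum_add_char) auto
  qed
qed

lemma exp_sum_localise:
  assumes n: "n \<ge> 1" and km: "k + m = n" "k \<le> m"
  shows "(\<Sum>v\<in>{v \<in> cube (p ^ n). sol n v}. wave (p ^ n) (r, s, t) v) =
    (\<Sum>v\<in>{v \<in> cube (p ^ n). (sol n v \<and> stationary k (r, s, t) v) \<and>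
       (\<lambda>(x, y, z). int p ^ (n - 1) dvd r * x + s * y + t * z) v}. wave (p ^ n) (r, s, t) v)"
  using exp_sum_stationary[OF assms, of "(r, s, t)"] exp_sum_orthogonal[OF n, of k] km by simp

lemma exp_sum_nonzero:
  assumes n: "n \<ge> 1"
    and "(\<Sum>v\<in>{v \<in> cube (p ^ n). sol n v}. wave (p ^ n) (r, s, t) v) \<noteq> 0"
  shows "int p ^ (n - 1) dvd dual r s t"
proof -
  \<comment> \<open>For odd n this gives 2 k = n - 1, just the precision that
    \<open>dual_vanishes\<close> asks for.\<close>
  define k where "k = n div 2"
  have km: "k + (n - k) = n" "k \<le> n - k" "n - 1 \<le> 2 * k" by (simp_all add: k_def)
  from assms(2) have "{v \<in> cube (p ^ n). (sol n v \<and> stationary k (r, s, t) v) \<and>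
       (\<lambda>(x, y, z). int p ^ (n - 1) dvd r * x + s * y + t * z) v} \<noteq> {}"
    unfolding exp_sum_localise[OF n km(1,2)] by (metis sum.empty)
  then obtain x y z where "sol n (x, y, z)" "stationary k (r, s, t) (x, y, z)"
    "int p ^ (n - 1) dvd r * x + s * y + t * z" by auto
  then show ?thesis
    using dual_vanishes[of z n x y k s t r] n km(3) unfolding stationary_def by simp
qed

end

section \<open>Counting the stationary points\<close>

context form_mod_prime
begin

text \<open>The p-adic valuation of \<open>u\<close> is at most j, so cancelling \<open>u\<close>
  costs at most j powers of p.\<close>

lemma power_dvd_cancel_partial:
  assumes "int p ^ k dvd u * v" "\<not> int p ^ Suc j dvd u" "j \<le> k"
  shows "int p ^ (k - j) dvd v"
  using assms
proof (induction j arbitrary: k u)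
  case 0
  then show ?case using power_dvd_cancel[of u k v] by simp
next
  case (Suc j)
  obtain k' where k: "k = Suc k'" using Suc.prems(3) by (cases k) auto
  show ?case
  proof (cases "int p dvd u")
    case False
    then have "int p ^ k dvd v" using power_dvd_cancel Suc.prems(1) by blast
    then show ?thesis by (meson diff_le_self le_imp_power_dvd dvd_trans)
  next
    case True
    then obtain u' where u: "u = int p * u'" by (elim dvdE)
    have p0: "int p \<noteq> 0" using prime_int_p by auto
    have "int p ^ k' dvd u' * v" using Suc.prems(1) p0 unfolding k u by (simp add: mult.assoc)
    moreover have "\<not> int p ^ Suc j dvd u'" using Suc.prems(2) p0 unfolding u by simp
    ultimately have "int p ^ (k' - j) dvd v" using Suc.IH[of k' u'] Suc.prems(3) k by simp
    then show ?thesis by (simp add: k)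
  qed
qed

text \<open>Two vectors parallel to (r, s, t) should be parallel to each other. Since (r, s, t) may
  itself be divisible by p, their cross product is known to vanish only after multiplication by one
  of its entries.\<close>

lemma cross_gradients:
  fixes r s t :: int
  assumes "m dvd s * y3 - t * y2" "m dvd t * y1 - r * y3" "m dvd r * y2 - s * y1"
    and "m dvd s * w3 - t * w2" "m dvd t * w1 - r * w3" "m dvd r * w2 - s * w1"
    and "\<rho> = r \<or> \<rho> = s \<or> \<rho> = t"
  shows "m dvd \<rho> * (y2 * w3 - y3 * w2)" "m dvd \<rho> * (y3 * w1 - y1 * w3)" "m dvd \<rho> * (y1 * w2 - y2 * w1)"
proof -
  have r: "m dvd r * (y2 * w3 - y3 * w2)" "m dvd r * (y3 * w1 - y1 * w3)" "m dvd r * (y1 * w2 - y2 * w1)"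
  proof -
    have "r * (y2 * w3 - y3 * w2) = (r * y2 - s * y1) * w3 + (t * y1 - r * y3) * w2 + y1 * (s * w3 - t * w2)"
      "r * (y3 * w1 - y1 * w3) = y1 * (t * w1 - r * w3) - (t * y1 - r * y3) * w1"
      "r * (y1 * w2 - y2 * w1) = y1 * (r * w2 - s * w1) - (r * y2 - s * y1) * w1"
      by (simp_all add: algebra_simps)
    then show "m dvd r * (y2 * w3 - y3 * w2)" "m dvd r * (y3 * w1 - y1 * w3)" "m dvd r * (y1 * w2 - y2 * w1)"
      using assms(1-6) by (simp_all only: dvd_add dvd_diff dvd_mult dvd_mult2)
  qed
  have s: "m dvd s * (y3 * w1 - y1 * w3)" "m dvd s * (y1 * w2 - y2 * w1)" "m dvd s * (y2 * w3 - y3 * w2)"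
  proof -
    have "s * (y3 * w1 - y1 * w3) = (s * y3 - t * y2) * w1 + (r * y2 - s * y1) * w3 + y2 * (t * w1 - r * w3)"
      "s * (y1 * w2 - y2 * w1) = y2 * (r * w2 - s * w1) - (r * y2 - s * y1) * w2"
      "s * (y2 * w3 - y3 * w2) = y2 * (s * w3 - t * w2) - (s * y3 - t * y2) * w2"
      by (simp_all add: algebra_simps)
    then show "m dvd s * (y3 * w1 - y1 * w3)" "m dvd s * (y1 * w2 - y2 * w1)" "m dvd s * (y2 * w3 - y3 * w2)"
      using assms(1-6) by (simp_all only: dvd_add dvd_diff dvd_mult dvd_mult2)
  qed
  have t: "m dvd t * (y1 * w2 - y2 * w1)" "m dvd t * (y2 * w3 - y3 * w2)" "m dvd t * (y3 * w1 - y1 * w3)"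
  proof -
    have "t * (y1 * w2 - y2 * w1) = (t * y1 - r * y3) * w2 + (s * y3 - t * y2) * w1 + y3 * (r * w2 - s * w1)"
      "t * (y2 * w3 - y3 * w2) = y3 * (s * w3 - t * w2) - (s * y3 - t * y2) * w3"
      "t * (y3 * w1 - y1 * w3) = y3 * (t * w1 - r * w3) - (t * y1 - r * y3) * w3"
      by (simp_all add: algebra_simps)
    then show "m dvd t * (y1 * w2 - y2 * w1)" "m dvd t * (y2 * w3 - y3 * w2)" "m dvd t * (y3 * w1 - y1 * w3)"
      using assms(1-6) by (simp_all only: dvd_add dvd_diff dvd_mult dvd_mult2)
  qed
  show "m dvd \<rho> * (y2 * w3 - y3 * w2)" "m dvd \<rho> * (y3 * w1 - y1 * w3)" "m dvd \<rho> * (y1 * w2 - y2 * w1)"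
    using assms(7) r s t by blast+
qed

text \<open>For the symmetric Hessian H one has (H v) x (H v') = adj(H) (v x v'). Applying H once
  more recovers det(H) (v x v'), and these are its first two rows.\<close>

lemma cross_cofactor:
  fixes x y z x' y' z' :: int
  defines "W1 \<equiv> Qy x y z * Qz x' y' z' - Qz x y z * Qy x' y' z'"
    and "W2 \<equiv> Qz x y z * Qx x' y' z' - Qx x y z * Qz x' y' z'"
    and "W3 \<equiv> Qx x y z * Qy x' y' z' - Qy x y z * Qx x' y' z'"
  shows "2 * D4 * (y * z' - z * y') = 2 * a * W1 + b * W2 + d * W3"
    and "2 * D4 * (z * x' - x * z') = b * W1 + 2 * c * W2 + e * W3"
proof -
  define C1 C2 C3 where C: "C1 = y * z' - z * y'" "C2 = z * x' - x * z'" "C3 = x * y' - y * x'"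
  have W: "W1 = (4*c*f - e^2) * C1 + (d*e - 2*b*f) * C2 + (b*e - 2*c*d) * C3"
    "W2 = (d*e - 2*b*f) * C1 + (4*a*f - d^2) * C2 + (b*d - 2*a*e) * C3"
    "W3 = (b*e - 2*c*d) * C1 + (b*d - 2*a*e) * C2 + (4*a*c - b^2) * C3"
    unfolding assms C Qx_def Qy_def Qz_def by (simp_all add: power2_eq_square algebra_simps)
  show "2 * D4 * (y * z' - z * y') = 2 * a * W1 + b * W2 + d * W3"
    "2 * D4 * (z * x' - x * z') = b * W1 + 2 * c * W2 + e * W3"
    unfolding W C(1,2)[symmetric] by (simp_all add: power2_eq_square algebra_simps)
qed

text \<open>All gradients at stationary points are parallel to the frequency, hence to each other,
  and the gradient map is linear and invertible modulo p. So stationary points lie on one line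
  through the origin, with a loss of j if p^(j+1) does not divide the whole frequency.\<close>

lemma stationary_parallel:
  assumes "stationary k (r, s, t) (x, y, z)" "stationary k (r, s, t) (x', y', z')"
    and j: "\<not> (int p ^ Suc j dvd r \<and> int p ^ Suc j dvd s \<and> int p ^ Suc j dvd t)" "j \<le> k"
  shows "int p ^ (k - j) dvd y * z' - z * y'" "int p ^ (k - j) dvd x * z' - z * x'"
proof -
  obtain \<rho> where \<rho>: "\<rho> = r \<or> \<rho> = s \<or> \<rho> = t" "\<not> int p ^ Suc j dvd \<rho>" using j by blast
  note st = assms(1,2)[unfolded stationary_def prod.case]
  note W = cross_gradients[OF st(1)[THEN conjunct1] st(1)[THEN conjunct2, THEN conjunct1] st(1)[THEN conjunct2, THEN conjunct2]
      st(2)[THEN conjunct1] st(2)[THEN conjunct2, THEN conjunct1] st(2)[THEN conjunct2, THEN conjunct2] \<rho>(1)]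
  note W' = W[THEN power_dvd_cancel_partial[OF _ \<rho>(2) j(2)]]
  have unit: "\<not> int p dvd 2 * D4" using two_unit det_unit dvd_mult_iff by blast
  have "int p ^ (k - j) dvd 2 * D4 * (y * z' - z * y')"
    unfolding cross_cofactor(1)[where x = x and x' = x'] by (intro dvd_add dvd_mult W')
  then show "int p ^ (k - j) dvd y * z' - z * y'" using power_dvd_cancel[OF unit] by blast
  have "int p ^ (k - j) dvd 2 * D4 * (z * x' - x * z')"
    unfolding cross_cofactor(2)[where y = y and y' = y'] by (intro dvd_add dvd_mult W')
  then have "int p ^ (k - j) dvd z * x' - x * z'" using power_dvd_cancel[OF unit] by blast
  then show "int p ^ (k - j) dvd x * z' - z * x'" by (simp add: dvd_diff_commute)
qed

lemma card_linear_congruence: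
  assumes "\<not> int p dvd u" "l \<le> n"
  shows "card {y \<in> {0..<int (p ^ n)}. int p ^ l dvd y * u - w} \<le> p ^ (n - l)"
proof -
  let ?A = "{y \<in> {0..<int (p ^ n)}. int p ^ l dvd y * u - w}"
  have pos: "int p ^ l > 0" using prime_gt_0_nat[OF prime_p] by simp
  have pn: "int (p ^ n) = int p ^ (n - l) * int p ^ l"
    using assms(2) by (simp add: power_add[symmetric])
  have "inj_on (\<lambda>y. y div int p ^ l) ?A"
  proof (rule inj_onI)
    fix y y' assume y: "y \<in> ?A" "y' \<in> ?A" "y div int p ^ l = y' div int p ^ l"
    have "int p ^ l dvd y * u - w" "int p ^ l dvd y' * u - w" using y by auto
    from dvd_diff[OF this] have "int p ^ l dvd (y * u - w) - (y' * u - w)" .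
    then have "int p ^ l dvd u * (y - y')" by (simp add: algebra_simps)
    then have "int p ^ l dvd y - y'" using power_dvd_cancel[OF assms(1)] by blast
    then have "y mod int p ^ l = y' mod int p ^ l" by (simp add: mod_eq_dvd_iff)
    then show "y = y'" using y(3) by (metis div_mult_mod_eq)
  qed
  moreover have "(\<lambda>y. y div int p ^ l) ` ?A \<subseteq> {0..<int (p ^ (n - l))}"
  proof (rule image_subsetI)
    fix y assume "y \<in> ?A"
    then have y: "0 \<le> y" "y < int p ^ (n - l) * int p ^ l" unfolding pn by auto
    have "y div int p ^ l * int p ^ l \<le> y"
      using pos by (metis div_mult_mod_eq le_add_same_cancel1 pos_mod_sign)
    then have "y div int p ^ l < int p ^ (n - l)"
      using y(2) pos by (meson le_less_trans mult_less_cancel_right_pos)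
    then show "y div int p ^ l \<in> {0..<int (p ^ (n - l))}"
      using y(1) pos by (simp add: pos_imp_zdiv_nonneg_iff)
  qed
  ultimately have "card ?A \<le> card {0..<int (p ^ (n - l))}"
    by (intro card_inj_on_le) auto
  then show ?thesis by (simp del: of_nat_power)
qed

lemma card_linear_pairs:
  assumes "\<not> int p dvd u" "l \<le> n"
  shows "card {(y, z). y \<in> {0..<int (p ^ n)} \<and> z \<in> {0..<int (p ^ n)} \<and> int p ^ l dvd y * u - z * w}
    \<le> p ^ n * p ^ (n - l)"
proof -
  have fin: "finite {y \<in> {0..<int (p ^ n)}. int p ^ l dvd y * u - z * w}" for z
    by (rule finite_subset[of _ "{0..<int (p ^ n)}"]) auto
  have "{(y, z). y \<in> {0..<int (p ^ n)} \<and> z \<in> {0..<int (p ^ n)} \<and> int p ^ l dvd y * u - z * w}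
    = (\<lambda>(z, y). (y, z)) ` (SIGMA z:{0..<int (p ^ n)}. {y \<in> {0..<int (p ^ n)}. int p ^ l dvd y * u - z * w})"
    by force
  then have "card {(y, z). y \<in> {0..<int (p ^ n)} \<and> z \<in> {0..<int (p ^ n)} \<and> int p ^ l dvd y * u - z * w}
    \<le> card (SIGMA z:{0..<int (p ^ n)}. {y \<in> {0..<int (p ^ n)}. int p ^ l dvd y * u - z * w})"
    by (simp only:) (intro card_image_le finite_SigmaI finite_atLeastLessThan_int fin)
  also have "\<dots> = (\<Sum>z\<in>{0..<int (p ^ n)}. card {y \<in> {0..<int (p ^ n)}. int p ^ l dvd y * u - z * w})"
    by (intro card_SigmaI finite_atLeastLessThan_int ballI fin)
  also have "\<dots> \<le> (\<Sum>z\<in>{0..<int (p ^ n)}. p ^ (n - l))"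
    using card_linear_congruence[OF assms] by (intro sum_mono) blast
  also have "\<dots> = p ^ n * p ^ (n - l)" by (simp del: of_nat_power)
  finally show ?thesis .
qed

lemma small_dvd_eq:
  fixes x y :: int
  assumes "x \<in> {0..<m}" "y \<in> {0..<m}" "m dvd x - y" shows "x = y"
  using assms by (metis atLeastLessThan_iff mod_eq_dvd_iff mod_pos_pos_trivial)

text \<open>The uniqueness half of Hensel's lemma. The difference of two values of a quadratic
  polynomial factors in this way, with u the derivative and w the leading coefficient; modulo p the
  second factor is the unit u.\<close>

lemma simple_root_unique:
  assumes "\<not> int p dvd u" "int p dvd x - x'" "int p ^ n dvd (x - x') * (u - w * (x - x'))"
  shows "int p ^ n dvd x - x'"
proof -
  have "\<not> int p dvd u - w * (x - x')" using assms(1,2) by (metis dvd_mult dvd_diff_left_iff)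
  then show ?thesis using power_dvd_cancel assms(3) by (metis mult.commute)
qed

text \<open>Compare with one fixed stationary point: z is free, which gives p^n choices;
  proportionality modulo p^(k-j) leaves p^(n-(k-j)) values of a second coordinate; the equation
  determines the third one within its class modulo p. The factor p^3 counts classes, and 2 counts
  which partial derivative is a unit.\<close>

lemma card_stationary:
  assumes n: "n \<ge> 1" and k: "k \<le> n" "j \<le> k"
    and j: "\<not> (int p ^ Suc j dvd r \<and> int p ^ Suc j dvd s \<and> int p ^ Suc j dvd t)"
  shows "card {v \<in> cube (p ^ n). sol n v \<and> stationary k (r, s, t) v} \<le> p ^ 3 * (2 * (p ^ n * p ^ (n - (k - j))))"
proof (cases "{v \<in> cube (p ^ n). sol n v \<and> stationary k (r, s, t) v} = {}")
  case True
  then show ?thesis by (metis card.empty le0)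
next
  case False
  let ?V = "{v \<in> cube (p ^ n). sol n v \<and> stationary k (r, s, t) v}"
  let ?P = "\<lambda>u w. {(y, z). y \<in> {0..<int (p ^ n)} \<and> z \<in> {0..<int (p ^ n)} \<and> int p ^ (k - j) dvd y * u - z * w}"
  obtain x' y' z' where v': "(x', y', z') \<in> ?V" using False by auto
  then have z': "\<not> int p dvd z'" by simp
  have pos: "p > 0" using prime_gt_0_nat[OF prime_p] .
  have par: "int p ^ (k - j) dvd y * z' - z * y'" "int p ^ (k - j) dvd x * z' - z * x'"
    if "(x, y, z) \<in> ?V" for x y z
    using stationary_parallel[OF _ _ j k(2), of x y z x' y' z'] that v' by auto
  \<comment> \<open>Inside a class modulo p the root is simple, so x is determined by (y, z) on
    \<open>VX\<close>, and y by (x, z) on \<open>VY\<close>.\<close>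
  define VX where "VX \<rho> = {(x, y, z) \<in> ?V. red p (x, y, z) = \<rho> \<and> \<not> int p dvd Qx x y z}" for \<rho>
  define VY where "VY \<rho> = {(x, y, z) \<in> ?V. red p (x, y, z) = \<rho> \<and> \<not> int p dvd Qy x y z}" for \<rho>
  have finP: "finite (?P u w)" for u w
    by (rule finite_subset[of _ "{0..<int (p ^ n)} \<times> {0..<int (p ^ n)}"]) auto
  have l: "k - j \<le> n" using k by simp
  have bX: "card (VX \<rho>) \<le> p ^ n * p ^ (n - (k - j))" for \<rho>
  proof -
    have "inj_on (\<lambda>(x, y, z). (y, z)) (VX \<rho>)"
    proof (rule inj_onI, clarsimp)
      fix x x1 y z assume A: "(x, y, z) \<in> VX \<rho>" "(x1, y, z) \<in> VX \<rho>"
      have "int p ^ n dvd Q x y z - Q x1 y z" using A unfolding VX_def by (intro dvd_diff) auto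
      also have "Q x y z - Q x1 y z = (x - x1) * (Qx x y z - a * (x - x1))"
        by (simp add: Qx_def ternary_form_def power2_eq_square algebra_simps)
      finally have *: "int p ^ n dvd (x - x1) * (Qx x y z - a * (x - x1))" .
      have "int p dvd x - x1" "\<not> int p dvd Qx x y z"
        using A unfolding VX_def by (auto simp: mod_eq_dvd_iff)
      with * have "int (p ^ n) dvd x - x1" using simple_root_unique by simp
      then show "x = x1" using A unfolding VX_def cube_def by (intro small_dvd_eq[of x "int (p ^ n)"]) auto
    qed
    moreover have "(\<lambda>(x, y, z). (y, z)) ` VX \<rho> \<subseteq> ?P z' y'"
      using par unfolding VX_def cube_def by auto
    ultimately have "card (VX \<rho>) \<le> card (?P z' y')" using finP by (intro card_inj_on_le) auto
    then show ?thesis using card_linear_pairs[OF z' l, of y'] by linarith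
  qed
  have bY: "card (VY \<rho>) \<le> p ^ n * p ^ (n - (k - j))" for \<rho>
  proof -
    have "inj_on (\<lambda>(x, y, z). (x, z)) (VY \<rho>)"
    proof (rule inj_onI, clarsimp)
      fix x y y1 z assume A: "(x, y, z) \<in> VY \<rho>" "(x, y1, z) \<in> VY \<rho>"
      have "int p ^ n dvd Q x y z - Q x y1 z" using A unfolding VY_def by (intro dvd_diff) auto
      also have "Q x y z - Q x y1 z = (y - y1) * (Qy x y z - c * (y - y1))"
        by (simp add: Qy_def ternary_form_def power2_eq_square algebra_simps)
      finally have *: "int p ^ n dvd (y - y1) * (Qy x y z - c * (y - y1))" .
      have "int p dvd y - y1" "\<not> int p dvd Qy x y z"
        using A unfolding VY_def by (auto simp: mod_eq_dvd_iff)
      with * have "int (p ^ n) dvd y - y1" using simple_root_unique by simp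
      then show "y = y1" using A unfolding VY_def cube_def by (intro small_dvd_eq[of y "int (p ^ n)"]) auto
    qed
    moreover have "(\<lambda>(x, y, z). (x, z)) ` VY \<rho> \<subseteq> ?P z' x'"
      using par unfolding VY_def cube_def by auto
    ultimately have "card (VY \<rho>) \<le> card (?P z' x')" using finP by (intro card_inj_on_le) auto
    then show ?thesis using card_linear_pairs[OF z' l, of x'] by linarith
  qed
  have finV: "finite (VX \<rho> \<union> VY \<rho>)" for \<rho>
    by (rule finite_subset[of _ "cube (p ^ n)"]) (auto simp: VX_def VY_def)
  have "?V \<subseteq> (\<Union>\<rho>\<in>cube p. VX \<rho> \<union> VY \<rho>)"
  proof
    fix v assume v: "v \<in> ?V"
    obtain x y z where xyz: "v = (x, y, z)" by (cases v)
    have "int p dvd Q x y z" using v n p_dvd_power dvd_trans unfolding xyz by auto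
    then have "\<not> int p dvd Qx x y z \<or> \<not> int p dvd Qy x y z" using gradient_unit v unfolding xyz by auto
    then have "v \<in> VX (red p v) \<union> VY (red p v)" using v unfolding VX_def VY_def xyz by auto
    then show "v \<in> (\<Union>\<rho>\<in>cube p. VX \<rho> \<union> VY \<rho>)" using red_in_cube[OF pos] by blast
  qed
  then have "card ?V \<le> card (\<Union>\<rho>\<in>cube p. VX \<rho> \<union> VY \<rho>)"
    using finV by (intro card_mono) auto
  also have "\<dots> \<le> (\<Sum>\<rho>\<in>cube p. card (VX \<rho> \<union> VY \<rho>))" by (rule card_UN_le) simp
  also have "\<dots> \<le> (\<Sum>\<rho>\<in>cube p. 2 * (p ^ n * p ^ (n - (k - j))))"
  proof (rule sum_mono)
    fix \<rho>
    have "card (VX \<rho> \<union> VY \<rho>) \<le> card (VX \<rho>) + card (VY \<rho>)" by (rule card_Un_le)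
    then show "card (VX \<rho> \<union> VY \<rho>) \<le> 2 * (p ^ n * p ^ (n - (k - j)))" using bX[of \<rho>] bY[of \<rho>] by linarith
  qed
  finally show ?thesis by simp
qed

text \<open>After localisation every term is bounded by 1. The exponent is 3n/2 + j up to rounding,
  the square-root saving for two-dimensional solution sets, weakened by the common power p^j in the
  frequency.\<close>

lemma exp_sum_bound:
  assumes n: "n \<ge> 1" and j: "j \<le> n div 2"
    and "\<not> (int p ^ Suc j dvd r \<and> int p ^ Suc j dvd s \<and> int p ^ Suc j dvd t)"
  shows "norm (\<Sum>v\<in>{v \<in> cube (p ^ n). sol n v}. wave (p ^ n) (r, s, t) v)
    \<le> real (2 * p ^ 3 * p ^ (n + (n - n div 2) + j))"
proof -
  let ?k = "n div 2"
  let ?V = "{v \<in> cube (p ^ n). sol n v \<and> stationary ?k (r, s, t) v}"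
  have "norm (\<Sum>v\<in>{v \<in> cube (p ^ n). sol n v}. wave (p ^ n) (r, s, t) v) =
      norm (\<Sum>v\<in>?V. wave (p ^ n) (r, s, t) v)"
    using exp_sum_stationary[OF n, of ?k "n - ?k" "(r, s, t)"] by simp
  also have "\<dots> \<le> (\<Sum>v\<in>?V. norm (wave (p ^ n) (r, s, t) v))" by (rule norm_sum)
  also have "\<dots> = real (card ?V)" by simp
  also have "\<dots> \<le> real (p ^ 3 * (2 * (p ^ n * p ^ (n - (?k - j)))))"
    using card_stationary[OF n _ j assms(3)] by (intro of_nat_mono) simp
  also have "p ^ 3 * (2 * (p ^ n * p ^ (n - (?k - j)))) = 2 * p ^ 3 * p ^ (n + (n - ?k) + j)"
  proof -
    have "n - (?k - j) = (n - ?k) + j" using j by simp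
    then show ?thesis by (simp only: power_add mult_ac)
  qed
  finally show ?thesis .
qed

end

section \<open>The number of solutions modulo \<open>p ^ n\<close>\<close>

context form_mod_prime
begin

lemma p_odd_gt: "p > 2"
  using prime_p odd_p prime_ge_2_nat[of p] by (cases "p = 2") auto

lemma small_dvd_zero:
  fixes x :: int
  assumes "int p dvd x" "\<bar>x\<bar> < int p" shows "x = 0"
  using assms by (metis dvd_imp_le_int not_less abs_of_nat)

lemma squares_distinct:
  assumes "int p dvd u^2 - v^2" "u \<in> {0..int (p div 2)}" "v \<in> {0..int (p div 2)}"
  shows "u = v"
proof -
  have "u^2 - v^2 = (u - v) * (u + v)" by (simp add: power2_eq_square algebra_simps)
  then consider "int p dvd u - v" | "int p dvd u + v" using assms(1) dvd_mult_iff by metis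
  then show ?thesis
  proof cases
    case 1
    moreover have "\<bar>u - v\<bar> < int p" using assms(2,3) p_odd_gt by auto
    ultimately show ?thesis using small_dvd_zero by fastforce
  next
    case 2
    have "2 * (p div 2) < p" using odd_p by presburger
    then have "\<bar>u + v\<bar> < int p" using assms(2,3) by auto
    then have "u + v = 0" using 2 small_dvd_zero by blast
    then show ?thesis using assms(2,3) by auto
  qed
qed

text \<open>Pigeonhole: on 0, ..., (p-1)/2 squares are distinct modulo p, so \<alpha> u^2 and
  \<gamma> - \<beta> v^2 take (p+1)/2 values each, which is too many to be disjoint among p
  residues.\<close>

lemma binary_represents:
  assumes "\<not> int p dvd \<alpha>" "\<not> int p dvd \<beta>"
  obtains u v where "int p dvd \<alpha> * u^2 + \<beta> * v^2 - \<gamma>"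
proof -
  let ?I = "{0..int (p div 2)}"
  define F G where "F u = (\<alpha> * u^2) mod int p" and "G v = (\<gamma> - \<beta> * v^2) mod int p" for u v
  have pos: "int p > 0" using p_odd_gt by simp
  have injF: "inj_on F ?I"
  proof (rule inj_onI)
    fix u v assume A: "u \<in> ?I" "v \<in> ?I" "F u = F v"
    then have "int p dvd \<alpha> * u^2 - \<alpha> * v^2" by (simp add: F_def mod_eq_dvd_iff)
    then have "int p dvd \<alpha> * (u^2 - v^2)" by (simp only: right_diff_distrib)
    then show "u = v" using squares_distinct A(1,2) assms(1) dvd_mult_iff by blast
  qed
  have injG: "inj_on G ?I"
  proof (rule inj_onI)
    fix u v assume A: "u \<in> ?I" "v \<in> ?I" "G u = G v"
    then have "int p dvd (\<gamma> - \<beta> * u^2) - (\<gamma> - \<beta> * v^2)" by (simp add: G_def mod_eq_dvd_iff)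
    also have "(\<gamma> - \<beta> * u^2) - (\<gamma> - \<beta> * v^2) = \<beta> * (v^2 - u^2)" by (simp add: algebra_simps)
    finally show "u = v" using squares_distinct[of v u] A(1,2) assms(2) dvd_mult_iff by blast
  qed
  have "F ` ?I \<inter> G ` ?I \<noteq> {}"
  proof
    assume disj: "F ` ?I \<inter> G ` ?I = {}"
    have "card (F ` ?I \<union> G ` ?I) = card ?I + card ?I"
      using disj by (subst card_Un_disjoint) (simp_all add: card_image[OF injF] card_image[OF injG])
    moreover have "F ` ?I \<union> G ` ?I \<subseteq> {0..<int p}" using pos by (auto simp: F_def G_def)
    then have "card (F ` ?I \<union> G ` ?I) \<le> card {0..<int p}" by (intro card_mono) auto
    moreover have "card ?I = p div 2 + 1" by simp
    moreover have "2 * (p div 2) + 2 > p" using odd_p by presburger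
    ultimately show False by simp
  qed
  then obtain u v where "F u = G v" by blast
  then have "int p dvd \<alpha> * u^2 - (\<gamma> - \<beta> * v^2)" by (simp add: F_def G_def mod_eq_dvd_iff)
  then show ?thesis by (intro that[of u v]) (simp add: algebra_simps)
qed

section \<open>Points on binary norm forms and affine conics modulo p\<close>

definition square :: "(int \<times> int) set" where
  "square = {0..<int p} \<times> {0..<int p}"

text \<open>y^2 + D x^2 is the norm of y + x sqrt(-D), where -D is the discriminant b^2 -
  4ac.\<close>

definition norm_fibre :: "int \<Rightarrow> (int \<times> int) set" where
  "norm_fibre m = {(x, y) \<in> square. int p dvd y^2 + D * x^2 - m}"

lemma finite_square [simp]: "finite square"
  by (simp add: square_def)

lemma finite_norm_fibre [simp]: "finite (norm_fibre m)"
  by (rule finite_subset[of _ square]) (auto simp: norm_fibre_def)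

lemma mod_eq_imp_dvd: "x mod int p = y mod int p \<Longrightarrow> int p dvd x - y"
  by (simp add: mod_eq_dvd_iff)

lemma dvd_mod_diff: "int p dvd x mod int p - x" 
  by (simp add: mod_eq_dvd_iff[symmetric])

lemma range_eq_of_dvd:
  fixes x y :: int
  assumes "x \<in> {0..<int p}" "y \<in> {0..<int p}" "int p dvd x - y" shows "x = y"
  using assms by (metis atLeastLessThan_iff mod_eq_dvd_iff mod_pos_pos_trivial)

lemma binary_cong:
  assumes "int p dvd x - x'" "int p dvd y - y'"
  shows "int p dvd y^2 + D * x^2 - m \<longleftrightarrow> int p dvd y'^2 + D * x'^2 - m"
proof (rule dvd_diff_iff_cong)
  have "(y^2 + D * x^2 - m) - (y'^2 + D * x'^2 - m) = (y - y') * (y + y') + (x - x') * (D * (x + x'))"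
    by (simp add: power2_eq_square algebra_simps)
  then show "int p dvd (y^2 + D * x^2 - m) - (y'^2 + D * x'^2 - m)"
    using assms by (simp only: dvd_add dvd_mult2)
qed

text \<open>Multiplication by an element of norm \<open>m' / m\<close> maps one norm fibre into the other.\<close>

lemma card_norm_fibre_le:
  assumes "\<not> int p dvd m" "\<not> int p dvd m'"
  shows "card (norm_fibre m) \<le> card (norm_fibre m')"
proof -
  have "\<not> int p dvd D * m" using disc_unit assms(1) dvd_mult_iff by blast
  then obtain u v where uv: "int p dvd m * u^2 + (D * m) * v^2 - m'"
    using binary_represents[OF assms(1)] by metis
  define w where "w = u^2 + D * v^2"
  have wm: "int p dvd w * m - m'" using uv by (simp add: w_def algebra_simps)
  have w: "\<not> int p dvd w" using wm assms(2) by (metis dvd_diff_iff_cong dvd_mult2)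
  \<comment> \<open>Multiplication of y + x sqrt(-D) by u + v sqrt(-D), whose norm \<open>w\<close>
    is m'/m modulo p. Multiplying by the conjugate yields injectivity below.\<close>
  define T where "T = (\<lambda>(x, y). ((u * x + v * y) mod int p, (u * y - D * v * x) mod int p))"
  have pos: "int p > 0" using p_odd_gt by simp
  have "inj_on T (norm_fibre m)"
  proof (rule inj_onI, clarify)
    fix x y x' y' assume A: "(x, y) \<in> norm_fibre m" "(x', y') \<in> norm_fibre m" "T (x, y) = T (x', y')"
    have 1: "int p dvd (u * x + v * y) - (u * x' + v * y')"
      and 2: "int p dvd (u * y - D * v * x) - (u * y' - D * v * x')"
      using A(3) unfolding T_def prod.case prod.inject by (simp_all only: mod_eq_imp_dvd)
    have "w * (x - x') = u * ((u * x + v * y) - (u * x' + v * y')) - v * ((u * y - D * v * x) - (u * y' - D * v * x'))"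
      by (simp add: w_def power2_eq_square algebra_simps)
    then have "int p dvd w * (x - x')" using 1 2 by (simp only: dvd_diff dvd_mult)
    moreover have "w * (y - y') = D * v * ((u * x + v * y) - (u * x' + v * y')) + u * ((u * y - D * v * x) - (u * y' - D * v * x'))"
      by (simp add: w_def power2_eq_square algebra_simps)
    then have "int p dvd w * (y - y')" using 1 2 by (simp only: dvd_add dvd_mult)
    ultimately have "int p dvd x - x'" "int p dvd y - y'" using w dvd_mult_iff by blast+
    then show "x = x' \<and> y = y'"
      using A(1,2) unfolding norm_fibre_def square_def by (auto intro: range_eq_of_dvd)
  qed
  moreover have "T ` norm_fibre m \<subseteq> norm_fibre m'"
  proof (rule image_subsetI, clarify)
    fix x y assume A: "(x, y) \<in> norm_fibre m"
    have "(u * y - D * v * x)^2 + D * (u * x + v * y)^2 - m' = w * (y^2 + D * x^2 - m) + (w * m - m')"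
      by (simp add: w_def power2_eq_square algebra_simps)
    moreover have "int p dvd y^2 + D * x^2 - m" using A by (simp add: norm_fibre_def)
    ultimately have "int p dvd (u * y - D * v * x)^2 + D * (u * x + v * y)^2 - m'"
      using wm by (simp only: dvd_add dvd_mult)
    then have "int p dvd ((u * y - D * v * x) mod int p)^2 + D * ((u * x + v * y) mod int p)^2 - m'"
      by (simp only: binary_cong[OF dvd_mod_diff dvd_mod_diff])
    then show "T (x, y) \<in> norm_fibre m'"
      using pos by (simp add: T_def norm_fibre_def square_def)
  qed
  ultimately show ?thesis by (intro card_inj_on_le) auto
qed

lemma Legendre_cases:
  "(Legendre (b^2 - 4*a*c) (int p) = 1 \<and> (\<exists>h. int p dvd h^2 + D)) \<or>
   (Legendre (b^2 - 4*a*c) (int p) = -1 \<and> (\<forall>h. \<not> int p dvd h^2 + D))"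
proof -
  have "\<not> [b^2 - 4*a*c = 0] (mod int p)"
    using disc_unit by (metis cong_0_iff dvd_minus_iff minus_diff_eq)
  moreover have "QuadRes (int p) (b^2 - 4*a*c) \<longleftrightarrow> (\<exists>h. int p dvd h^2 + D)"
    unfolding QuadRes_def cong_iff_dvd_diff by (simp add: algebra_simps)
  ultimately show ?thesis unfolding Legendre_def by auto
qed

text \<open>If -D is a square, the norm form splits into two lines meeting only at the origin,
  giving 2p - 1 points; otherwise it is anisotropic and only the origin remains. The formula covers
  both values of the Legendre symbol.\<close>

lemma card_norm_fibre_0:
  "int (card (norm_fibre 0)) = int p + (int p - 1) * Legendre (b^2 - 4*a*c) (int p)"
proof -
  have pos: "int p > 0" using p_odd_gt by simp
  have zero: "(0, y) \<in> norm_fibre 0 \<longleftrightarrow> y = 0" for y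
  proof
    assume "(0, y) \<in> norm_fibre 0"
    then have "int p dvd y" "y \<in> {0..<int p}"
      by (simp_all add: norm_fibre_def square_def power2_eq_square dvd_mult_iff)
    then show "y = 0" using range_eq_of_dvd[of y 0] pos by simp
  qed (use pos in \<open>simp add: norm_fibre_def square_def\<close>)
  consider (res) h where "Legendre (b^2 - 4*a*c) (int p) = 1" "int p dvd h^2 + D"
    | (non) "Legendre (b^2 - 4*a*c) (int p) = -1" "\<forall>h. \<not> int p dvd h^2 + D"
    using Legendre_cases by blast
  then show ?thesis
  proof cases
    case res
    let ?A = "{1..<int p}"
    have h: "\<not> int p dvd h"
    proof
      assume "int p dvd h"
      then have "int p dvd D" using res(2) by (metis dvd_add_right_iff dvd_mult2 power2_eq_square)
      then show False using disc_unit by blast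
    qed
    have eq: "norm_fibre 0 = {(0, 0)} \<union> (\<lambda>x. (x, (h * x) mod int p)) ` ?A \<union> (\<lambda>x. (x, (- h * x) mod int p)) ` ?A"
      (is "_ = _ \<union> ?B \<union> ?C")
    proof -
      have mem: "(x, y) \<in> norm_fibre 0 \<longleftrightarrow> y = (h * x) mod int p \<or> y = (- h * x) mod int p"
        if x: "x \<in> {0..<int p}" and y: "y \<in> {0..<int p}" for x y
      proof -
        have "y^2 + D * x^2 - 0 = (y - h * x) * (y + h * x) + (h^2 + D) * x^2"
          by (simp add: power2_eq_square algebra_simps)
        then have "(x, y) \<in> norm_fibre 0 \<longleftrightarrow> int p dvd (y - h * x) * (y + h * x)"
          using x y res(2) by (simp add: norm_fibre_def square_def dvd_add_left_iff)
        also have "\<dots> \<longleftrightarrow> int p dvd y - h * x \<or> int p dvd y - (- h * x)"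
          using dvd_mult_iff by simp
        also have "\<dots> \<longleftrightarrow> y mod int p = (h * x) mod int p \<or> y mod int p = (- h * x) mod int p"
          by (simp only: mod_eq_dvd_iff)
        finally show ?thesis using y by simp
      qed
      show ?thesis
      proof (rule Set.set_eqI)
        fix v :: "int \<times> int"
        obtain x y where v: "v = (x, y)" by (cases v)
        show "v \<in> norm_fibre 0 \<longleftrightarrow> v \<in> {(0, 0)} \<union> ?B \<union> ?C"
        proof (cases "x \<in> {0..<int p} \<and> y \<in> {0..<int p}")
          case True
          then show ?thesis using mem[of x y] unfolding v by (cases "x = 0") (auto simp: image_iff)
        next
          case False
          then show ?thesis using pos unfolding v by (auto simp: norm_fibre_def square_def)
        qed
      qed
    qed
    have disj: "?B \<inter> ?C = {}"
    proof (rule equals0I)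
      fix v assume "v \<in> ?B \<inter> ?C"
      then obtain x x' where v: "x \<in> ?A" "v = (x, (h * x) mod int p)" "v = (x', (- h * x') mod int p)"
        by blast
      then have "x' = x" by simp
      then have x: "x \<in> ?A" "(h * x) mod int p = (- h * x) mod int p"
        using v(1) v(2)[symmetric, unfolded v(3)] by simp_all
      then have "int p dvd 2 * (h * x)" by (simp add: mod_eq_dvd_iff)
      then have "int p dvd x" using h two_unit dvd_mult_iff by blast
      then show False using x(1) zdvd_not_zless by auto
    qed
    have "card ?B = p - 1" "card ?C = p - 1"
      by (subst card_image; auto simp: inj_on_def)+
    then have "card (norm_fibre 0) = 1 + ((p - 1) + (p - 1))"
      unfolding eq Un_assoc using disj
      by (subst card_Un_disjoint) (auto simp: card_Un_disjoint)
    then show ?thesis using res(1) p_odd_gt by simp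
  next
    case non
    have "norm_fibre 0 = {(0, 0)}"
    proof (rule Set.set_eqI)
      fix v :: "int \<times> int"
      obtain x y where v: "v = (x, y)" by (cases v)
      show "v \<in> norm_fibre 0 \<longleftrightarrow> v \<in> {(0, 0)}"
      proof (cases "x = 0")
        case True
        then show ?thesis using zero v by simp
      next
        case False
        have "v \<notin> norm_fibre 0"
        proof
          assume "v \<in> norm_fibre 0"
          then have x: "x \<in> {0..<int p}" and d: "int p dvd y^2 + D * x^2"
            unfolding v by (auto simp: norm_fibre_def square_def)
          then have "\<not> int p dvd x" using False zdvd_not_zless by auto
          then have "coprime x (int p)" using coprime_p_iff by blast
          then obtain i where i: "[x * i = 1] (mod int p)" using cong_solve_coprime_int by blast
          then have i': "int p dvd x * i - 1" by (simp add: cong_iff_dvd_diff)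
          \<comment> \<open>\<open>i\<close> is the inverse of x, so a zero with non-zero x would
            exhibit y/x as a square root of -D.\<close>
          have "(y * i)^2 + D = i^2 * (y^2 + D * x^2) - (x * i - 1) * (D * (x * i + 1))"
            by (simp add: power2_eq_square algebra_simps)
          then have "int p dvd (y * i)^2 + D" using d i' by (simp only: dvd_diff dvd_mult dvd_mult2)
          then show False using non(2) by blast
        qed
        then show ?thesis using False v by simp
      qed
    qed
    then show ?thesis using non(1) by simp
  qed
qed

text \<open>All p - 1 fibres over non-zero residues have the same size, and together with the fibre
  over 0 they partition p^2 points; solving for the common size gives the claim.\<close>

lemma card_norm_fibre:
  assumes "\<not> int p dvd m"
  shows "int (card (norm_fibre m)) = int p - Legendre (b^2 - 4*a*c) (int p)"
proof -
  let ?s = "Legendre (b^2 - 4*a*c) (int p)"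
  have pos: "int p > 0" using p_odd_gt by simp
  have eq: "card (norm_fibre i) = card (norm_fibre m)" if "i \<in> {1..<int p}" for i
    using that assms card_norm_fibre_le[of i m] card_norm_fibre_le[of m i] zdvd_not_zless[of i "int p"] by fastforce
  have "square = (\<Union>i\<in>{0..<int p}. norm_fibre i)"
  proof (rule Set.set_eqI)
    fix v :: "int \<times> int"
    obtain x y where v: "v = (x, y)" by (cases v)
    have "int p dvd (y^2 + D * x^2) - (y^2 + D * x^2) mod int p" by (simp add: mod_eq_dvd_iff[symmetric])
    moreover have "(y^2 + D * x^2) mod int p \<in> {0..<int p}" using pos by simp
    ultimately show "v \<in> square \<longleftrightarrow> v \<in> (\<Union>i\<in>{0..<int p}. norm_fibre i)"
      unfolding norm_fibre_def v by blast
  qed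
  then have "card square = (\<Sum>i\<in>{0..<int p}. card (norm_fibre i))"
  proof (simp only:, intro card_UN_disjoint ballI impI)
    fix i j assume ij: "i \<in> {0..<int p}" "j \<in> {0..<int p}" "i \<noteq> j"
    show "norm_fibre i \<inter> norm_fibre j = {}"
    proof (rule ccontr)
      assume "norm_fibre i \<inter> norm_fibre j \<noteq> {}"
      then obtain x y where "int p dvd y^2 + D * x^2 - i" "int p dvd y^2 + D * x^2 - j"
        by (auto simp: norm_fibre_def)
      from dvd_diff[OF this(2,1)] have "int p dvd i - j" by (simp add: algebra_simps)
      then show False using ij range_eq_of_dvd by blast
    qed
  qed auto
  also have "{0..<int p} = insert 0 {1..<int p}" using pos by auto
  also have "(\<Sum>i\<in>insert 0 {1..<int p}. card (norm_fibre i)) = card (norm_fibre 0) + (\<Sum>i\<in>{1..<int p}. card (norm_fibre m))"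
  proof -
    have "(\<Sum>i\<in>{1..<int p}. card (norm_fibre i)) = (\<Sum>i\<in>{1..<int p}. card (norm_fibre m))"
      by (intro sum.cong refl eq)
    then show ?thesis by simp
  qed
  finally have "card square = card (norm_fibre 0) + nat (int p - 1) * card (norm_fibre m)" by simp
  moreover have "nat (int p - 1) = p - 1" by simp
  ultimately have "card square = card (norm_fibre 0) + (p - 1) * card (norm_fibre m)" by simp
  moreover have "card square = p * p" by (simp add: square_def)
  ultimately have "int (p * p) = int (card (norm_fibre 0) + (p - 1) * card (norm_fibre m))" by metis
  then have "int p * int p = int (card (norm_fibre 0)) + (int p - 1) * int (card (norm_fibre m))"
    using p_odd_gt by (simp add: of_nat_diff)
  then have "(int p - 1) * int (card (norm_fibre m)) = (int p - 1) * (int p - ?s)"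
    unfolding card_norm_fibre_0 by (simp add: algebra_simps)
  then show ?thesis using p_odd_gt by simp
qed

text \<open>Completing the squares turns the affine conic \<open>Q(x, y, z) = 0\<close> into a norm fibre.\<close>

lemma complete_squares:
  "4 * a * D * Q x y z = (D * y + (2*a*e - b*d) * z)^2 + D * (2*a*x + b*y + d*z)^2 + 4 * a * D4 * z^2"
  by (simp add: ternary_form_def power2_eq_square algebra_simps)

text \<open>For fixed z the substitution that completes the squares is affine in (x, y) with
  determinant 2 a D, a unit, hence a bijection of the residue pairs.\<close>

lemma card_affine_conic:
  assumes z: "\<not> int p dvd z"
  shows "card {(x, y) \<in> square. int p dvd Q x y z} = card (norm_fibre (- 4 * a * D4 * z^2))"
proof -
  have pos: "int p > 0" using p_odd_gt by simp
  define T where "T = (\<lambda>(x, y). ((2*a*x + b*y + d*z) mod int p, (D * y + (2*a*e - b*d) * z) mod int p))"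
  have inj: "inj_on T square"
  proof (rule inj_onI, clarify)
    fix x y x' y' assume A: "(x, y) \<in> square" "(x', y') \<in> square" "T (x, y) = T (x', y')"
    have 1: "int p dvd (2*a*x + b*y + d*z) - (2*a*x' + b*y' + d*z)"
      and 2: "int p dvd (D * y + (2*a*e - b*d) * z) - (D * y' + (2*a*e - b*d) * z)"
      using A(3) unfolding T_def prod.case prod.inject by (simp_all only: mod_eq_imp_dvd)
    have "(D * y + (2*a*e - b*d) * z) - (D * y' + (2*a*e - b*d) * z) = D * (y - y')" by (simp add: algebra_simps)
    then have y: "int p dvd y - y'" using 2 disc_unit dvd_mult_iff by metis
    have "2 * (a * (x - x')) = ((2*a*x + b*y + d*z) - (2*a*x' + b*y' + d*z)) - b * (y - y')" by (simp add: algebra_simps)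
    then have "int p dvd 2 * (a * (x - x'))" using 1 y by (simp only: dvd_diff dvd_mult)
    then have "int p dvd x - x'" using a_unit two_unit dvd_mult_iff by blast
    with y show "x = x' \<and> y = y'"
      using A(1,2) unfolding square_def by (auto intro: range_eq_of_dvd)
  qed
  have "T ` square \<subseteq> square" using pos by (auto simp: T_def square_def)
  then have img: "T ` square = square" using inj by (intro endo_inj_surj) simp_all
  have key: "T v \<in> norm_fibre (- 4 * a * D4 * z^2) \<longleftrightarrow> int p dvd Q (fst v) (snd v) z" if "v \<in> square" for v
  proof -
    obtain x y where v: "v = (x, y)" by (cases v)
    have "T v \<in> norm_fibre (- 4 * a * D4 * z^2) \<longleftrightarrow>
        int p dvd ((D * y + (2*a*e - b*d) * z) mod int p)^2 + D * ((2*a*x + b*y + d*z) mod int p)^2 - (- 4 * a * D4 * z^2)"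
      using pos unfolding v T_def norm_fibre_def square_def by simp
    also have "\<dots> \<longleftrightarrow> int p dvd (D * y + (2*a*e - b*d) * z)^2 + D * (2*a*x + b*y + d*z)^2 - (- 4 * a * D4 * z^2)"
      by (rule binary_cong[OF dvd_mod_diff dvd_mod_diff])
    also have "(D * y + (2*a*e - b*d) * z)^2 + D * (2*a*x + b*y + d*z)^2 - (- 4 * a * D4 * z^2) = 2 * (2 * (a * (D * Q x y z)))"
      using complete_squares[of x y z] by simp
    also have "int p dvd \<dots> \<longleftrightarrow> int p dvd Q x y z" by (simp only: dvd_mult_iff two_unit a_unit disc_unit simp_thms)
    finally show ?thesis by (simp add: v)
  qed
  have img': "T ` {(x, y) \<in> square. int p dvd Q x y z} = norm_fibre (- 4 * a * D4 * z^2)"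
  proof
    show "T ` {(x, y) \<in> square. int p dvd Q x y z} \<subseteq> norm_fibre (- 4 * a * D4 * z^2)"
      using key by fastforce
    show "norm_fibre (- 4 * a * D4 * z^2) \<subseteq> T ` {(x, y) \<in> square. int p dvd Q x y z}"
    proof
      fix w assume w: "w \<in> norm_fibre (- 4 * a * D4 * z^2)"
      then have "w \<in> square" by (auto simp: norm_fibre_def)
      then obtain v where v: "v \<in> square" "w = T v" using img by blast
      then have "int p dvd Q (fst v) (snd v) z" using key w by blast
      then show "w \<in> T ` {(x, y) \<in> square. int p dvd Q x y z}" using v by (auto simp: case_prod_unfold)
    qed
  qed
  have "inj_on T {(x, y) \<in> square. int p dvd Q x y z}"
    using inj by (rule inj_on_subset) auto
  from card_image[OF this] show ?thesis unfolding img' by simp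
qed

lemma card_sol_1:
  "int (card {v \<in> cube (p ^ 1). sol 1 v}) = (int p - 1) * (int p - Legendre (b^2 - 4*a*c) (int p))"
proof -
  have pos: "int p > 0" using p_odd_gt by simp
  have unit: "\<not> int p dvd z" if "z \<in> {1..<int p}" for z using that zdvd_not_zless by auto
  have "{v \<in> cube (p ^ 1). sol 1 v} =
      (\<lambda>(z, x, y). (x, y, z)) ` (SIGMA z:{1..<int p}. {(x, y) \<in> square. int p dvd Q x y z})"
  proof (rule Set.set_eqI)
    fix v :: "int \<times> int \<times> int"
    obtain x y z where v: "v = (x, y, z)" by (cases v)
    have "z \<in> {0..<int p} \<and> \<not> int p dvd z \<longleftrightarrow> z \<in> {1..<int p}"
      using unit by (cases "z = 0") auto
    then show "v \<in> {v \<in> cube (p ^ 1). sol 1 v} \<longleftrightarrow>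
      v \<in> (\<lambda>(z, x, y). (x, y, z)) ` (SIGMA z:{1..<int p}. {(x, y) \<in> square. int p dvd Q x y z})"
      unfolding v by (auto simp: cube_def square_def image_iff)
  qed
  then have "card {v \<in> cube (p ^ 1). sol 1 v} = card (SIGMA z:{1..<int p}. {(x, y) \<in> square. int p dvd Q x y z})"
    by (simp only:) (rule card_image, auto simp: inj_on_def)
  also have "\<dots> = (\<Sum>z\<in>{1..<int p}. card {(x, y) \<in> square. int p dvd Q x y z})"
    by (intro card_SigmaI) (auto intro: finite_subset[of _ square])
  finally have "int (card {v \<in> cube (p ^ 1). sol 1 v}) = (\<Sum>z\<in>{1..<int p}. int (card {(x, y) \<in> square. int p dvd Q x y z}))"
    by simp
  also have "\<dots> = (\<Sum>z\<in>{1..<int p}. int p - Legendre (b^2 - 4*a*c) (int p))"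
  proof (rule sum.cong[OF refl])
    fix z assume z: "z \<in> {1..<int p}"
    then have "\<not> int p dvd 2 * (2 * (a * (D4 * (z * z))))"
      using unit[OF z] by (simp only: dvd_mult_iff two_unit a_unit det_unit simp_thms)
    then have "\<not> int p dvd - 4 * a * D4 * z^2"
      by (simp add: power2_eq_square mult.assoc)
    then show "int (card {(x, y) \<in> square. int p dvd Q x y z}) = int p - Legendre (b^2 - 4*a*c) (int p)"
      using card_affine_conic[OF unit[OF z]] card_norm_fibre by simp
  qed
  finally show ?thesis using p_odd_gt by (simp add: of_nat_diff)
qed

section \<open>Hensel lifting of the solution count\<close>

lemma card_linear_equation:
  assumes "\<not> int p dvd g1 \<or> \<not> int p dvd g2"
  shows "card {(t1, t2, t3) \<in> cube p. int p dvd w + (t1 * g1 + t2 * g2 + t3 * g3)} = p^2"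
proof -
  have pos: "int p > 0" using p_odd_gt by simp
  have solve: "\<exists>t\<in>{0..<int p}. int p dvd w + t * g" if "\<not> int p dvd g" for g w
  proof -
    have "coprime g (int p)" using that coprime_p_iff by blast
    then obtain i where "[g * i = 1] (mod int p)" using cong_solve_coprime_int by blast
    then have i: "int p dvd g * i - 1" by (simp add: cong_iff_dvd_diff)
    define t where "t = (- w * i) mod int p"
    have "w + t * g = g * (t - - w * i) - w * (g * i - 1)" by (simp add: algebra_simps)
    moreover have "int p dvd t - - w * i" unfolding t_def by (rule dvd_mod_diff)
    ultimately have "int p dvd w + t * g" using i by (simp only: dvd_diff dvd_mult)
    then show ?thesis using pos unfolding t_def by (intro bexI) auto
  qed
  have uniq: "t = t'" if "int p dvd w + t * g" "int p dvd w + t' * g" "\<not> int p dvd g"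
    "t \<in> {0..<int p}" "t' \<in> {0..<int p}" for t t' g w
  proof -
    from dvd_diff[OF that(1,2)] have "int p dvd g * (t - t')" by (simp add: algebra_simps)
    then show ?thesis using that range_eq_of_dvd dvd_mult_iff by blast
  qed
  have card: "card square = p^2" by (simp add: square_def power2_eq_square)
  let ?A = "{(t1, t2, t3) \<in> cube p. int p dvd w + (t1 * g1 + t2 * g2 + t3 * g3)}"
  show ?thesis
  proof (cases "int p dvd g1")
    case False
    have "bij_betw (\<lambda>(t1, t2, t3). (t2, t3)) ?A square"
    proof (rule bij_betwI')
      fix u v assume u: "u \<in> ?A" and v: "v \<in> ?A"
      obtain t1 t2 t3 r1 r2 r3 where uv: "u = (t1, t2, t3)" "v = (r1, r2, r3)" by (metis prod_cases3)
      have "t1 = r1" if "t2 = r2" "t3 = r3"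
        using uniq[of "w + (t2 * g2 + t3 * g3)" t1 g1 r1] u v False that unfolding uv cube_def
        by (simp add: ac_simps)
      then show "((case u of (t1, t2, t3) \<Rightarrow> (t2, t3)) = (case v of (t1, t2, t3) \<Rightarrow> (t2, t3))) = (u = v)"
        unfolding uv by auto
    next
      fix u assume "u \<in> ?A"
      then show "(case u of (t1, t2, t3) \<Rightarrow> (t2, t3)) \<in> square" by (auto simp: cube_def square_def)
    next
      fix v assume v: "v \<in> square"
      obtain t2 t3 where t: "v = (t2, t3)" by (cases v)
      obtain t1 where "t1 \<in> {0..<int p}" "int p dvd (w + (t2 * g2 + t3 * g3)) + t1 * g1"
        using solve[OF False] by blast
      then have "(t1, t2, t3) \<in> ?A" using v unfolding t square_def cube_def by (simp add: ac_simps)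
      then show "\<exists>u\<in>?A. v = (case u of (t1, t2, t3) \<Rightarrow> (t2, t3))"
        by (rule rev_bexI) (simp add: t)
    qed
    from bij_betw_same_card[OF this] show ?thesis unfolding card .
  next
    case True
    then have g2: "\<not> int p dvd g2" using assms by blast
    have "bij_betw (\<lambda>(t1, t2, t3). (t1, t3)) ?A square"
    proof (rule bij_betwI')
      fix u v assume u: "u \<in> ?A" and v: "v \<in> ?A"
      obtain t1 t2 t3 r1 r2 r3 where uv: "u = (t1, t2, t3)" "v = (r1, r2, r3)" by (metis prod_cases3)
      have "t2 = r2" if "t1 = r1" "t3 = r3"
        using uniq[of "w + (t1 * g1 + t3 * g3)" t2 g2 r2] u v g2 that unfolding uv cube_def
        by (simp add: ac_simps)
      then show "((case u of (t1, t2, t3) \<Rightarrow> (t1, t3)) = (case v of (t1, t2, t3) \<Rightarrow> (t1, t3))) = (u = v)"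
        unfolding uv by auto
    next
      fix u assume "u \<in> ?A"
      then show "(case u of (t1, t2, t3) \<Rightarrow> (t1, t3)) \<in> square" by (auto simp: cube_def square_def)
    next
      fix v assume v: "v \<in> square"
      obtain t1 t3 where t: "v = (t1, t3)" by (cases v)
      obtain t2 where "t2 \<in> {0..<int p}" "int p dvd (w + (t1 * g1 + t3 * g3)) + t2 * g2"
        using solve[OF g2] by blast
      then have "(t1, t2, t3) \<in> ?A" using v unfolding t square_def cube_def by (simp add: ac_simps)
      then show "\<exists>u\<in>?A. v = (case u of (t1, t2, t3) \<Rightarrow> (t1, t3))"
        by (rule rev_bexI) (simp add: t)
    qed
    from bij_betw_same_card[OF this] show ?thesis unfolding card .
  qed
qed

text \<open>Hensel lifting: Q(v + p^n t) equals Q(v) + p^n (t . gradient) modulo p^(n+1), so the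
  admissible digit vectors t satisfy one linear equation modulo p. It is non-degenerate because a
  partial derivative is a unit, which leaves p^2 lifts of each solution.\<close>

lemma card_sol_Suc:
  assumes n: "n \<ge> 1"
  shows "card {v \<in> cube (p ^ Suc n). sol (Suc n) v} = p^2 * card {v \<in> cube (p ^ n). sol n v}"
proof -
  have pos: "int p > 0" using p_odd_gt by simp
  define m where "m = int p ^ n"
  have m: "m > 0" "int (p ^ n) = m" "int (p ^ Suc n) = int p * m" "int p ^ Suc n = int p * m"
    using pos by (simp_all add: m_def)
  let ?S = "{v \<in> cube (p ^ n). sol n v}" and ?S' = "{v \<in> cube (p ^ Suc n). sol (Suc n) v}"
  define lift where "lift = (\<lambda>((x, y, z), (t1, t2, t3)). (x + m * t1, y + m * t2, z + m * t3))"
  \<comment> \<open>The digits that lift (x, y, z); the quotient by \<open>m\<close> is exact on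
    solutions modulo p^n.\<close>
  define F where "F = (\<lambda>(x, y, z). {(t1, t2, t3) \<in> cube p.
    int p dvd Q x y z div m + (t1 * Qx x y z + t2 * Qy x y z + t3 * Qz x y z)})"
  have F: "card (F v) = p^2" if "v \<in> ?S" for v
  proof -
    obtain x y z where v: "v = (x, y, z)" by (cases v)
    have "int p dvd Q x y z" using that n p_dvd_power dvd_trans unfolding v by auto
    then have "\<not> int p dvd Qx x y z \<or> \<not> int p dvd Qy x y z" using gradient_unit that unfolding v by auto
    then show ?thesis unfolding F_def v prod.case by (rule card_linear_equation)
  qed
  have sol_lift: "sol (Suc n) (x + m * t1, y + m * t2, z + m * t3) \<longleftrightarrow>
      sol n (x, y, z) \<and> int p dvd Q x y z div m + (t1 * Qx x y z + t2 * Qy x y z + t3 * Qz x y z)"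
    for x y z t1 t2 t3
  proof -
    let ?L = "t1 * Qx x y z + t2 * Qy x y z + t3 * Qz x y z"
    have pm: "int p dvd m" unfolding m_def by (rule p_dvd_power[OF n])
    then have z: "int p dvd z + m * t3 \<longleftrightarrow> int p dvd z" by (simp add: dvd_add_left_iff)
    have eq: "Q (x + m * t1) (y + m * t2) (z + m * t3) = Q x y z + m * (?L + m * Q t1 t2 t3)"
      unfolding Q_shift by (simp add: power2_eq_square distrib_left)
    show ?thesis
    proof (cases "m dvd Q x y z")
      case False
      have "\<not> int p * m dvd Q (x + m * t1) (y + m * t2) (z + m * t3)"
      proof
        assume "int p * m dvd Q (x + m * t1) (y + m * t2) (z + m * t3)"
        then have "m dvd Q x y z + m * (?L + m * Q t1 t2 t3)" unfolding eq using dvd_mult_right by blast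
        then show False using False by (simp add: dvd_add_left_iff)
      qed
      then show ?thesis using False unfolding sol_simp m(4) by (simp add: m_def)
    next
      case True
      then obtain h where h: "Q x y z = m * h" by (elim dvdE)
      have "Q (x + m * t1) (y + m * t2) (z + m * t3) = m * ((h + ?L) + m * Q t1 t2 t3)"
        unfolding eq h by (simp add: algebra_simps)
      then have "int p * m dvd Q (x + m * t1) (y + m * t2) (z + m * t3) \<longleftrightarrow> int p dvd (h + ?L) + m * Q t1 t2 t3"
        using m(1) by (simp add: mult.commute[of m])
      also have "\<dots> \<longleftrightarrow> int p dvd h + ?L" using pm by (simp add: dvd_add_left_iff)
      also have "h = Q x y z div m" using h m(1) by simp
      finally show ?thesis using True unfolding sol_simp m(4) z by (simp add: m_def)
    qed
  qed
  have "bij_betw lift (Sigma ?S F) ?S'"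
  proof (rule bij_betwI[where g = "\<lambda>(x, y, z). ((x mod m, y mod m, z mod m), (x div m, y div m, z div m))"])
    have rng: "x + m * t \<in> {0..<int p * m}" if "x \<in> {0..<m}" "t \<in> {0..<int p}" for x t
    proof -
      have "m * t \<le> m * (int p - 1)" using that m(1) by (intro mult_left_mono) auto
      then show ?thesis using that m(1) by (auto simp: algebra_simps)
    qed
    show "lift \<in> Sigma ?S F \<rightarrow> ?S'"
    proof (rule Pi_I)
      fix w assume w: "w \<in> Sigma ?S F"
      obtain x y z t1 t2 t3 where xyz: "w = ((x, y, z), (t1, t2, t3))" by (metis prod_cases3 surj_pair)
      have "sol (Suc n) (x + m * t1, y + m * t2, z + m * t3)"
        using w unfolding sol_lift xyz F_def by auto
      moreover have "(x + m * t1, y + m * t2, z + m * t3) \<in> cube (p ^ Suc n)"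
        using w unfolding xyz F_def cube_def m(2,3) by (auto simp del: atLeastLessThan_iff intro!: rng)
      ultimately show "lift w \<in> ?S'" unfolding xyz lift_def by simp
    qed
    have dm: "x mod m + m * (x div m) = x" for x by simp
    show "(\<lambda>(x, y, z). ((x mod m, y mod m, z mod m), (x div m, y div m, z div m))) \<in> ?S' \<rightarrow> Sigma ?S F"
    proof (rule Pi_I)
      fix w assume w: "w \<in> ?S'"
      obtain x y z where xyz: "w = (x, y, z)" by (cases w)
      have "x div m \<in> {0..<int p}" if "x \<in> {0..<int p * m}" for x
      proof -
        have "x div m * m \<le> x" using m(1) by (metis div_mult_mod_eq le_add_same_cancel1 pos_mod_sign)
        then have "x div m < int p" using that m(1)
          by (meson atLeastLessThan_iff le_less_trans mult_less_cancel_right_pos)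
        then show ?thesis using that m(1) by (simp add: pos_imp_zdiv_nonneg_iff)
      qed
      then have c: "(x div m, y div m, z div m) \<in> cube p" 
        using w unfolding xyz cube_def m(3) by blast
      have c': "(x mod m, y mod m, z mod m) \<in> cube (p ^ n)" unfolding cube_def m(2) using m(1) by simp
      have "sol (Suc n) (x mod m + m * (x div m), y mod m + m * (y div m), z mod m + m * (z div m))"
        unfolding dm using w xyz by simp
      then show "(case w of (x, y, z) \<Rightarrow> ((x mod m, y mod m, z mod m), (x div m, y div m, z div m))) \<in> Sigma ?S F"
        unfolding sol_lift xyz using c c' by (simp add: F_def)
    qed
    show "(case lift w of (x, y, z) \<Rightarrow> ((x mod m, y mod m, z mod m), (x div m, y div m, z div m))) = w"
      if w: "w \<in> Sigma ?S F" for w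
    proof -
      obtain x y z t1 t2 t3 where xyz: "w = ((x, y, z), (t1, t2, t3))" by (metis prod_cases3 surj_pair)
      have "x \<in> {0..<m}" "y \<in> {0..<m}" "z \<in> {0..<m}" using w unfolding xyz cube_def m(2) by auto
      then show ?thesis unfolding xyz lift_def using m(1) by simp
    qed
    show "lift (case w of (x, y, z) \<Rightarrow> ((x mod m, y mod m, z mod m), (x div m, y div m, z div m))) = w" for w
      by (cases w) (simp add: lift_def)
  qed
  from bij_betw_same_card[OF this] have "card ?S' = card (Sigma ?S F)" by (rule sym)
  also have "\<dots> = (\<Sum>v\<in>?S. card (F v))"
    by (intro card_SigmaI) (auto simp: F_def intro: finite_subset[of _ "cube p"])
  also have "\<dots> = p^2 * card ?S" using F by simp
  finally show ?thesis .
qed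

lemma card_sol:
  assumes "n \<ge> 1"
  shows "real (card {v \<in> cube (p ^ n). sol n v}) = density_const p a b c * real (p ^ n) ^ 2"
  using assms
proof (induction n rule: dec_induct)
  case base
  have "real_of_int (int (card {v \<in> cube (p ^ 1). sol 1 v})) =
      (real p - 1) * (real p - of_int (Legendre (b^2 - 4*a*c) (int p)))"
    unfolding card_sol_1 by simp
  then show ?case using p_odd_gt by (simp add: density_const_def legendre_disc_def)
next
  case (step n)
  have "real (card {v \<in> cube (p ^ Suc n). sol (Suc n) v}) = real p ^ 2 * real (card {v \<in> cube (p ^ n). sol n v})"
    unfolding card_sol_Suc[OF step.hyps(1)] by simp
  then show ?case unfolding step.IH by (simp add: power_mult_distrib)
qed

lemma density_const_pos: "density_const p a b c > 0"
proof -
  have "Legendre (b^2 - 4*a*c) (int p) \<le> 1" using Legendre_cases by auto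
  then have "real_of_int (Legendre (b^2 - 4*a*c) (int p)) \<le> 1" by linarith
  then show ?thesis using p_odd_gt unfolding density_const_def legendre_disc_def
    by (intro divide_pos_pos mult_pos_pos) auto
qed

end

section \<open>Integer zeros of diagonal ternary forms\<close>

lemma sum_inverse_le_ln: "n \<ge> 1 \<Longrightarrow> (\<Sum>g=1..n. 1 / real g) \<le> 1 + ln (real n)"
proof (induction n rule: dec_induct)
  case base
  then show ?case by simp
next
  case (step n)
  have "ln (real n / real (Suc n)) \<le> real n / real (Suc n) - 1"
    using step.hyps by (intro ln_le_minus_one) simp
  then have "1 / real (Suc n) \<le> ln (real (Suc n)) - ln (real n)"
    using step.hyps by (simp add: ln_div field_simps)
  then show ?case using step.IH by simp
qed

text \<open>Take g to be the gcd of c u and v. The cofactors are coprime, and their product is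
  w^2/g^2, a square, so each of them is a square.\<close>

lemma square_times_square_factors:
  fixes c u v w :: nat
  assumes "c * (u * v) = w^2" "c > 0" "u > 0" "v > 0"
  obtains g r s where "c * u = g * r^2" "v = g * s^2"
proof -
  define g where "g = gcd (c * u) v"
  obtain r' s' where rs: "c * u = r' * g" "v = s' * g" "coprime r' s'"
    unfolding g_def using gcd_coprime_exists[of "c * u" v] assms by auto
  have g: "g > 0" using assms by (simp add: g_def)
  have "w^2 = (c * u) * v" using assms(1) by (simp add: mult.assoc)
  then have "w^2 = (r' * s') * g^2" unfolding rs(1,2) by (simp add: power2_eq_square ac_simps)
  then have "g^2 dvd w^2" by simp
  then have "g dvd w" by simp
  then obtain k where "w = g * k" by (elim dvdE)
  with \<open>w^2 = (r' * s') * g^2\<close> g have k: "r' * s' = k^2" by (simp add: power_mult_distrib)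
  then have "is_nth_power 2 (r' * s')" by (auto simp: is_nth_power_def)
  then obtain r s where "r' = r^2" "s' = s^2"
    using is_nth_power_mult_coprime_nat_iff[OF rs(3)] by (auto simp: is_nth_power_def)
  then show ?thesis using that[of g r s] rs by (simp add: mult.commute)
qed

lemma le_sqrt_div:
  fixes g r M :: nat
  assumes "g * r^2 \<le> M" "g > 0"
  shows "r \<le> nat \<lfloor>sqrt (real M / real g)\<rfloor>"
proof -
  have "real g * real r ^ 2 \<le> real M" using assms(1) by (metis of_nat_le_iff of_nat_mult of_nat_power)
  then have "real r ^ 2 \<le> real M / real g" using assms(2) by (simp add: field_simps)
  then have "real r \<le> sqrt (real M / real g)" by (simp add: real_le_rsqrt)
  then show ?thesis by (simp add: le_nat_floor)
qed

text \<open>Writing c u = g r^2 and v = g s^2, a given g admits at most sqrt(c M/g) values of r and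
  sqrt(M/g) values of s. Summing M/g over g produces the logarithm.\<close>

lemma card_square_products:
  fixes c M :: nat
  assumes "c > 0" "M \<ge> 1"
  defines "A \<equiv> {(u, v). u \<in> {1..M} \<and> v \<in> {1..M} \<and> (\<exists>w. c * (u * v) = w^2)}"
  shows "real (card A) \<le> real c * real M * (1 + ln (real M))"
proof -
  let ?R = "\<lambda>g. {0<..nat \<lfloor>sqrt (real (c * M) / real g)\<rfloor>}" and ?S = "\<lambda>g. {0<..nat \<lfloor>sqrt (real M / real g)\<rfloor>}"
  let ?B = "SIGMA g:{1..M}. ?R g \<times> ?S g"
  have "A \<subseteq> (\<lambda>(g, r, s). (g * r^2 div c, g * s^2)) ` ?B"
  proof
    fix x assume x: "x \<in> A"
    obtain u v where uv: "x = (u, v)" by (cases x)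
    have u: "u \<in> {1..M}" "v \<in> {1..M}" using x unfolding A_def uv by auto
    obtain w where w: "c * (u * v) = w^2" using x unfolding A_def uv by auto
    obtain g r s where grs: "c * u = g * r^2" "v = g * s^2"
      using square_times_square_factors[OF w assms(1)] u by auto
    have pos: "g > 0" "r > 0" "s > 0"
      using grs u assms(1) by (auto intro!: Nat.gr0I)
    have "g * r^2 \<le> c * M" unfolding grs(1)[symmetric] using u by simp
    then have "r \<in> ?R g" using le_sqrt_div[of g r "c * M"] pos by (simp del: of_nat_mult)
    moreover have "g * s^2 \<le> M" using u grs by simp
    then have "s \<in> ?S g" "g \<le> M" using le_sqrt_div[of g s M] pos
      by (auto intro: order_trans[of g "g * s^2"])
    ultimately have "(g, r, s) \<in> ?B" using pos by simp
    moreover have "x = (g * r^2 div c, g * s^2)" unfolding uv grs(1)[symmetric] grs(2)[symmetric] using assms(1) by simp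
    ultimately show "x \<in> (\<lambda>(g, r, s). (g * r^2 div c, g * s^2)) ` ?B" by (force simp: image_iff)
  qed
  then have "card A \<le> card ((\<lambda>(g, r, s). (g * r^2 div c, g * s^2)) ` ?B)" by (intro card_mono) auto
  also have "\<dots> \<le> card ?B" by (rule card_image_le) auto
  also have "\<dots> = (\<Sum>g\<in>{1..M}. card (?R g \<times> ?S g))" by (intro card_SigmaI) auto
  finally have "real (card A) \<le> (\<Sum>g\<in>{1..M}. real (card (?R g \<times> ?S g)))"
    unfolding of_nat_sum[symmetric] by (rule of_nat_mono)
  also have "\<dots> \<le> (\<Sum>g\<in>{1..M}. real c * real M * (1 / real g))"
  proof (rule sum_mono)
    fix g assume g: "g \<in> {1..M}"
    have "real (card (?R g \<times> ?S g)) = real (nat \<lfloor>sqrt (real (c * M) / real g)\<rfloor>) * real (nat \<lfloor>sqrt (real M / real g)\<rfloor>)"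
      by (simp add: card_cartesian_product)
    also have "\<dots> \<le> sqrt (real (c * M) / real g) * sqrt (real M / real g)"
      by (intro mult_mono of_nat_floor) auto
    also have "\<dots> = sqrt (real c) * (real M / real g)"
      by (simp add: real_sqrt_mult real_sqrt_divide)
    also have "\<dots> \<le> real c * (real M / real g)"
    proof (rule mult_right_mono)
      have "real c \<ge> 1" using assms(1) by simp
      then have "real c * 1 \<le> real c * real c" by (intro mult_left_mono) auto
      then show "sqrt (real c) \<le> real c" by (intro real_le_lsqrt) (simp_all add: power2_eq_square)
    qed simp
    finally show "real (card (?R g \<times> ?S g)) \<le> real c * real M * (1 / real g)" by simp
  qed
  also have "\<dots> = real c * real M * (\<Sum>g=1..M. 1 / real g)" by (simp add: sum_distrib_left)
  also have "\<dots> \<le> real c * real M * (1 + ln (real M))"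
    using sum_inverse_le_ln[OF assms(2)] by (intro mult_left_mono) auto
  finally show ?thesis .
qed

text \<open>A pair with a vanishing entry lies on one of the axes; the others are reduced to positive pairs.\<close>

lemma card_square_products_int:
  fixes c :: int and M :: nat
  assumes "c \<noteq> 0" "M \<ge> 1"
  defines "A \<equiv> {(u, v). \<bar>u\<bar> \<le> int M \<and> \<bar>v\<bar> \<le> int M \<and> (\<exists>w. c * (u * v) = w^2)}"
  shows "finite A" and "real (card A) \<le> (4 * real_of_int \<bar>c\<bar> + 6) * real M * (1 + ln (real M))"
proof -
  let ?I = "{- int M..int M}"
  let ?N = "{(u, v). u \<in> {1..M} \<and> v \<in> {1..M} \<and> (\<exists>w. nat \<bar>c\<bar> * (u * v) = w^2)}"
  let ?sg = "{-1, 1 :: int}"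
  have finN: "finite ?N" by (rule finite_subset[of _ "{1..M} \<times> {1..M}"]) auto
  have "A \<subseteq> ?I \<times> ?I" by (auto simp: A_def)
  then show "finite A" by (rule finite_subset) simp
  have sub: "A \<subseteq> (?I \<times> {0}) \<union> ({0} \<times> ?I) \<union> (\<lambda>(i, j, u, v). (i * int u, j * int v)) ` (?sg \<times> ?sg \<times> ?N)" (is "_ \<subseteq> ?X \<union> ?Y \<union> ?Z")
  proof
    fix x assume x: "x \<in> A"
    obtain u v where uv: "x = (u, v)" by (cases x)
    have b: "\<bar>u\<bar> \<le> int M" "\<bar>v\<bar> \<le> int M" using x unfolding A_def uv by auto
    show "x \<in> ?X \<union> ?Y \<union> ?Z"
    proof (cases "u = 0 \<or> v = 0")
      case True
      then show ?thesis using b unfolding uv by auto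
    next
      case False
      obtain w where w: "c * (u * v) = w^2" using x unfolding A_def uv by auto
      have "int (nat \<bar>c\<bar> * (nat \<bar>u\<bar> * nat \<bar>v\<bar>)) = \<bar>c * (u * v)\<bar>" by (simp add: abs_mult)
      also have "\<dots> = int ((nat \<bar>w\<bar>)^2)" unfolding w by simp
      finally have "nat \<bar>c\<bar> * (nat \<bar>u\<bar> * nat \<bar>v\<bar>) = (nat \<bar>w\<bar>)^2" using of_nat_eq_iff by blast
      moreover have "1 \<le> nat \<bar>u\<bar>" "nat \<bar>u\<bar> \<le> M" "1 \<le> nat \<bar>v\<bar>" "nat \<bar>v\<bar> \<le> M"
        using False b by linarith+
      ultimately have N: "(nat \<bar>u\<bar>, nat \<bar>v\<bar>) \<in> ?N" by auto
      have "x = (sgn u * int (nat \<bar>u\<bar>), sgn v * int (nat \<bar>v\<bar>))"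
        unfolding uv by (simp add: sgn_mult_abs)
      moreover have "sgn u \<in> ?sg" "sgn v \<in> ?sg" using False by (auto simp: sgn_if)
      ultimately have "x \<in> ?Z" using N by (intro image_eqI[of _ _ "(sgn u, sgn v, nat \<bar>u\<bar>, nat \<bar>v\<bar>)"]) auto
      then show ?thesis by blast
    qed
  qed
  have "card A \<le> card (?X \<union> ?Y \<union> ?Z)" using sub finN by (intro card_mono) auto
  also have "\<dots> \<le> card ?X + card ?Y + card ?Z"
    by (meson card_Un_le add_le_mono1 order_trans)
  also have "card ?Z \<le> card (?sg \<times> ?sg \<times> ?N)" using finN by (intro card_image_le) auto
  also have "\<dots> = 4 * card ?N" by (simp add: card_cartesian_product)
  finally have "card A \<le> card ?X + card ?Y + 4 * card ?N" by simp
  moreover have "card ?X = 2 * M + 1" "card ?Y = 2 * M + 1" by (simp_all add: card_cartesian_product)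
  ultimately have "card A \<le> 4 * M + 2 + 4 * card ?N" by linarith
  then have "real (card A) \<le> real (4 * M + 2 + 4 * card ?N)" by (rule of_nat_mono)
  also have "\<dots> = 4 * real M + 2 + 4 * real (card ?N)" by simp
  also have "\<dots> \<le> 6 * real M * (1 + ln (real M)) + 4 * (real (nat \<bar>c\<bar>) * real M * (1 + ln (real M)))"
  proof -
    have "ln (real M) \<ge> 0" "real M \<ge> 1" using assms(2) by auto
    then have "6 * real M * 1 \<le> 6 * real M * (1 + ln (real M))" by (intro mult_left_mono) auto
    moreover have "real (card ?N) \<le> real (nat \<bar>c\<bar>) * real M * (1 + ln (real M))"
      using assms(1,2) by (intro card_square_products) auto
    ultimately show ?thesis using \<open>real M \<ge> 1\<close> by linarith
  qed
  also have "\<dots> = (4 * real_of_int \<bar>c\<bar> + 6) * real M * (1 + ln (real M))"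
    by (simp add: algebra_simps)
  finally show "real (card A) \<le> (4 * real_of_int \<bar>c\<bar> + 6) * real M * (1 + ln (real M))" .
qed

text \<open>For two zeros of the form, Lagrange's identity makes \<open>A B W\<^sup>2\<close> the product of the integers
  \<open>C Z Z\<^sub>0 \<plusminus> (A X X\<^sub>0 + B Y Y\<^sub>0)\<close>; together with the sign of \<open>W\<close> they determine \<open>(X, Y, Z)\<close>.\<close>

lemma card_diagonal_zeros_aux:
  fixes A B C X0 Y0 Z0 :: int
  assumes "A \<noteq> 0" "B \<noteq> 0" "C \<noteq> 0" "Z0 \<noteq> 0" and zero: "A * X0^2 + B * Y0^2 + C * Z0^2 = 0"
  shows "\<exists>\<kappa>\<ge>0. \<forall>M\<ge>1. real (card {(x, y, z). A * x^2 + B * y^2 + C * z^2 = 0 \<and>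
    \<bar>x\<bar> \<le> int M \<and> \<bar>y\<bar> \<le> int M \<and> \<bar>z\<bar> \<le> int M}) \<le> \<kappa> * real M * (1 + ln (real M))"
proof -
  \<comment> \<open>Chosen so that both factors in Lagrange's identity are at most L M in absolute
    value when the coordinates are at most M.\<close>
  define L where "L = nat (\<bar>A * X0\<bar> + \<bar>B * Y0\<bar> + \<bar>C * Z0\<bar>)"
  have L: "int L = \<bar>A * X0\<bar> + \<bar>B * Y0\<bar> + \<bar>C * Z0\<bar>" by (simp add: L_def)
  have "C * Z0 \<noteq> 0" using assms by simp
  then have L1: "L \<ge> 1" using L by linarith
  define \<kappa> where "\<kappa> = 3 * ((4 * real_of_int \<bar>A * B\<bar> + 6) * real L * (1 + ln (real L)))"
  show ?thesis
  proof (intro exI[of _ \<kappa>] conjI allI impI)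
    show "\<kappa> \<ge> 0" using L1 unfolding \<kappa>_def by (intro mult_nonneg_nonneg) auto
    fix M :: nat assume M: "M \<ge> 1"
    let ?V = "{(x, y, z). A * x^2 + B * y^2 + C * z^2 = 0 \<and> \<bar>x\<bar> \<le> int M \<and> \<bar>y\<bar> \<le> int M \<and> \<bar>z\<bar> \<le> int M}"
    let ?P = "{(u, v). \<bar>u\<bar> \<le> int (L * M) \<and> \<bar>v\<bar> \<le> int (L * M) \<and> (\<exists>w. (A * B) * (u * v) = w^2)}"
    let ?sg = "{-1, 0, 1 :: int}"
    define W where "W x y = x * Y0 - X0 * y" for x y
    define l where "l x y = A * x * X0 + B * y * Y0" for x y
    define F where "F = (\<lambda>(x, y, z). (sgn (W x y), C * z * Z0 - l x y, C * z * Z0 + l x y))"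
    have id: "(C * z * Z0 - l x y) * (C * z * Z0 + l x y) = A * B * (W x y)^2"
      if "A * x^2 + B * y^2 + C * z^2 = 0" for x y z
    proof -
      have 1: "C * z^2 = - (A * x^2 + B * y^2)" "C * Z0^2 = - (A * X0^2 + B * Y0^2)"
        using that zero by linarith+
      have "(C * z * Z0 - l x y) * (C * z * Z0 + l x y) = (C * z^2) * (C * Z0^2) - (l x y)^2"
        by (simp add: power2_eq_square algebra_simps)
      also have "\<dots> = A * B * (W x y)^2"
        unfolding 1 l_def W_def by (simp add: power2_eq_square algebra_simps)
      finally show ?thesis .
    qed
    have inj: "inj_on F ?V"
    proof (rule inj_onI)
      fix v v' assume A: "v \<in> ?V" "v' \<in> ?V" "F v = F v'"
      obtain x y z x' y' z' where v: "v = (x, y, z)" "v' = (x', y', z')" by (metis prod_cases3)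
      have V: "A * x^2 + B * y^2 + C * z^2 = 0" "A * x'^2 + B * y'^2 + C * z'^2 = 0"
        and F: "F (x, y, z) = F (x', y', z')"
        using A unfolding v by auto
      have 1: "C * z * Z0 - l x y = C * z' * Z0 - l x' y'" "C * z * Z0 + l x y = C * z' * Z0 + l x' y'"
        and sg: "sgn (W x y) = sgn (W x' y')"
        using F by (simp_all add: F_def)
      have "C * z * Z0 = C * z' * Z0" using 1 by linarith
      then have z: "z = z'" using assms by simp
      then have l: "l x y = l x' y'" using 1 by simp
      have "A * B * (W x y)^2 = A * B * (W x' y')^2"
        by (rule trans[OF id[OF V(1), unfolded 1, symmetric] id[OF V(2)]])
      then have "\<bar>W x y\<bar> = \<bar>W x' y'\<bar>" using assms by (simp add: power2_eq_iff abs_eq_iff)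
      then have W: "W x y = W x' y'" using sg by (metis sgn_mult_abs)
      \<comment> \<open>Up to sign the determinant of the linear system that recovers (x, y) from
        \<open>l\<close> and \<open>W\<close>; it equals -C Z0^2.\<close>
      have d: "A * X0^2 + B * Y0^2 \<noteq> 0" using zero assms by auto
      have "(A * X0^2 + B * Y0^2) * x = X0 * l x y + B * Y0 * W x y"
        "(A * X0^2 + B * Y0^2) * x' = X0 * l x' y' + B * Y0 * W x' y'"
        by (simp_all add: l_def W_def power2_eq_square algebra_simps)
      then have x: "x = x'" using l W d by (metis mult_cancel_left)
      have "(A * X0^2 + B * Y0^2) * y = Y0 * l x y - A * X0 * W x y"
        "(A * X0^2 + B * Y0^2) * y' = Y0 * l x' y' - A * X0 * W x' y'"
        by (simp_all add: l_def W_def power2_eq_square algebra_simps)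
      then have "y = y'" using l W d by (metis mult_cancel_left)
      with x z show "v = v'" using v by simp
    qed
    have img: "F ` ?V \<subseteq> ?sg \<times> ?P"
    proof (rule image_subsetI, clarify)
      fix x y z assume V: "A * x^2 + B * y^2 + C * z^2 = 0" "\<bar>x\<bar> \<le> int M" "\<bar>y\<bar> \<le> int M" "\<bar>z\<bar> \<le> int M"
      have "\<bar>C * z * Z0\<bar> + \<bar>l x y\<bar> \<le> \<bar>C * Z0\<bar> * \<bar>z\<bar> + (\<bar>A * X0\<bar> * \<bar>x\<bar> + \<bar>B * Y0\<bar> * \<bar>y\<bar>)"
        unfolding l_def abs_mult[symmetric]
        by (intro add_mono order_trans[OF abs_triangle_ineq]) (simp_all add: ac_simps)
      also have "\<dots> \<le> \<bar>C * Z0\<bar> * int M + (\<bar>A * X0\<bar> * int M + \<bar>B * Y0\<bar> * int M)"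
        using V by (intro add_mono mult_left_mono) auto
      also have "\<dots> = int (L * M)" by (simp add: L algebra_simps)
      finally have b: "\<bar>C * z * Z0\<bar> + \<bar>l x y\<bar> \<le> int (L * M)" .
      have "\<bar>C * z * Z0 - l x y\<bar> \<le> int (L * M)" "\<bar>C * z * Z0 + l x y\<bar> \<le> int (L * M)"
        using b by linarith+
      moreover have "(A * B) * ((C * z * Z0 - l x y) * (C * z * Z0 + l x y)) = (A * B * W x y)^2"
        unfolding id[OF V(1)] by (simp add: power2_eq_square algebra_simps)
      ultimately show "F (x, y, z) \<in> ?sg \<times> ?P"
        unfolding F_def prod.case by (auto simp: sgn_if intro!: exI[of _ "A * B * W x y"])
    qed
    have AB: "A * B \<noteq> 0" and LM: "L * M \<ge> 1" using assms L1 M by auto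
    note P = card_square_products_int[OF AB LM]
    have "card ?V \<le> card (?sg \<times> ?P)"
      using inj img P(1) by (intro card_inj_on_le) auto
    also have "\<dots> = 3 * card ?P" by (simp add: card_cartesian_product)
    finally have "real (card ?V) \<le> real (3 * card ?P)" by (rule of_nat_mono)
    also have "\<dots> = 3 * real (card ?P)" by simp
    also have "\<dots> \<le> 3 * ((4 * real_of_int \<bar>A * B\<bar> + 6) * real (L * M) * (1 + ln (real (L * M))))"
      using P(2) by linarith
    also have "\<dots> \<le> 3 * ((4 * real_of_int \<bar>A * B\<bar> + 6) * real (L * M) * ((1 + ln (real L)) * (1 + ln (real M))))"
    proof -
      have "ln (real L) \<ge> 0" "ln (real M) \<ge> 0" using L1 M by auto
      then have "0 \<le> ln (real L) * ln (real M)" by simp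
      moreover have "ln (real (L * M)) = ln (real L) + ln (real M)" using L1 M by (simp add: ln_mult)
      ultimately have "1 + ln (real (L * M)) \<le> (1 + ln (real L)) * (1 + ln (real M))"
        by (simp add: algebra_simps)
      then show ?thesis by (intro mult_left_mono) auto
    qed
    also have "\<dots> = \<kappa> * real M * (1 + ln (real M))" by (simp add: \<kappa>_def)
    finally show "real (card ?V) \<le> \<kappa> * real M * (1 + ln (real M))" .
  qed
qed

text \<open>The parametrisation needs a base zero with non-zero last coordinate. If there is none,
  every zero has z = 0, and x with the sign of y determines it: at most 3 (2M + 1), hence at most 9
  M zeros.\<close>

lemma card_diagonal_zeros:
  fixes A B C :: int
  assumes "A \<noteq> 0" "B \<noteq> 0" "C \<noteq> 0"
  shows "\<exists>\<kappa>\<ge>0. \<forall>M\<ge>1. real (card {(x, y, z). A * x^2 + B * y^2 + C * z^2 = 0 \<and>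
    \<bar>x\<bar> \<le> int M \<and> \<bar>y\<bar> \<le> int M \<and> \<bar>z\<bar> \<le> int M}) \<le> \<kappa> * real M * (1 + ln (real M))"
proof (cases "\<exists>x y z. z \<noteq> 0 \<and> A * x^2 + B * y^2 + C * z^2 = 0")
  case True
  then show ?thesis using card_diagonal_zeros_aux[OF assms] by blast
next
  case False
  show ?thesis
  proof (intro exI[of _ 9] conjI allI impI)
    fix M :: nat assume M: "M \<ge> 1"
    let ?V = "{(x, y, z). A * x^2 + B * y^2 + C * z^2 = 0 \<and> \<bar>x\<bar> \<le> int M \<and> \<bar>y\<bar> \<le> int M \<and> \<bar>z\<bar> \<le> int M}"
    let ?T = "{- int M..int M} \<times> {-1, 0, 1 :: int}"
    have "inj_on (\<lambda>(x, y, z :: int). (x, sgn y)) ?V"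
    proof (rule inj_onI)
      fix v v' assume A: "v \<in> ?V" "v' \<in> ?V"
        "(case v of (x, y, z) \<Rightarrow> (x, sgn y)) = (case v' of (x, y, z) \<Rightarrow> (x, sgn y))"
      obtain x y z x' y' z' where v: "v = (x, y, z)" "v' = (x', y', z')" by (metis prod_cases3)
      have V: "A * x^2 + B * y^2 + C * z^2 = 0" "A * x'^2 + B * y'^2 + C * z'^2 = 0"
        and F: "x = x'" "sgn y = sgn y'"
        using A unfolding v by auto
      have z: "z = 0" "z' = 0" using False V by blast+
      have "A * x^2 + B * y^2 = 0" "A * x^2 + B * y'^2 = 0" using V F(1) z by simp_all
      then have "B * y^2 = B * y'^2" by linarith
      then have "\<bar>y\<bar> = \<bar>y'\<bar>" using assms by (simp add: power2_eq_iff abs_eq_iff)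
      then have "y = y'" using F by (metis sgn_mult_abs)
      then show "v = v'" using z F v by simp
    qed
    moreover have "(\<lambda>(x, y, z). (x, sgn y)) ` ?V \<subseteq> ?T"
    proof (rule image_subsetI)
      fix v assume "v \<in> ?V"
      moreover have "sgn w \<in> {-1, 0, 1}" for w :: int by (simp add: sgn_if)
      ultimately show "(case v of (x, y, z) \<Rightarrow> (x, sgn y)) \<in> ?T" by (cases v) force
    qed
    ultimately have "card ?V \<le> card ?T" by (intro card_inj_on_le) auto
    also have "\<dots> = 3 * (2 * M + 1)" by (simp add: card_cartesian_product)
    also have "\<dots> \<le> 9 * M" using M by simp
    finally have "real (card ?V) \<le> real (9 * M)" by (rule of_nat_mono)
    also have "\<dots> \<le> 9 * real M * (1 + ln (real M))"
    proof -
      have "ln (real M) \<ge> 0" using M by auto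
      then have "9 * real M * 1 \<le> 9 * real M * (1 + ln (real M))" by (intro mult_left_mono) auto
      then show ?thesis by simp
    qed
    finally show "real (card ?V) \<le> 9 * real M * (1 + ln (real M))" .
  qed simp
qed

section \<open>The exponential sums on average\<close>

definition centred_cube :: "nat \<Rightarrow> (int \<times> int \<times> int) set" where
  "centred_cube M = {- int M..int M} \<times> {- int M..int M} \<times> {- int M..int M}"

lemma finite_centred_cube [simp]: "finite (centred_cube M)"
  by (simp add: centred_cube_def)

lemma mem_centred_cube:
  "(r, s, t) \<in> centred_cube M \<longleftrightarrow> \<bar>r\<bar> \<le> int M \<and> \<bar>s\<bar> \<le> int M \<and> \<bar>t\<bar> \<le> int M"
  by (auto simp: centred_cube_def)

context form_mod_prime
begin

definition exp_sum :: "nat \<Rightarrow> int \<times> int \<times> int \<Rightarrow> complex" where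
  "exp_sum n \<xi> = (\<Sum>v\<in>{v \<in> cube (p ^ n). sol n v}. wave (p ^ n) \<xi> v)"

definition dual_size :: int where
  "dual_size = \<bar>4*c*f - e^2\<bar> + \<bar>4*a*f - d^2\<bar> + \<bar>4*a*c - b^2\<bar>
     + 2 * \<bar>d*e - 2*b*f\<bar> + 2 * \<bar>b*e - 2*c*d\<bar> + 2 * \<bar>b*d - 2*a*e\<bar>"

lemma dual_size_bound:
  assumes "\<bar>r\<bar> \<le> int M" "\<bar>s\<bar> \<le> int M" "\<bar>t\<bar> \<le> int M"
  shows "\<bar>dual r s t\<bar> \<le> dual_size * (int M)^2"
proof -
  have m: "\<bar>w * u * v\<bar> \<le> \<bar>w\<bar> * (int M)^2" if "\<bar>u\<bar> \<le> int M" "\<bar>v\<bar> \<le> int M" for u v w :: int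
  proof -
    have "\<bar>u\<bar> * \<bar>v\<bar> \<le> int M * int M" using that by (intro mult_mono) auto
    then have "\<bar>w\<bar> * (\<bar>u\<bar> * \<bar>v\<bar>) \<le> \<bar>w\<bar> * (int M)^2"
      by (intro mult_left_mono) (auto simp: power2_eq_square)
    then show ?thesis by (simp add: abs_mult mult.assoc)
  qed
  let ?A = "4*c*f - e^2" and ?B = "4*a*f - d^2" and ?C = "4*a*c - b^2"
    and ?E = "d*e - 2*b*f" and ?F = "b*e - 2*c*d" and ?G = "b*d - 2*a*e"
  have "dual r s t = ?A * r * r + ?B * s * s + ?C * t * t
      + 2 * (?E * r * s) + 2 * (?F * r * t) + 2 * (?G * s * t)"
    by (simp only: dual_def power2_eq_square mult.assoc)
  moreover have "\<bar>?A * r * r\<bar> \<le> \<bar>?A\<bar> * (int M)^2" "\<bar>?B * s * s\<bar> \<le> \<bar>?B\<bar> * (int M)^2"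
    "\<bar>?C * t * t\<bar> \<le> \<bar>?C\<bar> * (int M)^2" "\<bar>?E * r * s\<bar> \<le> \<bar>?E\<bar> * (int M)^2"
    "\<bar>?F * r * t\<bar> \<le> \<bar>?F\<bar> * (int M)^2" "\<bar>?G * s * t\<bar> \<le> \<bar>?G\<bar> * (int M)^2"
    by (rule m; rule assms)+
  moreover have "\<bar>x1 + x2 + x3 + 2 * x4 + 2 * x5 + 2 * x6\<bar> \<le> B1 + B2 + B3 + 2 * B4 + 2 * B5 + 2 * B6"
    if "\<bar>x1\<bar> \<le> B1" "\<bar>x2\<bar> \<le> B2" "\<bar>x3\<bar> \<le> B3" "\<bar>x4\<bar> \<le> B4" "\<bar>x5\<bar> \<le> B5" "\<bar>x6\<bar> \<le> B6"
    for x1 x2 x3 x4 x5 x6 B1 B2 B3 B4 B5 B6 :: int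
    using that[THEN abs_le_D1] that[THEN abs_le_D2] by (intro abs_leI) linarith+
  ultimately have "\<bar>dual r s t\<bar> \<le> \<bar>?A\<bar> * (int M)^2 + \<bar>?B\<bar> * (int M)^2 + \<bar>?C\<bar> * (int M)^2
      + 2 * (\<bar>?E\<bar> * (int M)^2) + 2 * (\<bar>?F\<bar> * (int M)^2) + 2 * (\<bar>?G\<bar> * (int M)^2)"
    by (simp only:)
  then show ?thesis unfolding dual_size_def by (simp only: distrib_right mult.assoc)
qed

text \<open>The substitution of \<open>dual_diagonal\<close> is linear, triangular with non-zero
  diagonal, hence injective on integer vectors. It maps zeros of the dual form to zeros of a
  diagonal form and enlarges coordinates by at most the constant \<open>L\<close>.\<close>

lemma card_dual_zeros:
  "\<exists>\<kappa>\<ge>0. \<forall>M\<ge>1. real (card {(r, s, t) \<in> centred_cube M. dual r s t = 0}) \<le> \<kappa> * real M * (1 + ln (real M))"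
proof -
  have nz: "a \<noteq> 0" "D \<noteq> 0" "D4 \<noteq> 0" using a_unit disc_unit det_unit by (metis dvd_0_right)+
  then have nz': "D4 * D \<noteq> 0" by simp
  obtain \<kappa> where \<kappa>: "\<kappa> \<ge> 0" "\<And>M. M \<ge> 1 \<Longrightarrow> real (card {(x, y, z). (D4 * D) * x^2 + D4 * y^2 + a * z^2 = 0 \<and>
    \<bar>x\<bar> \<le> int M \<and> \<bar>y\<bar> \<le> int M \<and> \<bar>z\<bar> \<le> int M}) \<le> \<kappa> * real M * (1 + ln (real M))"
    using card_diagonal_zeros[OF nz' nz(3) nz(1)] by blast
  define L where "L = nat (1 + \<bar>2*a\<bar> + \<bar>b\<bar> + \<bar>D\<bar> + \<bar>b*e - 2*c*d\<bar> + \<bar>b*d - 2*a*e\<bar>)"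
  have L: "int L = 1 + \<bar>2*a\<bar> + \<bar>b\<bar> + \<bar>D\<bar> + \<bar>b*e - 2*c*d\<bar> + \<bar>b*d - 2*a*e\<bar>" by (simp add: L_def)
  then have L1: "L \<ge> 1" by linarith
  show ?thesis
  proof (intro exI[of _ "\<kappa> * real L * (1 + ln (real L))"] conjI allI impI)
    show "0 \<le> \<kappa> * real L * (1 + ln (real L))" using \<kappa>(1) L1 by (intro mult_nonneg_nonneg) auto
    fix M :: nat assume M: "M \<ge> 1"
    let ?V = "{(r, s, t) \<in> centred_cube M. dual r s t = 0}"
    let ?U = "{(x, y, z). (D4 * D) * x^2 + D4 * y^2 + a * z^2 = 0 \<and>
      \<bar>x\<bar> \<le> int (L * M) \<and> \<bar>y\<bar> \<le> int (L * M) \<and> \<bar>z\<bar> \<le> int (L * M)}"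
    define F where "F = (\<lambda>(r, s, t). (r, 2*a * s - b * r, D * t + (b*e - 2*c*d) * r + (b*d - 2*a*e) * s))"
    have inj: "inj_on F ?V"
    proof (rule inj_onI)
      fix v v' assume F: "F v = F v'"
      obtain r s t r' s' t' where v: "v = (r, s, t)" "v' = (r', s', t')" by (metis prod_cases3)
      from F[unfolded v] have r: "r = r'" and s: "2*a * s - b * r = 2*a * s' - b * r'"
        and t: "D * t + (b*e - 2*c*d) * r + (b*d - 2*a*e) * s = D * t' + (b*e - 2*c*d) * r' + (b*d - 2*a*e) * s'"
        unfolding F_def prod.case prod.inject by blast+
      have s': "s = s'" using s r nz(1) by simp
      have "t = t'" using t nz(2) unfolding r s' by simp
      then show "v = v'" using v r s' by simp
    qed
    have finU: "finite ?U"
      by (rule finite_subset[of _ "centred_cube (L * M)"]) (auto simp: centred_cube_def)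
    have img: "F ` ?V \<subseteq> ?U"
    proof (rule image_subsetI)
      fix v assume v: "v \<in> ?V"
      obtain r s t where rst: "v = (r, s, t)" by (metis prod_cases3)
      have m: "\<bar>w * u\<bar> \<le> \<bar>w\<bar> * int M" if "\<bar>u\<bar> \<le> int M" for u w :: int
        using that by (simp add: abs_mult mult_left_mono)
      have b: "\<bar>r\<bar> \<le> int M" "\<bar>s\<bar> \<le> int M" "\<bar>t\<bar> \<le> int M" and z: "dual r s t = 0"
        using v unfolding rst by (auto simp: mem_centred_cube)
      define k1 k2 k3 k4 k5 where k: "k1 = \<bar>2*a\<bar>" "k2 = \<bar>b\<bar>" "k3 = \<bar>D\<bar>" "k4 = \<bar>b*e - 2*c*d\<bar>" "k5 = \<bar>b*d - 2*a*e\<bar>"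
      have LM: "int (L * M) = int M + k1 * int M + k2 * int M + k3 * int M + k4 * int M + k5 * int M"
        unfolding of_nat_mult L k by (simp only: distrib_right mult_1_left)
      have n: "0 \<le> k1 * int M" "0 \<le> k2 * int M" "0 \<le> k3 * int M" "0 \<le> k4 * int M" "0 \<le> k5 * int M"
        by (simp_all add: k)
      note mm = m[OF b(2), of "2*a"] m[OF b(1), of b] m[OF b(3), of D] m[OF b(1), of "b*e - 2*c*d"] m[OF b(2), of "b*d - 2*a*e"]
      define y1 y2 y3 y4 y5 where y: "y1 = 2*a * s" "y2 = b * r" "y3 = D * t" "y4 = (b*e - 2*c*d) * r" "y5 = (b*d - 2*a*e) * s"
      have yy: "\<bar>y1\<bar> \<le> k1 * int M" "\<bar>y2\<bar> \<le> k2 * int M" "\<bar>y3\<bar> \<le> k3 * int M" "\<bar>y4\<bar> \<le> k4 * int M" "\<bar>y5\<bar> \<le> k5 * int M"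
        using mm unfolding k y by blast+
      have "\<bar>r\<bar> \<le> int (L * M)" using b(1) n LM by linarith
      moreover have "\<bar>y1 - y2\<bar> \<le> int (L * M)" using yy n LM by linarith
      moreover have "\<bar>y3 + y4 + y5\<bar> \<le> int (L * M)" using yy n LM by linarith
      moreover have "(D4 * D) * r^2 + D4 * (2*a * s - b * r)^2
          + a * (D * t + (b*e - 2*c*d) * r + (b*d - 2*a*e) * s)^2 = 0"
        using dual_diagonal[of r s t] z by simp
      ultimately show "F v \<in> ?U" unfolding rst F_def y by simp
    qed
    have "card ?V \<le> card ?U" using inj img finU by (rule card_inj_on_le)
    then have "real (card ?V) \<le> real (card ?U)" by simp
    also have "\<dots> \<le> \<kappa> * real (L * M) * (1 + ln (real (L * M)))" using L1 M by (intro \<kappa>(2)) simp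
    also have "\<dots> \<le> \<kappa> * real (L * M) * ((1 + ln (real L)) * (1 + ln (real M)))"
    proof -
      have "ln (real L) \<ge> 0" "ln (real M) \<ge> 0" using L1 M by auto
      then have "0 \<le> ln (real L) * ln (real M)" by simp
      moreover have "ln (real (L * M)) = ln (real L) + ln (real M)" using L1 M by (simp add: ln_mult)
      ultimately have "1 + ln (real (L * M)) \<le> (1 + ln (real L)) * (1 + ln (real M))"
        by (simp add: algebra_simps)
      then show ?thesis using \<kappa>(1) by (intro mult_left_mono) auto
    qed
    finally show "real (card ?V) \<le> \<kappa> * real L * (1 + ln (real L)) * real M * (1 + ln (real M))"
      by (simp add: ac_simps)
  qed
qed

text \<open>By homogeneity, dividing by m yields zeros with coordinates at most M/m, so the weight m
  is exactly compensated. The origin has to be removed, since it is divisible by every m.\<close>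

lemma card_dual_zeros_dvd:
  assumes "\<And>M. M \<ge> 1 \<Longrightarrow> real (card {(r, s, t) \<in> centred_cube M. dual r s t = 0}) \<le> \<kappa> * real M * (1 + ln (real M))"
    and "\<kappa> \<ge> 0" "M \<ge> 1" "m \<ge> 1"
  shows "real m * real (card {(r, s, t) \<in> centred_cube M - {(0, 0, 0)}. dual r s t = 0 \<and>
      int m dvd r \<and> int m dvd s \<and> int m dvd t}) \<le> \<kappa> * real M * (1 + ln (real M))"
proof -
  let ?V = "{(r, s, t) \<in> centred_cube M - {(0, 0, 0)}. dual r s t = 0 \<and> int m dvd r \<and> int m dvd s \<and> int m dvd t}"
  let ?U = "{(r, s, t) \<in> centred_cube (M div m). dual r s t = 0}"
  have lnM: "ln (real M) \<ge> 0" using assms(3) by simp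
  have bd: "\<bar>x\<bar> \<le> int (M div m)" if "\<bar>int m * x\<bar> \<le> int M" for x
  proof -
    have "int m * \<bar>x\<bar> \<le> int M" using that by (simp add: abs_mult)
    then have "int m * \<bar>x\<bar> div int m \<le> int M div int m" using assms(4) by (intro zdiv_mono1) simp_all
    then have "\<bar>x\<bar> \<le> int M div int m" using assms(4) by simp
    then show ?thesis by (simp add: zdiv_int)
  qed
  have sub: "?V \<subseteq> (\<lambda>(r, s, t). (int m * r, int m * s, int m * t)) ` (?U - {(0, 0, 0)})"
  proof
    fix v assume v: "v \<in> ?V"
    then obtain r s t where rst: "v = (int m * r, int m * s, int m * t)" by (auto elim!: dvdE)
    have "dual (int m * r) (int m * s) (int m * t) = (int m)^2 * dual r s t"
      by (simp add: dual_def power2_eq_square algebra_simps)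
    then have "dual r s t = 0" using v assms(4) unfolding rst by simp
    moreover have "(r, s, t) \<in> centred_cube (M div m)"
      using v bd unfolding rst by (simp add: mem_centred_cube)
    moreover have "(r, s, t) \<noteq> (0, 0, 0)" using v unfolding rst by auto
    ultimately show "v \<in> (\<lambda>(r, s, t). (int m * r, int m * s, int m * t)) ` (?U - {(0, 0, 0)})"
      unfolding rst by force
  qed
  have finU: "finite ?U" by (rule finite_subset[of _ "centred_cube (M div m)"]) auto
  have le: "card ?V \<le> card (?U - {(0, 0, 0)})"
    using sub finU by (meson surj_card_le finite_Diff)
  show ?thesis
  proof (cases "M div m \<ge> 1")
    case False
    then have "?U - {(0, 0, 0)} = {}" by (auto simp: mem_centred_cube)
    then have "card (?U - {(0, 0, 0)}) = 0" by (simp only: card.empty)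
    then have V0: "card ?V = 0" using le by linarith
    have "0 \<le> \<kappa> * real M * (1 + ln (real M))" using assms(2) lnM by simp
    then show ?thesis unfolding V0 by simp
  next
    case True
    have "card ?V \<le> card ?U" using le finU by (meson card_Diff1_le le_trans)
    then have "real (card ?V) \<le> \<kappa> * real (M div m) * (1 + ln (real (M div m)))"
      using assms(1)[OF True] by linarith
    also have "\<dots> \<le> \<kappa> * real (M div m) * (1 + ln (real M))"
      using True assms(2) by (intro mult_left_mono add_left_mono) (auto intro!: ln_mono)
    finally have "real m * real (card ?V) \<le> real m * (\<kappa> * real (M div m) * (1 + ln (real M)))"
      by (intro mult_left_mono) auto
    also have "\<dots> = \<kappa> * real (m * (M div m)) * (1 + ln (real M))" by simp
    also have "\<dots> \<le> \<kappa> * real M * (1 + ln (real M))"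
      using assms(2) lnM by (intro mult_right_mono mult_left_mono of_nat_mono) auto
    finally show ?thesis .
  qed
qed

text \<open>A non-zero sum forces p^(n-1) to divide the dual form, which is too small for that
  unless it vanishes. The factor p^j from the exact power of p in the frequency is majorised by a
  sum over all i, a form in which the summation over frequencies can be interchanged.\<close>

lemma norm_exp_sum_le:
  assumes n: "n \<ge> 1" and nz: "(r, s, t) \<noteq> (0, 0, 0)"
    and size: "\<bar>r\<bar> < int (p ^ (n div 2))" "\<bar>s\<bar> < int (p ^ (n div 2))" "\<bar>t\<bar> < int (p ^ (n div 2))"
    and dual: "\<bar>dual r s t\<bar> < int (p ^ (n - 1))"
  shows "norm (exp_sum n (r, s, t)) \<le> real (2 * p ^ 3 * p ^ (n + (n - n div 2))) *
    (\<Sum>i<n. if dual r s t = 0 \<and> int (p ^ i) dvd r \<and> int (p ^ i) dvd s \<and> int (p ^ i) dvd t then real (p ^ i) else 0)"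
proof (cases "exp_sum n (r, s, t) = 0")
  case True
  then show ?thesis by (simp add: sum_nonneg)
next
  case False
  have "int p ^ (n - 1) dvd dual r s t"
    using exp_sum_nonzero[OF n] False unfolding exp_sum_def by blast
  then have z: "dual r s t = 0"
    using dual by (metis dvd_imp_le_int not_less abs_of_nat of_nat_power)
  let ?P = "\<lambda>i. int (p ^ i) dvd r \<and> int (p ^ i) dvd s \<and> int (p ^ i) dvd t"
  define k where "k = n div 2"
  \<comment> \<open>Entries smaller than p^k and divisible by it are zero. So the exact power p^j
    dividing the non-zero frequency has j < k, within the range of
    \<open>exp_sum_bound\<close>.\<close>
  have "\<not> ?P k"
  proof
    assume P: "?P k"
    have "r = 0" "s = 0" "t = 0"
      using P size unfolding k_def by (metis dvd_imp_le_int not_less abs_of_nat)+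
    then show False using nz by simp
  qed
  moreover have "?P 0" by simp
  ultimately have "\<exists>j<k. (\<forall>i\<le>j. \<not> \<not> ?P i) \<and> \<not> ?P (Suc j)"
    by (intro ex_least_nat_less[where P = "\<lambda>i. \<not> ?P i"]) blast+
  then obtain j where j: "j < k" "?P j" "\<not> ?P (Suc j)" by blast
  have "norm (exp_sum n (r, s, t)) \<le> real (2 * p ^ 3 * p ^ (n + (n - n div 2) + j))"
    unfolding exp_sum_def using j by (intro exp_sum_bound[OF n]) (auto simp: k_def)
  also have "\<dots> = real (2 * p ^ 3 * p ^ (n + (n - n div 2))) * real (p ^ j)"
    by (simp only: power_add of_nat_mult mult.assoc)
  also have "real (p ^ j) = (if dual r s t = 0 \<and> ?P j then real (p ^ j) else 0)" using z j by simp
  also have "real (2 * p ^ 3 * p ^ (n + (n - n div 2))) * (if dual r s t = 0 \<and> ?P j then real (p ^ j) else 0) \<le>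
     real (2 * p ^ 3 * p ^ (n + (n - n div 2))) * (\<Sum>i<n. if dual r s t = 0 \<and> ?P i then real (p ^ i) else 0)"
    using j(1) by (intro mult_left_mono member_le_sum[of j "{..<n}" "\<lambda>i. if dual r s t = 0 \<and> ?P i then real (p ^ i) else 0"])
      (auto simp: k_def)
  finally show ?thesis .
qed

text \<open>After interchanging summations each of the n levels i contributes p^i times the number
  of zeros divisible by p^i, which is of order M log M uniformly in i; hence the factor n.\<close>

lemma sum_norm_exp_sum:
  "\<exists>\<kappa>\<ge>0. \<forall>n\<ge>1. \<forall>M\<ge>1. M < p ^ (n div 2) \<longrightarrow> dual_size * (int M)^2 < int (p ^ (n - 1)) \<longrightarrow>
    (\<Sum>\<xi>\<in>centred_cube M - {(0, 0, 0)}. norm (exp_sum n \<xi>))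
      \<le> \<kappa> * real n * real M * (1 + ln (real M)) * real (p ^ (n + (n - n div 2)))"
proof -
  obtain \<kappa> where \<kappa>: "\<kappa> \<ge> 0"
    "\<And>M. M \<ge> 1 \<Longrightarrow> real (card {(r, s, t) \<in> centred_cube M. dual r s t = 0}) \<le> \<kappa> * real M * (1 + ln (real M))"
    using card_dual_zeros by blast
  show ?thesis
  proof (intro exI[of _ "2 * real p ^ 3 * \<kappa>"] conjI allI impI)
    show "0 \<le> 2 * real p ^ 3 * \<kappa>" using \<kappa>(1) by simp
    fix n M :: nat
    assume n: "n \<ge> 1" and M: "M \<ge> 1" "M < p ^ (n div 2)" "dual_size * (int M)^2 < int (p ^ (n - 1))"
    let ?C = "centred_cube M - {(0, 0, 0)}"
    let ?c = "real (2 * p ^ 3 * p ^ (n + (n - n div 2)))"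
    let ?P = "\<lambda>i (r, s, t). dual r s t = 0 \<and> int (p ^ i) dvd r \<and> int (p ^ i) dvd s \<and> int (p ^ i) dvd t"
    have "(\<Sum>\<xi>\<in>?C. norm (exp_sum n \<xi>)) \<le> (\<Sum>\<xi>\<in>?C. ?c * (\<Sum>i<n. if ?P i \<xi> then real (p ^ i) else 0))"
    proof (rule sum_mono)
      fix \<xi> assume \<xi>: "\<xi> \<in> ?C"
      obtain r s t where rst: "\<xi> = (r, s, t)" by (metis prod_cases3)
      have b: "\<bar>r\<bar> \<le> int M" "\<bar>s\<bar> \<le> int M" "\<bar>t\<bar> \<le> int M"
        using \<xi> unfolding rst by (auto simp: mem_centred_cube)
      have M2: "int M < int (p ^ (n div 2))" using M(2) by (simp only: of_nat_less_iff)
      show "norm (exp_sum n \<xi>) \<le> ?c * (\<Sum>i<n. if ?P i \<xi> then real (p ^ i) else 0)"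
        unfolding rst prod.case
      proof (rule norm_exp_sum_le[OF n])
        show "(r, s, t) \<noteq> (0, 0, 0)" using \<xi> rst by blast
        show "\<bar>r\<bar> < int (p ^ (n div 2))" "\<bar>s\<bar> < int (p ^ (n div 2))" "\<bar>t\<bar> < int (p ^ (n div 2))"
          using b M2 by linarith+
        show "\<bar>dual r s t\<bar> < int (p ^ (n - 1))" using dual_size_bound[OF b] M(3) by linarith
      qed
    qed
    also have "\<dots> = ?c * (\<Sum>i<n. \<Sum>\<xi>\<in>?C. if ?P i \<xi> then real (p ^ i) else 0)"
      unfolding sum_distrib_left[symmetric] by (subst sum.swap) (rule refl)
    also have "\<dots> = ?c * (\<Sum>i<n. real (p ^ i) * real (card {\<xi> \<in> ?C. ?P i \<xi>}))"
    proof -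
      have "(\<Sum>\<xi>\<in>?C. if ?P i \<xi> then real (p ^ i) else 0) = real (p ^ i) * real (card {\<xi> \<in> ?C. ?P i \<xi>})" for i
        by (subst sum.inter_filter[symmetric]) simp_all
      then show ?thesis by (simp only:)
    qed
    also have "\<dots> \<le> ?c * (\<Sum>i<n. \<kappa> * real M * (1 + ln (real M)))"
    proof (intro mult_left_mono sum_mono)
      fix i
      have "{\<xi> \<in> ?C. ?P i \<xi>} = {(r, s, t) \<in> ?C. dual r s t = 0 \<and> int (p ^ i) dvd r \<and> int (p ^ i) dvd s \<and> int (p ^ i) dvd t}"
        by auto
      moreover have "p ^ i \<ge> 1" using prime_gt_0_nat[OF prime_p] by simp
      ultimately show "real (p ^ i) * real (card {\<xi> \<in> ?C. ?P i \<xi>}) \<le> \<kappa> * real M * (1 + ln (real M))"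
        using card_dual_zeros_dvd[OF \<kappa>(2,1) M(1), of "p ^ i"] by (simp only:)
    qed simp
    also have "\<dots> = 2 * real p ^ 3 * \<kappa> * real n * real M * (1 + ln (real M)) * real (p ^ (n + (n - n div 2)))"
      by simp
    finally show "(\<Sum>\<xi>\<in>?C. norm (exp_sum n \<xi>))
      \<le> 2 * real p ^ 3 * \<kappa> * real n * real M * (1 + ln (real M)) * real (p ^ (n + (n - n div 2)))" .
  qed
qed

end

section \<open>Counting in weighted boxes\<close>

text \<open>A weak form of Jordan's inequality: monotonicity of 2 sin x - x up to pi/3, and beyond
  that the comparison of 2 sin(pi/3) = sqrt 3 with pi/2.\<close>

lemma two_sin_ge:
  fixes x :: real
  assumes "0 \<le> x" "x \<le> pi / 2" shows "x \<le> 2 * sin x"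
proof (cases "x \<le> pi / 3")
  case True
  have "2 * sin 0 - 0 \<le> 2 * sin x - x"
  proof (rule DERIV_nonneg_imp_nondecreasing[OF assms(1)])
    fix y assume y: "0 \<le> y" "y \<le> x"
    have "cos (pi / 3) \<le> cos y" using y True by (intro cos_monotone_0_pi_le) auto
    then have "0 \<le> 2 * cos y - 1" by (simp add: cos_60)
    moreover have "((\<lambda>x. 2 * sin x - x) has_real_derivative 2 * cos y - 1) (at y)"
      by (auto intro!: derivative_eq_intros)
    ultimately show "\<exists>z. ((\<lambda>x. 2 * sin x - x) has_real_derivative z) (at y) \<and> 0 \<le> z" by blast
  qed
  then show ?thesis by simp
next
  case False
  have "sin (pi / 3) \<le> sin x" using False assms by (intro sin_monotone_2pi_le) auto
  moreover have "sqrt 3 \<ge> 1.7" by (intro real_le_rsqrt) (simp add: power2_eq_square)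
  moreover have "pi / 2 < 1.6" using pi_approx by simp
  ultimately show ?thesis using assms by (simp add: sin_60)
qed

lemma norm_cis_minus_1: "norm (cis t - 1) = 2 * \<bar>sin (t / 2)\<bar>"
proof -
  have "(cos t - 1)^2 + (sin t)^2 = 2 - 2 * cos t"
    using sin_cos_squared_add[of t] by (simp add: power2_diff)
  also have "\<dots> = (2 * sin (t / 2))^2"
    using cos_double_sin[of "t / 2"] by (simp add: power_mult_distrib)
  finally have "(cos t - 1)^2 + (sin t)^2 = (2 * sin (t / 2))^2" .
  then have "norm (cis t - 1) = sqrt ((2 * sin (t / 2))^2)" by (simp add: cmod_def)
  also have "\<dots> = 2 * \<bar>sin (t / 2)\<bar>" unfolding real_sqrt_abs by (simp add: abs_mult)
  finally show ?thesis .
qed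

lemma norm_add_char_minus_1:
  assumes "q > 0" "2 * \<bar>x\<bar> \<le> int q"
  shows "norm (add_char q x - 1) \<ge> \<bar>of_int x\<bar> / real q"
proof -
  define t where "t = pi * \<bar>of_int x\<bar> / real q"
  have "2 * \<bar>real_of_int x\<bar> \<le> real q" using assms(2) by linarith
  then have t: "0 \<le> t" "t \<le> pi / 2" using assms(1) by (simp_all add: t_def field_simps)
  have "\<bar>of_int x\<bar> / real q \<le> t"
  proof -
    have "1 * \<bar>real_of_int x\<bar> \<le> pi * \<bar>of_int x\<bar>" using pi_gt3 by (intro mult_right_mono) auto
    then show ?thesis using assms(1) unfolding t_def by (simp add: divide_right_mono)
  qed
  also have "\<dots> \<le> 2 * sin t" by (rule two_sin_ge[OF t])
  also have "\<dots> \<le> 2 * \<bar>sin (2 * pi * of_int x / real q / 2)\<bar>"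
  proof (cases "x \<ge> 0")
    case True
    then have "2 * pi * of_int x / real q / 2 = t" by (simp add: t_def)
    then show ?thesis by simp
  next
    case False
    then have "2 * pi * of_int x / real q / 2 = - t" by (simp add: t_def)
    then show ?thesis by simp
  qed
  finally show ?thesis unfolding add_char_def norm_cis_minus_1 .
qed

text \<open>Geometric series. The bound does not depend on H, so it beats the trivial bound H once H
  exceeds 2 q / |x|.\<close>

lemma norm_sum_add_char_le:
  assumes "q > 0" "2 * \<bar>x\<bar> \<le> int q" "x \<noteq> 0"
  shows "norm (\<Sum>t\<in>{0..<int H}. add_char q (x * t)) \<le> 2 * real q / \<bar>of_int x\<bar>"
proof -
  define \<zeta> where "\<zeta> = add_char q x"
  have lower: "norm (\<zeta> - 1) \<ge> \<bar>of_int x\<bar> / real q"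
    unfolding \<zeta>_def by (rule norm_add_char_minus_1[OF assms(1,2)])
  moreover have pos: "\<bar>real_of_int x\<bar> / real q > 0" using assms by simp
  ultimately have ne: "\<zeta> \<noteq> 1" by auto
  have "(\<Sum>t\<in>{0..<int H}. add_char q (x * t)) = (\<Sum>t<H. \<zeta> ^ t)"
    unfolding sum_int_lessThan \<zeta>_def add_char_power by (simp add: mult.commute)
  also have "\<dots> = (\<zeta> ^ H - 1) / (\<zeta> - 1)" using ne by (rule geometric_sum)
  also have "norm \<dots> \<le> 2 / (\<bar>of_int x\<bar> / real q)"
    unfolding norm_divide
  proof (rule frac_le)
    have "norm (\<zeta> ^ H - 1) \<le> norm (\<zeta> ^ H) + norm (1 :: complex)" by (rule norm_triangle_ineq4)
    then show "norm (\<zeta> ^ H - 1) \<le> 2" by (simp add: norm_power \<zeta>_def)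
  qed (use lower pos in auto)
  finally show ?thesis by simp
qed

lemma sum_triple:
  "(\<Sum>\<tau>\<in>A \<times> B \<times> C. g \<tau>) = (\<Sum>i\<in>A. \<Sum>j\<in>B. \<Sum>k\<in>C. g (i, j, k))"
  unfolding sum.cartesian_product by (intro sum.cong refl) auto

text \<open>Residues are indexed by the symmetric interval, so that the frequencies of large modulus are
  exactly those at which the transform of the averaging weight is small.\<close>

lemma wave_sum_centred:
  assumes q: "q = 2 * h + 1"
  shows "(\<Sum>\<xi>\<in>centred_cube h. wave q \<xi> (x, y, z)) =
    (if int q dvd x \<and> int q dvd y \<and> int q dvd z then of_nat (q ^ 3) else 0)"
proof -
  have q0: "q > 0" using q by simp
  have 1: "(\<Sum>r\<in>{- int h..int h}. add_char q (r * x)) = (if int q dvd x then of_nat q else 0)" for x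
  proof -
    have "(\<Sum>r\<in>{- int h..int h}. add_char q (r * x)) = (\<Sum>r\<in>{0..<int q}. add_char q ((r - int h) * x))"
      by (rule sum.reindex_bij_witness[of _ "\<lambda>r. r - int h" "\<lambda>r. r + int h"]) (auto simp: q)
    also have "\<dots> = (\<Sum>r\<in>{0..<int q}. add_char q (r * x)) * add_char q (- int h * x)"
      unfolding sum_distrib_right by (intro sum.cong refl) (simp add: add_char_add[symmetric] left_diff_distrib)
    also have "\<dots> = (if int q dvd x then of_nat q else 0)"
    proof (cases "int q dvd x")
      case True
      then have "add_char q (- int h * x) = 1" using add_char_eq_1_iff[OF q0] by simp
      then show ?thesis using True sum_add_char[OF q0] by simp
    next
      case False
      then show ?thesis using sum_add_char[OF q0] by simp
    qed
    finally show ?thesis .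
  qed
  have "(\<Sum>\<xi>\<in>centred_cube h. wave q \<xi> (x, y, z)) =
      (\<Sum>r\<in>{- int h..int h}. \<Sum>s\<in>{- int h..int h}. \<Sum>t\<in>{- int h..int h}.
        add_char q (r * x) * (add_char q (s * y) * add_char q (t * z)))"
    unfolding centred_cube_def sum_triple by (simp add: add_char_add mult.assoc)
  also have "\<dots> = (\<Sum>r\<in>{- int h..int h}. add_char q (r * x)) * ((\<Sum>s\<in>{- int h..int h}. add_char q (s * y)) *
      (\<Sum>t\<in>{- int h..int h}. add_char q (t * z)))"
    by (simp only: sum_distrib_right sum_distrib_left[symmetric])
  also have "\<dots> = (if int q dvd x \<and> int q dvd y \<and> int q dvd z then of_nat (q ^ 3) else 0)"
    unfolding 1 by (auto simp: power3_eq_cube)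
  finally show ?thesis .
qed

definition neg3 :: "int \<times> int \<times> int \<Rightarrow> int \<times> int \<times> int" where
  "neg3 = (\<lambda>(x, y, z). (- x, - y, - z))"

lemma fourier_inversion:
  assumes q: "q = 2 * h + 1" and A: "A \<subseteq> cube q"
  shows "of_nat (q ^ 3) * of_bool (red q u \<in> A) =
    (\<Sum>\<xi>\<in>centred_cube h. (\<Sum>v\<in>A. wave q \<xi> v) * wave q \<xi> (neg3 u))"
proof -
  have finA: "finite A" using A finite_subset finite_cube by blast
  obtain x y z where u: "u = (x, y, z)" by (metis prod_cases3)
  have q0: "q > 0" using q by simp
  have key: "(\<Sum>\<xi>\<in>centred_cube h. wave q \<xi> v * wave q \<xi> (neg3 u)) = (if red q u = v then of_nat (q ^ 3) else 0)"
    if "v \<in> A" for v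
  proof -
    obtain x' y' z' where v: "v = (x', y', z')" by (metis prod_cases3)
    have "(\<Sum>\<xi>\<in>centred_cube h. wave q \<xi> v * wave q \<xi> (neg3 u)) =
        (\<Sum>\<xi>\<in>centred_cube h. wave q \<xi> (x' - x, y' - y, z' - z))"
      by (intro sum.cong refl) (auto simp: u v neg3_def wave_def add_char_add[symmetric] algebra_simps
          intro!: arg_cong[where f = "add_char q"])
    also have "\<dots> = (if red q v = red q u then of_nat (q ^ 3) else 0)"
      unfolding wave_sum_centred[OF q] u v red_eq_iff ..
    also have "red q v = v" using that A red_id by blast
    finally show ?thesis by (simp add: eq_commute)
  qed
  have "(\<Sum>\<xi>\<in>centred_cube h. (\<Sum>v\<in>A. wave q \<xi> v) * wave q \<xi> (neg3 u)) =
      (\<Sum>v\<in>A. \<Sum>\<xi>\<in>centred_cube h. wave q \<xi> v * wave q \<xi> (neg3 u))"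
    unfolding sum_distrib_right by (rule sum.swap)
  also have "\<dots> = (\<Sum>v\<in>A. if red q u = v then of_nat (q ^ 3) else 0)" using key by (intro sum.cong refl) blast
  also have "\<dots> = of_nat (q ^ 3) * of_bool (red q u \<in> A)" using finA by simp
  finally show ?thesis ..
qed

definition translate :: "int \<times> int \<times> int \<Rightarrow> int \<times> int \<times> int \<Rightarrow> int \<times> int \<times> int" where
  "translate = (\<lambda>(x, y, z) (x', y', z'). (x + x', y + y', z + z'))"

definition shift3 :: "('a \<Rightarrow> int) \<Rightarrow> 'a \<times> 'a \<times> 'a \<Rightarrow> int \<times> int \<times> int" where
  "shift3 s = (\<lambda>(i, j, k). (s i, s j, s k))"

text \<open>The zero frequency yields card A / q^3. In the cube of side M the normalised transform
  of the weight is bounded by 1, which leaves the sum of exponential sums. Outside it some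
  coordinate exceeds M and supplies a factor \<beta>; the number of frequencies and each exponential
  sum are bounded by q^3, which gives q^3 \<beta> after division by q^3.\<close>

lemma averaged_count_bound:
  fixes T :: "'a set" and s :: "'a \<Rightarrow> int"
  assumes q: "q = 2 * h + 1" and A: "A \<subseteq> cube q" and T: "finite T" "T \<noteq> {}"
    and \<beta>: "0 \<le> \<beta>" "\<And>x. int M < \<bar>x\<bar> \<Longrightarrow> \<bar>x\<bar> \<le> int h \<Longrightarrow>
      norm (\<Sum>\<tau>\<in>T. add_char q (x * s \<tau>)) \<le> \<beta> * real (card T)"
  shows "\<bar>(\<Sum>\<tau>\<in>T \<times> T \<times> T. of_bool (red q (translate u (shift3 s \<tau>)) \<in> A)) / real (card T) ^ 3 -
      real (card A) / real q ^ 3\<bar> \<le>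
    (\<Sum>\<xi>\<in>centred_cube M - {(0, 0, 0)}. norm (\<Sum>v\<in>A. wave q \<xi> v)) / real q ^ 3 + real q ^ 3 * \<beta>"
proof -
  define E where "E \<xi> = (\<Sum>v\<in>A. wave q \<xi> v)" for \<xi>
  define B where "B x = (\<Sum>\<tau>\<in>T. add_char q (x * s \<tau>))" for x
  \<comment> \<open>The transform of the product weight factorises; the signs come from the
    conjugate characters in Fourier inversion.\<close>
  define B3 where "B3 = (\<lambda>(r, s, t). B (- r) * B (- s) * B (- t))"
  define c where "c = real (card T)"
  define S where "S = (\<Sum>\<tau>\<in>T \<times> T \<times> T. of_bool (red q (translate u (shift3 s \<tau>)) \<in> A) :: real)"
  have q0: "q > 0" using q by simp
  have c: "c > 0" using T by (simp add: c_def card_gt_0_iff)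
  have finA: "finite A" using A finite_subset finite_cube by blast
  have cardA: "card A \<le> q ^ 3" using card_mono[OF _ A] by simp
  have B_le: "norm (B x) \<le> c" for x
    unfolding B_def c_def by (rule order_trans[OF norm_sum]) simp
  have B_small: "norm (B (- x)) \<le> \<beta> * c" if "int M < \<bar>x\<bar>" "\<bar>x\<bar> \<le> int h" for x
    using \<beta>(2)[of "- x"] that unfolding B_def c_def by simp
  have sumB: "(\<Sum>\<tau>\<in>T \<times> T \<times> T. wave q \<xi> (neg3 (translate u (shift3 s \<tau>)))) = wave q \<xi> (neg3 u) * B3 \<xi>" for \<xi>
  proof -
    obtain x y z r i t where uxi: "u = (x, y, z)" "\<xi> = (r, i, t)" by (metis prod_cases3)
    have "B3 \<xi> = (\<Sum>\<tau>\<in>T. add_char q (- r * s \<tau>)) * ((\<Sum>\<tau>\<in>T. add_char q (- i * s \<tau>)) * (\<Sum>\<tau>\<in>T. add_char q (- t * s \<tau>)))"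
      by (simp add: B3_def B_def uxi mult.assoc)
    also have "\<dots> = (\<Sum>\<tau>1\<in>T. \<Sum>\<tau>2\<in>T. \<Sum>\<tau>3\<in>T. add_char q (- r * s \<tau>1) * (add_char q (- i * s \<tau>2) * add_char q (- t * s \<tau>3)))"
      by (simp only: sum_distrib_right sum_distrib_left[symmetric])
    finally have B3: "B3 \<xi> = (\<Sum>\<tau>1\<in>T. \<Sum>\<tau>2\<in>T. \<Sum>\<tau>3\<in>T. add_char q (- r * s \<tau>1) * (add_char q (- i * s \<tau>2) * add_char q (- t * s \<tau>3)))" .
    have pt: "wave q \<xi> (neg3 (translate u (shift3 s (\<tau>1, \<tau>2, \<tau>3)))) =
        wave q \<xi> (neg3 u) * (add_char q (- r * s \<tau>1) * (add_char q (- i * s \<tau>2) * add_char q (- t * s \<tau>3)))"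
      for \<tau>1 \<tau>2 \<tau>3
      unfolding uxi shift3_def translate_def neg3_def prod.case wave_simp add_char_add[symmetric]
      by (rule arg_cong[where f = "add_char q"]) (simp add: algebra_simps)
    have "(\<Sum>\<tau>\<in>T \<times> T \<times> T. wave q \<xi> (neg3 (translate u (shift3 s \<tau>)))) =
        (\<Sum>\<tau>1\<in>T. \<Sum>\<tau>2\<in>T. \<Sum>\<tau>3\<in>T. wave q \<xi> (neg3 u) * (add_char q (- r * s \<tau>1) * (add_char q (- i * s \<tau>2) * add_char q (- t * s \<tau>3))))"
      unfolding sum_triple by (intro sum.cong refl pt)
    then show ?thesis unfolding B3 sum_distrib_left .
  qed
  have "complex_of_real (real (q ^ 3) * S) = (\<Sum>\<tau>\<in>T \<times> T \<times> T. of_nat (q ^ 3) * of_bool (red q (translate u (shift3 s \<tau>)) \<in> A))"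
    unfolding S_def sum_distrib_left of_real_sum by (intro sum.cong refl) simp
  also have "\<dots> = (\<Sum>\<tau>\<in>T \<times> T \<times> T. \<Sum>\<xi>\<in>centred_cube h. E \<xi> * wave q \<xi> (neg3 (translate u (shift3 s \<tau>))))"
    unfolding E_def fourier_inversion[OF q A] ..
  also have "\<dots> = (\<Sum>\<xi>\<in>centred_cube h. E \<xi> * (\<Sum>\<tau>\<in>T \<times> T \<times> T. wave q \<xi> (neg3 (translate u (shift3 s \<tau>)))))"
    unfolding sum_distrib_left by (rule sum.swap)
  also have "\<dots> = (\<Sum>\<xi>\<in>centred_cube h. E \<xi> * (wave q \<xi> (neg3 u) * B3 \<xi>))" unfolding sumB ..
  also have "\<dots> = E (0, 0, 0) * (wave q (0, 0, 0) (neg3 u) * B3 (0, 0, 0)) +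
      (\<Sum>\<xi>\<in>centred_cube h - {(0, 0, 0)}. E \<xi> * (wave q \<xi> (neg3 u) * B3 \<xi>))"
    by (rule sum.remove) (simp_all add: mem_centred_cube)
  also have "E (0, 0, 0) * (wave q (0, 0, 0) (neg3 u) * B3 (0, 0, 0)) = complex_of_real (real (card A) * c ^ 3)"
  proof -
    have "wave q (0, 0, 0) v = 1" for v by (cases v) simp
    then show ?thesis by (simp add: E_def B3_def B_def c_def power3_eq_cube)
  qed
  finally have diff: "complex_of_real (real (q ^ 3) * S - real (card A) * c ^ 3) =
      (\<Sum>\<xi>\<in>centred_cube h - {(0, 0, 0)}. E \<xi> * (wave q \<xi> (neg3 u) * B3 \<xi>))" by simp
  have B3_le: "norm (B3 \<xi>) \<le> c ^ 3" for \<xi>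
  proof -
    obtain r i t where "\<xi> = (r, i, t)" by (metis prod_cases3)
    then have "norm (B3 \<xi>) = norm (B (- r)) * norm (B (- i)) * norm (B (- t))" by (simp add: B3_def norm_mult)
    also have "\<dots> \<le> c * c * c" using c by (intro mult_mono B_le mult_nonneg_nonneg) auto
    finally show ?thesis by (simp add: power3_eq_cube)
  qed
  have B3_small: "norm (B3 \<xi>) \<le> \<beta> * c ^ 3" if \<xi>: "\<xi> \<in> centred_cube h" "\<xi> \<notin> centred_cube M" for \<xi>
  proof -
    obtain r i t where rit: "\<xi> = (r, i, t)" by (metis prod_cases3)
    have n: "norm (B3 \<xi>) = norm (B (- r)) * norm (B (- i)) * norm (B (- t))" by (simp add: B3_def norm_mult rit)
    have h: "\<bar>r\<bar> \<le> int h" "\<bar>i\<bar> \<le> int h" "\<bar>t\<bar> \<le> int h" using \<xi>(1) unfolding rit by (auto simp: mem_centred_cube)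
    consider "int M < \<bar>r\<bar>" | "int M < \<bar>i\<bar>" | "int M < \<bar>t\<bar>"
      using \<xi>(2) unfolding rit mem_centred_cube by linarith
    then have "norm (B3 \<xi>) \<le> (\<beta> * c) * c * c"
    proof cases
      case 1
      then show ?thesis unfolding n using c \<beta>(1) h by (intro mult_mono B_le B_small mult_nonneg_nonneg) auto
    next
      case 2
      have "norm (B (- r)) * norm (B (- i)) * norm (B (- t)) \<le> c * (\<beta> * c) * c"
        using 2 c \<beta>(1) h by (intro mult_mono B_le B_small mult_nonneg_nonneg) auto
      then show ?thesis unfolding n by (simp add: ac_simps)
    next
      case 3
      have "norm (B (- r)) * norm (B (- i)) * norm (B (- t)) \<le> c * c * (\<beta> * c)"
        using 3 c \<beta>(1) h by (intro mult_mono B_le B_small mult_nonneg_nonneg) auto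
      then show ?thesis unfolding n by (simp add: ac_simps)
    qed
    then show ?thesis by (simp add: power3_eq_cube ac_simps)
  qed
  have E_le: "norm (E \<xi>) \<le> real (q ^ 3)" for \<xi>
  proof -
    have "norm (E \<xi>) \<le> (\<Sum>v\<in>A. norm (wave q \<xi> v))" unfolding E_def by (rule norm_sum)
    also have "\<dots> = real (card A)" by simp
    finally show ?thesis using cardA by (metis of_nat_le_iff order_trans)
  qed
  have term_le: "norm (E \<xi> * (wave q \<xi> (neg3 u) * B3 \<xi>)) \<le>
      (if \<xi> \<in> centred_cube M then norm (E \<xi>) * c ^ 3 else 0) + real (q ^ 3) * (\<beta> * c ^ 3)"
    if \<xi>: "\<xi> \<in> centred_cube h - {(0, 0, 0)}" for \<xi>
  proof (cases "\<xi> \<in> centred_cube M")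
    case True
    have "norm (E \<xi>) * norm (B3 \<xi>) \<le> norm (E \<xi>) * c ^ 3" by (intro mult_left_mono B3_le) simp
    moreover have "0 \<le> real (q ^ 3) * (\<beta> * c ^ 3)" using \<beta>(1) c by simp
    ultimately show ?thesis using True by (simp add: norm_mult)
  next
    case False
    have "norm (E \<xi>) * norm (B3 \<xi>) \<le> real (q ^ 3) * (\<beta> * c ^ 3)"
      using False \<xi> by (intro mult_mono E_le B3_small) auto
    then show ?thesis using False by (simp add: norm_mult)
  qed
  have card_h: "card (centred_cube h) = q ^ 3"
    by (simp add: centred_cube_def card_cartesian_product q power3_eq_cube nat_add_distrib nat_mult_distrib)
  have "\<bar>real (q ^ 3) * S - real (card A) * c ^ 3\<bar> = norm (complex_of_real (real (q ^ 3) * S - real (card A) * c ^ 3))"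
    by (simp only: norm_of_real)
  also have "\<dots> \<le> (\<Sum>\<xi>\<in>centred_cube h - {(0, 0, 0)}. norm (E \<xi> * (wave q \<xi> (neg3 u) * B3 \<xi>)))"
    unfolding diff by (rule norm_sum)
  also have "\<dots> \<le> (\<Sum>\<xi>\<in>centred_cube h - {(0, 0, 0)}.
      (if \<xi> \<in> centred_cube M then norm (E \<xi>) * c ^ 3 else 0) + real (q ^ 3) * (\<beta> * c ^ 3))"
    by (intro sum_mono term_le)
  also have "\<dots> = (\<Sum>\<xi>\<in>centred_cube h - {(0, 0, 0)}. if \<xi> \<in> centred_cube M then norm (E \<xi>) * c ^ 3 else 0) +
      real (card (centred_cube h - {(0, 0, 0)})) * (real (q ^ 3) * (\<beta> * c ^ 3))"
    by (simp add: sum.distrib)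
  also have "\<dots> \<le> (\<Sum>\<xi>\<in>centred_cube M - {(0, 0, 0)}. norm (E \<xi>) * c ^ 3) + real (q ^ 3) * (real (q ^ 3) * (\<beta> * c ^ 3))"
  proof (intro add_mono mult_right_mono)
    have "(\<Sum>\<xi>\<in>centred_cube h - {(0, 0, 0)}. if \<xi> \<in> centred_cube M then norm (E \<xi>) * c ^ 3 else 0) =
        (\<Sum>\<xi>\<in>{\<xi> \<in> centred_cube h - {(0, 0, 0)}. \<xi> \<in> centred_cube M}. norm (E \<xi>) * c ^ 3)"
      by (rule sum.inter_filter[symmetric]) simp
    also have "\<dots> \<le> (\<Sum>\<xi>\<in>centred_cube M - {(0, 0, 0)}. norm (E \<xi>) * c ^ 3)"
      using c by (intro sum_mono2) auto
    finally show "(\<Sum>\<xi>\<in>centred_cube h - {(0, 0, 0)}. if \<xi> \<in> centred_cube M then norm (E \<xi>) * c ^ 3 else 0)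
        \<le> (\<Sum>\<xi>\<in>centred_cube M - {(0, 0, 0)}. norm (E \<xi>) * c ^ 3)" .
    have "card (centred_cube h - {(0, 0, 0)}) \<le> card (centred_cube h)" by (intro card_mono) auto
    then show "real (card (centred_cube h - {(0, 0, 0)})) \<le> real (q ^ 3)" unfolding card_h by (rule of_nat_mono)
    show "0 \<le> real (q ^ 3) * (\<beta> * c ^ 3)" using \<beta>(1) c by simp
  qed
  finally have main: "\<bar>real q ^ 3 * S - real (card A) * c ^ 3\<bar> \<le>
      (\<Sum>\<xi>\<in>centred_cube M - {(0, 0, 0)}. norm (E \<xi>)) * c ^ 3 + real q ^ 3 * (real q ^ 3 * (\<beta> * c ^ 3))"
    by (simp add: sum_distrib_right)
  have pos: "real q ^ 3 * c ^ 3 > 0" using q0 c by simp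
  have "\<bar>S / c ^ 3 - real (card A) / real q ^ 3\<bar> = \<bar>real q ^ 3 * S - real (card A) * c ^ 3\<bar> / (real q ^ 3 * c ^ 3)"
  proof -
    have "S / c ^ 3 - real (card A) / real q ^ 3 = (real q ^ 3 * S - real (card A) * c ^ 3) / (real q ^ 3 * c ^ 3)"
      using pos q0 c by (subst diff_frac_eq) (auto simp: mult.commute)
    then show ?thesis using pos by (simp add: abs_divide)
  qed
  also have "\<dots> \<le> ((\<Sum>\<xi>\<in>centred_cube M - {(0, 0, 0)}. norm (E \<xi>)) * c ^ 3 + real q ^ 3 * (real q ^ 3 * (\<beta> * c ^ 3))) / (real q ^ 3 * c ^ 3)"
    using main pos by (intro divide_right_mono) auto
  also have "\<dots> = (\<Sum>\<xi>\<in>centred_cube M - {(0, 0, 0)}. norm (E \<xi>)) / real q ^ 3 + real q ^ 3 * \<beta>"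
  proof -
    have gen: "(E' * C + Q * (Q * (\<beta> * C))) / (Q * C) = E' / Q + Q * \<beta>" if "Q \<noteq> 0" "C \<noteq> 0" for E' Q C :: real
      using that by (simp add: field_simps)
    show ?thesis by (rule gen) (use q0 c in auto)
  qed
  finally show ?thesis unfolding S_def E_def c_def .
qed

text \<open>Sums of such tuples are distributed like the r-fold convolution of an interval, so their
  transform is an r-th power. Averaging over tuples avoids writing out the convolution
  weight.\<close>

definition tuples :: "nat \<Rightarrow> nat \<Rightarrow> (nat \<Rightarrow> int) set" where
  "tuples r H = PiE {..<r} (\<lambda>_. {0..<int H})"

definition tuple_sum :: "nat \<Rightarrow> (nat \<Rightarrow> int) \<Rightarrow> int" where
  "tuple_sum r \<tau> = (\<Sum>i<r. \<tau> i)"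

lemma finite_tuples [simp]: "finite (tuples r H)"
  by (simp add: tuples_def finite_PiE)

lemma card_tuples [simp]: "card (tuples r H) = H ^ r"
  by (simp add: tuples_def card_PiE)

lemma tuple_sum_bounds:
  assumes "\<tau> \<in> tuples r H" shows "0 \<le> tuple_sum r \<tau>" "tuple_sum r \<tau> \<le> int (r * H)"
proof -
  have \<tau>: "0 \<le> \<tau> i \<and> \<tau> i \<le> int H" if "i < r" for i
  proof -
    have "\<tau> i \<in> {0..<int H}"
      using PiE_mem[of \<tau> "{..<r}" "\<lambda>_. {0..<int H}" i] assms that unfolding tuples_def by simp
    then show ?thesis by simp
  qed
  show "0 \<le> tuple_sum r \<tau>" unfolding tuple_sum_def using \<tau> by (intro sum_nonneg) auto
  have "tuple_sum r \<tau> \<le> (\<Sum>i<r. int H)" unfolding tuple_sum_def using \<tau> by (intro sum_mono) auto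
  then show "tuple_sum r \<tau> \<le> int (r * H)" by simp
qed

lemma add_char_sum: "finite I \<Longrightarrow> add_char q (\<Sum>i\<in>I. g i) = (\<Prod>i\<in>I. add_char q (g i))"
  by (induction I rule: finite_induct) (simp_all add: add_char_add)

lemma sum_add_char_tuples:
  "(\<Sum>\<tau>\<in>tuples r H. add_char q (x * tuple_sum r \<tau>)) = (\<Sum>t\<in>{0..<int H}. add_char q (x * t)) ^ r"
proof -
  have "(\<Sum>\<tau>\<in>tuples r H. add_char q (x * tuple_sum r \<tau>)) = (\<Sum>\<tau>\<in>PiE {..<r} (\<lambda>_. {0..<int H}). \<Prod>i<r. add_char q (x * \<tau> i))"
    unfolding tuples_def tuple_sum_def by (intro sum.cong refl) (simp add: sum_distrib_left add_char_sum)
  also have "\<dots> = (\<Prod>i<r. \<Sum>t\<in>{0..<int H}. add_char q (x * t))"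
    by (rule prod_sum_PiE[symmetric]) auto
  finally show ?thesis by simp
qed

lemma norm_sum_tuples_le:
  assumes q: "q = 2 * h + 1" and "M \<ge> 1" "H \<ge> 1" "int M < \<bar>x\<bar>" "\<bar>x\<bar> \<le> int h"
  shows "norm (\<Sum>\<tau>\<in>tuples r H. add_char q (x * tuple_sum r \<tau>)) \<le> (2 * real q / (real M * real H)) ^ r * real (card (tuples r H))"
proof -
  have xM: "real M \<le> \<bar>of_int x\<bar>" using assms(4) by linarith
  have "norm (\<Sum>t\<in>{0..<int H}. add_char q (x * t)) \<le> 2 * real q / \<bar>of_int x\<bar>"
    using assms by (intro norm_sum_add_char_le) auto
  also have "\<dots> \<le> 2 * real q / real M" using assms(2) xM by (intro divide_left_mono) auto
  finally have "norm (\<Sum>t\<in>{0..<int H}. add_char q (x * t)) ^ r \<le> (2 * real q / real M) ^ r"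
    by (intro power_mono) auto
  also have "\<dots> = (2 * real q / (real M * real H) * real H) ^ r" using assms(3) by simp
  also have "\<dots> = (2 * real q / (real M * real H)) ^ r * real (card (tuples r H))"
    by (simp only: power_mult_distrib card_tuples of_nat_power)
  finally show ?thesis unfolding sum_add_char_tuples norm_power .
qed

context form_mod_prime
begin

text \<open>The choice M = q^(1/2-\<delta>/2) settles both errors: the lower bound on q^\<delta>
  makes dual_size M^2 smaller than p^(n-1), so low frequencies need the dual form to vanish, while M
  H is at least q^(1+\<delta>/2)/2, so each interval average saves q^(\<delta>/2) up to a factor
  4.\<close>

lemma equidistribution_bound:
  assumes \<delta>: "0 < \<delta>" "\<delta> \<le> 1"
  shows "\<exists>\<kappa>. \<forall>n\<ge>1. real (p ^ n) powr \<delta> > real p * (real_of_int dual_size + 1) \<longrightarrow>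
    (\<forall>u H. real H \<ge> real (p ^ n) powr (1/2 + \<delta>) \<longrightarrow>
      \<bar>(\<Sum>\<tau>\<in>tuples r H \<times> tuples r H \<times> tuples r H. of_bool (sol n (translate u (shift3 (tuple_sum r) \<tau>))))
        / real (card (tuples r H)) ^ 3 - density_const p a b c / real (p ^ n)\<bar> \<le>
      \<kappa> * ln (real (p ^ n)) * (1 + ln (real (p ^ n))) * real (p ^ n) powr (- \<delta> / 2) / real (p ^ n)
        + real (p ^ n) ^ 3 * (4 * real (p ^ n) powr (- \<delta> / 2)) ^ r)"
proof -
  obtain \<kappa> where \<kappa>0: "\<kappa> \<ge> 0" and \<kappa>: "\<And>n M. n \<ge> 1 \<Longrightarrow> M \<ge> 1 \<Longrightarrow> M < p ^ (n div 2) \<Longrightarrow> dual_size * (int M)^2 < int (p ^ (n - 1)) \<Longrightarrow>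
    (\<Sum>\<xi>\<in>centred_cube M - {(0, 0, 0)}. norm (exp_sum n \<xi>))
      \<le> \<kappa> * real n * real M * (1 + ln (real M)) * real (p ^ (n + (n - n div 2)))"
    using sum_norm_exp_sum by blast
  show ?thesis
  proof (intro exI[of _ "\<kappa> * real p"] allI impI)
    fix n u H
    assume n: "n \<ge> 1" and big: "real (p ^ n) powr \<delta> > real p * (real_of_int dual_size + 1)"
      and H: "real H \<ge> real (p ^ n) powr (1/2 + \<delta>)"
    define q where "q = real (p ^ n)"
    have p3: "p \<ge> 3" using p_odd_gt by simp
    have "real p ^ 1 \<le> real p ^ n" using n p3 by (intro power_increasing) auto
    then have qp: "q \<ge> real p" by (simp add: q_def)
    have q1: "q \<ge> 1" "q > 0" using qp p3 by linarith+
    define Mr where "Mr = q powr (1/2 - \<delta>/2)"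
    define M where "M = nat \<lfloor>Mr\<rfloor>"
    have Mr1: "Mr \<ge> 1" unfolding Mr_def using q1 \<delta> by (intro ge_one_powr_ge_zero) auto
    have M: "real M \<le> Mr" "Mr < real M + 1" "M \<ge> 1" using Mr1 unfolding M_def by linarith+
    have M2: "Mr \<le> 2 * real M" using M by linarith
    have Mr2: "Mr^2 = q powr (1 - \<delta>)"
    proof -
      have "Mr^2 = q powr (1/2 - \<delta>/2 + (1/2 - \<delta>/2))" unfolding Mr_def powr_add power2_eq_square ..
      then show ?thesis by simp
    qed
    have M_sq: "real M ^ 2 \<le> q powr (1 - \<delta>)" unfolding Mr2[symmetric] using M by (intro power_mono) auto
    have qd: "q powr (1 - \<delta>) * q powr \<delta> = q" using q1 by (simp add: powr_add[symmetric])
    have ds: "real_of_int dual_size \<ge> 0" by (simp add: dual_size_def)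
    have qd0: "q powr (1 - \<delta>) > 0" using q1 by simp
    have key: "q powr (1 - \<delta>) * (real p * (real_of_int dual_size + 1)) < q"
      using mult_strict_left_mono[OF big[folded q_def] qd0] qd by simp
    have pn1: "real (p ^ (n - 1)) * real p = q" using n by (simp add: q_def power_eq_if mult.commute)
    have "real M ^ 2 * (real_of_int dual_size + 1) * real p \<le> q powr (1 - \<delta>) * (real_of_int dual_size + 1) * real p"
      using M_sq ds by (intro mult_right_mono) auto
    also have "\<dots> < real (p ^ (n - 1)) * real p" using key pn1 by (simp add: ac_simps)
    finally have lt: "real M ^ 2 * (real_of_int dual_size + 1) < real (p ^ (n - 1))"
      using p3 by simp
    have "real_of_int dual_size * real M ^ 2 < real (p ^ (n - 1))"
    proof -
      have "real M ^ 2 * (real_of_int dual_size + 1) = real_of_int dual_size * real M ^ 2 + real M ^ 2"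
        by (simp add: algebra_simps)
      then show ?thesis using lt zero_le_power2[of "real M"] by linarith
    qed
    then have "real_of_int (dual_size * (int M)^2) < real_of_int (int (p ^ (n - 1)))" by simp
    then have c1: "dual_size * (int M)^2 < int (p ^ (n - 1))" by (simp only: of_int_less_iff)
    have "real M ^ 2 * 1 \<le> real M ^ 2 * (real_of_int dual_size + 1)" using ds by (intro mult_left_mono) auto
    then have "real M ^ 2 < real (p ^ (n - 1))" using lt by linarith
    also have "\<dots> \<le> real (p ^ (n div 2 * 2))" using p3 by (intro of_nat_mono power_increasing) auto
    also have "\<dots> = real (p ^ (n div 2)) ^ 2" by (simp add: power_mult)
    finally have "real M < real (p ^ (n div 2))" by (rule power_less_imp_less_base) simp
    then have c2: "M < p ^ (n div 2)" by simp
    have "odd (p ^ n)" using odd_p by simp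
    then obtain h where h: "p ^ n = 2 * h + 1" by (elim oddE)
    define \<beta> where "\<beta> = (2 * q / (real M * real H)) ^ r"
    have "0 < q powr (1/2 + \<delta>)" using q1 by simp
    then have Hpos: "real H > 0" using H unfolding q_def[symmetric] by linarith
    have H1: "H \<ge> 1" using Hpos by simp
    let ?A = "{v \<in> cube (p ^ n). sol n v}"
    let ?T = "tuples r H"
    have T: "?T \<noteq> {}"
    proof
      assume "?T = {}"
      then have "H ^ r = 0" using card_tuples[of r H] by simp
      then show False using H1 by simp
    qed
    have "\<bar>(\<Sum>\<tau>\<in>?T \<times> ?T \<times> ?T. of_bool (red (p ^ n) (translate u (shift3 (tuple_sum r) \<tau>)) \<in> ?A)) / real (card ?T) ^ 3 -
      real (card ?A) / real (p ^ n) ^ 3\<bar> \<le>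
      (\<Sum>\<xi>\<in>centred_cube M - {(0, 0, 0)}. norm (\<Sum>v\<in>?A. wave (p ^ n) \<xi> v)) / real (p ^ n) ^ 3 + real (p ^ n) ^ 3 * \<beta>"
    proof (rule averaged_count_bound[OF h _ _ T])
      show "0 \<le> \<beta>" unfolding \<beta>_def using q1 by simp
      show "norm (\<Sum>\<tau>\<in>?T. add_char (p ^ n) (x * tuple_sum r \<tau>)) \<le> \<beta> * real (card ?T)"
        if "int M < \<bar>x\<bar>" "\<bar>x\<bar> \<le> int h" for x
        using norm_sum_tuples_le[OF h M(3) H1 that] unfolding \<beta>_def q_def .
    qed auto
    moreover have "red (p ^ n) v \<in> ?A \<longleftrightarrow> sol n v" for v
      using red_sol[OF n] red_in_cube[of "p ^ n" v] p3 by simp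
    moreover have "real (card ?A) / real (p ^ n) ^ 3 = density_const p a b c / real (p ^ n)"
      unfolding card_sol[OF n] using q1 unfolding q_def[symmetric] by (simp add: power2_eq_square power3_eq_cube)
    ultimately have main: "\<bar>(\<Sum>\<tau>\<in>?T \<times> ?T \<times> ?T. of_bool (sol n (translate u (shift3 (tuple_sum r) \<tau>)))) / real (card ?T) ^ 3 -
      density_const p a b c / real (p ^ n)\<bar> \<le>
      (\<Sum>\<xi>\<in>centred_cube M - {(0, 0, 0)}. norm (exp_sum n \<xi>)) / q ^ 3 + q ^ 3 * \<beta>"
      unfolding exp_sum_def q_def by simp
    have lnq: "ln q \<ge> 0" using q1 by simp
    have "(\<Sum>\<xi>\<in>centred_cube M - {(0, 0, 0)}. norm (exp_sum n \<xi>))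
        \<le> \<kappa> * real n * real M * (1 + ln (real M)) * real (p ^ (n + (n - n div 2)))"
      by (rule \<kappa>[OF n M(3) c2 c1])
    also have "\<dots> \<le> \<kappa> * ln q * Mr * (1 + ln q) * (q * (real p * q powr (1/2)))"
    proof (intro mult_mono)
      \<comment> \<open>As p is at least 3 > e, the number n of levels is at most n ln p = ln
        q.\<close>
      have "1 \<le> ln (real p)"
      proof -
        have "exp 1 \<le> real p" using exp_le p3 by linarith
        then show ?thesis using p3 by (simp add: ln_ge_iff)
      qed
      then have "real n * 1 \<le> real n * ln (real p)" by (intro mult_left_mono) auto
      also have "\<dots> = ln q" using p3 by (simp add: q_def ln_realpow)
      finally show "real n \<le> ln q" by simp
      have "Mr \<le> q powr 1" unfolding Mr_def using q1 \<delta> by (intro powr_mono) auto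
      then have "real M \<le> q" using M q1 by simp
      then show "1 + ln (real M) \<le> 1 + ln q" using M(3) by simp
      \<comment> \<open>Rounding n/2 up costs at most the fixed factor p.\<close>
      have "real (p ^ (n - n div 2)) ^ 2 = real (p ^ ((n - n div 2) * 2))" by (simp add: power_mult)
      also have "\<dots> \<le> real (p ^ (n + 2))" using p3 by (intro of_nat_mono power_increasing) auto
      also have "\<dots> = (real p * q powr (1/2)) ^ 2"
        using q1 by (simp add: q_def power_mult_distrib power_add powr_half_sqrt power2_eq_square)
      finally have le: "real (p ^ (n - n div 2)) \<le> real p * q powr (1/2)"
        by (rule power2_le_imp_le) simp
      show "real (p ^ (n + (n - n div 2))) \<le> q * (real p * q powr (1/2))"
      proof -
        have "real (p ^ (n + (n - n div 2))) = q * real (p ^ (n - n div 2))"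
          by (simp only: q_def power_add of_nat_mult)
        also have "\<dots> \<le> q * (real p * q powr (1/2))" using le q1 by (intro mult_left_mono) auto
        finally show ?thesis .
      qed
    qed (use \<kappa>0 lnq M q1 Mr1 in \<open>auto intro!: mult_nonneg_nonneg\<close>)
    finally have le: "(\<Sum>\<xi>\<in>centred_cube M - {(0, 0, 0)}. norm (exp_sum n \<xi>))
        \<le> \<kappa> * ln q * Mr * (1 + ln q) * (q * (real p * q powr (1/2)))" .
    have "\<kappa> * ln q * Mr * (1 + ln q) * (q * (real p * q powr (1/2))) / q ^ 3 =
        \<kappa> * real p * ln q * (1 + ln q) * q powr (- \<delta> / 2) / q"
    proof -
      have "Mr * q powr (1/2) = q powr (1 - \<delta>/2)" unfolding Mr_def by (simp add: powr_add[symmetric])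
      also have "\<dots> = q powr (1 + - \<delta> / 2)" by simp
      also have "\<dots> = q * q powr (- \<delta> / 2)" using q1 by (simp only: powr_add powr_one)
      finally have e: "Mr * q powr (1/2) = q * q powr (- \<delta> / 2)" .
      have "\<kappa> * ln q * Mr * (1 + ln q) * (q * (real p * q powr (1/2))) = \<kappa> * ln q * (1 + ln q) * q * real p * (Mr * q powr (1/2))"
        by (simp only: ac_simps)
      also have "\<dots> = \<kappa> * real p * ln q * (1 + ln q) * q powr (- \<delta> / 2) * q^2"
        unfolding e by (simp only: ac_simps power2_eq_square)
      finally have a: "\<kappa> * ln q * Mr * (1 + ln q) * (q * (real p * q powr (1/2))) =
          \<kappa> * real p * ln q * (1 + ln q) * q powr (- \<delta> / 2) * q^2" .
      have "w * q^2 / q ^ 3 = w / q" for w using q1 by (simp add: power2_eq_square power3_eq_cube)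
      then show ?thesis unfolding a .
    qed
    moreover have "(\<Sum>\<xi>\<in>centred_cube M - {(0, 0, 0)}. norm (exp_sum n \<xi>)) / q ^ 3 \<le>
        \<kappa> * ln q * Mr * (1 + ln q) * (q * (real p * q powr (1/2))) / q ^ 3"
      using le q1 by (intro divide_right_mono) auto
    ultimately have "(\<Sum>\<xi>\<in>centred_cube M - {(0, 0, 0)}. norm (exp_sum n \<xi>)) / q ^ 3 \<le>
        \<kappa> * real p * ln q * (1 + ln q) * q powr (- \<delta> / 2) / q" by (simp only:)
    moreover have "\<beta> \<le> (4 * q powr (- \<delta> / 2)) ^ r"
      unfolding \<beta>_def
    proof (rule power_mono)
      have "q powr (1 + \<delta>/2) = Mr * q powr (1/2 + \<delta>)" unfolding Mr_def by (simp add: powr_add[symmetric])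
      also have "\<dots> \<le> (2 * real M) * real H"
        using M2 H unfolding q_def[symmetric] by (intro mult_mono) auto
      finally have le: "q powr (1 + \<delta>/2) \<le> 2 * (real M * real H)" by simp
      have "2 * q / (real M * real H) = 4 * q / (2 * (real M * real H))" by simp
      also have "\<dots> \<le> 4 * q / q powr (1 + \<delta>/2)"
        using le q1 by (intro divide_left_mono mult_pos_pos) (use M(3) H1 in auto)
      also have "\<dots> = 4 * q powr (- \<delta> / 2)"
      proof -
        have "q powr (1 + \<delta>/2) = q * q powr (\<delta>/2)" using q1 by (simp only: powr_add powr_one)
        moreover have "q powr (- \<delta> / 2) = 1 / q powr (\<delta>/2)" using powr_minus_divide[of q "\<delta>/2"] by simp
        ultimately show ?thesis using q1 by simp
      qed
      finally show "2 * q / (real M * real H) \<le> 4 * q powr (- \<delta> / 2)" .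
    qed (use q1 in simp)
    then have "q ^ 3 * \<beta> \<le> q ^ 3 * (4 * q powr (- \<delta> / 2)) ^ r" using q1 by (intro mult_left_mono) auto
    ultimately show "\<bar>(\<Sum>\<tau>\<in>?T \<times> ?T \<times> ?T. of_bool (sol n (translate u (shift3 (tuple_sum r) \<tau>)))) / real (card ?T) ^ 3 -
      density_const p a b c / real (p ^ n)\<bar> \<le>
      \<kappa> * real p * ln (real (p ^ n)) * (1 + ln (real (p ^ n))) * real (p ^ n) powr (- \<delta> / 2) / real (p ^ n)
        + real (p ^ n) ^ 3 * (4 * real (p ^ n) powr (- \<delta> / 2)) ^ r"
      using main unfolding q_def by linarith
  qed
qed

lemma filterlim_prime_power: "filterlim (\<lambda>n. real (p ^ n)) at_top sequentially"
proof (rule filterlim_at_top_mono[OF filterlim_real_sequentially])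
  show "\<forall>\<^sub>F n in sequentially. real n \<le> real (p ^ n)"
    using p_odd_gt by (intro always_eventually allI of_nat_mono less_imp_le power_gt_expt) auto
qed

text \<open>With r at least 10/\<delta> the r-fold saving is q^(-5) or better, so the high
  frequencies contribute at most 4^r q^(-2), negligible against 1/q. The bound is uniform in the
  centre u and in the side H.\<close>

lemma equidistribution:
  assumes \<delta>: "0 < \<delta>" "\<delta> \<le> 1" and r: "real r \<ge> 10 / \<delta>" and \<eta>: "\<eta> > 0"
  shows "\<forall>\<^sub>F n in sequentially. \<forall>u H. real H \<ge> real (p ^ n) powr (1/2 + \<delta>) \<longrightarrow>
      \<bar>(\<Sum>\<tau>\<in>tuples r H \<times> tuples r H \<times> tuples r H. of_bool (sol n (translate u (shift3 (tuple_sum r) \<tau>))))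
        / real (card (tuples r H)) ^ 3 - density_const p a b c / real (p ^ n)\<bar> \<le> \<eta> / real (p ^ n)"
proof -
  obtain \<kappa> where \<kappa>: "\<And>n u H. n \<ge> 1 \<Longrightarrow> real (p ^ n) powr \<delta> > real p * (real_of_int dual_size + 1) \<Longrightarrow>
    real H \<ge> real (p ^ n) powr (1/2 + \<delta>) \<Longrightarrow>
      \<bar>(\<Sum>\<tau>\<in>tuples r H \<times> tuples r H \<times> tuples r H. of_bool (sol n (translate u (shift3 (tuple_sum r) \<tau>))))
        / real (card (tuples r H)) ^ 3 - density_const p a b c / real (p ^ n)\<bar> \<le>
      \<kappa> * ln (real (p ^ n)) * (1 + ln (real (p ^ n))) * real (p ^ n) powr (- \<delta> / 2) / real (p ^ n)
        + real (p ^ n) ^ 3 * (4 * real (p ^ n) powr (- \<delta> / 2)) ^ r"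
    using equidistribution_bound[OF \<delta>, of r] by blast
  let ?B = "real p * (real_of_int dual_size + 1)"
  have "filterlim (\<lambda>x. x powr \<delta>) at_top at_top" using \<delta>(1) by real_asymp
  then have 1: "\<forall>\<^sub>F x in at_top. x powr \<delta> > ?B" unfolding filterlim_at_top_dense by blast
  have "((\<lambda>x. \<kappa> * (ln x * (1 + ln x) * x powr (- \<delta> / 2)) + 4 ^ r / x) \<longlongrightarrow> \<kappa> * 0 + 0) at_top"
  proof (intro tendsto_intros)
    show "((\<lambda>x. ln x * (1 + ln x) * x powr (- \<delta> / 2)) \<longlongrightarrow> 0) at_top" using \<delta>(1) by real_asymp
    show "((\<lambda>x::real. 4 ^ r / x) \<longlongrightarrow> 0) at_top" by real_asymp
  qed
  then have 2: "\<forall>\<^sub>F x in at_top. \<kappa> * (ln x * (1 + ln x) * x powr (- \<delta> / 2)) + 4 ^ r / x < \<eta>"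
    using \<eta> by (intro order_tendstoD(2)) auto
  have "\<forall>\<^sub>F x in at_top. x powr \<delta> > ?B \<and> \<kappa> * (ln x * (1 + ln x) * x powr (- \<delta> / 2)) + 4 ^ r / x < \<eta> \<and> x \<ge> 1"
    using eventually_conj[OF 1 eventually_conj[OF 2 eventually_ge_at_top[of 1]]] .
  then have "\<forall>\<^sub>F n in sequentially. real (p ^ n) powr \<delta> > ?B \<and>
      \<kappa> * (ln (real (p ^ n)) * (1 + ln (real (p ^ n))) * real (p ^ n) powr (- \<delta> / 2)) + 4 ^ r / real (p ^ n) < \<eta> \<and> real (p ^ n) \<ge> 1"
    using eventually_compose_filterlim[OF _ filterlim_prime_power] by blast
  with eventually_ge_at_top[of 1] show ?thesis
  proof eventually_elim
    case (elim n)
    define q where "q = real (p ^ n)"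
    have q1: "q \<ge> 1" using elim by (simp add: q_def)
    have small: "q ^ 3 * (4 * q powr (- \<delta> / 2)) ^ r \<le> 4 ^ r / q / q"
    proof -
      have "(q powr (- \<delta> / 2)) ^ r = q powr (- \<delta> / 2 * real r)"
        using q1 by (simp add: powr_realpow[symmetric] powr_powr)
      also have "\<dots> \<le> q powr (- 5)"
      proof (intro powr_mono q1)
        show "- \<delta> / 2 * real r \<le> - 5" using r \<delta>(1) by (simp add: field_simps)
      qed
      finally have "q ^ 3 * (4 ^ r * (q powr (- \<delta> / 2)) ^ r) \<le> q ^ 3 * (4 ^ r * q powr (- 5))"
        using q1 by (intro mult_left_mono) auto
      also have "q powr (- 5) = 1 / q ^ 5" using q1 by (simp add: powr_minus divide_inverse powr_numeral)
      also have "q ^ 3 * (4 ^ r * (1 / q ^ 5)) = 4 ^ r / q / q" using q1 by (simp add: field_simps eval_nat_numeral)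
      finally show ?thesis by (simp only: power_mult_distrib)
    qed
    show ?case
    proof (intro allI impI)
      fix u H assume H: "real H \<ge> real (p ^ n) powr (1/2 + \<delta>)"
      have "\<kappa> * ln q * (1 + ln q) * q powr (- \<delta> / 2) / q + q ^ 3 * (4 * q powr (- \<delta> / 2)) ^ r \<le>
        (\<kappa> * (ln q * (1 + ln q) * q powr (- \<delta> / 2)) + 4 ^ r / q) / q"
        using small by (simp add: add_divide_distrib mult.assoc)
      also have "\<dots> \<le> \<eta> / q" using elim q1 unfolding q_def by (intro divide_right_mono) auto
      finally show "\<bar>(\<Sum>\<tau>\<in>tuples r H \<times> tuples r H \<times> tuples r H. of_bool (sol n (translate u (shift3 (tuple_sum r) \<tau>))))
        / real (card (tuples r H)) ^ 3 - density_const p a b c / real (p ^ n)\<bar> \<le> \<eta> / real (p ^ n)"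
        using \<kappa>[of n H u] elim H unfolding q_def by linarith
    qed
  qed
qed

end

section \<open>Sums of Schwartz functions over lattice points\<close>

text \<open>The majorant of a Schwartz function and of its derivative.\<close>

definition cauchy_kernel :: "real \<Rightarrow> real" where
  "cauchy_kernel x = 1 / (1 + x^2)"

lemma cauchy_kernel_pos: "cauchy_kernel x > 0"
  by (simp add: cauchy_kernel_def add_pos_nonneg)

lemma cauchy_kernel_shift:
  assumes "\<bar>x - y\<bar> \<le> 1" shows "cauchy_kernel x \<le> 3 * cauchy_kernel y"
proof -
  have "(x - y)^2 \<le> 1" using assms abs_square_le_1 by blast
  \<comment> \<open>A sum-of-squares certificate: the right-hand side is 3 (1 + x^2) - (1 +
    y^2).\<close>
  then have "0 \<le> 2 * (1 - (x - y)^2) + (x + (x - y))^2 + x^2"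
    by (intro add_nonneg_nonneg) auto
  also have "\<dots> = 3 * (1 + x^2) - (1 + y^2)"
    by (simp add: power2_eq_square algebra_simps)
  finally have "1 + y^2 \<le> 3 * (1 + x^2)" by (simp only: diff_ge_0_iff_ge)
  moreover have "1 + x^2 > 0" "1 + y^2 > 0" by (simp_all add: add_pos_nonneg)
  ultimately show ?thesis unfolding cauchy_kernel_def by (simp add: field_simps)
qed

text \<open>Adding the decay bounds for the exponents 0 and 2, for the function and for its
  derivative, gives majorants by the kernel; the mean value theorem turns the second into the
  Lipschitz estimate.\<close>

lemma schwartz_bounds:
  assumes "schwartz g"
  obtains C where "C > 0" "\<And>x. \<bar>g x\<bar> \<le> C * cauchy_kernel x"
    "\<And>x y. \<bar>x - y\<bar> \<le> 1 \<Longrightarrow> \<bar>g x\<bar> \<le> C * cauchy_kernel y"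
    "\<And>x y. \<bar>x - y\<bar> \<le> 1 \<Longrightarrow> \<bar>g x - g y\<bar> \<le> C * \<bar>x - y\<bar> * cauchy_kernel y"
    "continuous_on UNIV g"
proof -
  have diff: "(deriv ^^ k) g differentiable at x" for k x using assms by (simp add: schwartz_def)
  have dec: "\<exists>C. \<forall>x. \<bar>x ^ j * (deriv ^^ k) g x\<bar> \<le> C" for j k using assms by (simp add: schwartz_def)
  have bound: "\<exists>C>0. \<forall>x. \<bar>(deriv ^^ k) g x\<bar> \<le> C * cauchy_kernel x" for k
  proof -
    obtain C0 where C0: "\<And>x. \<bar>x ^ 0 * (deriv ^^ k) g x\<bar> \<le> C0" using dec by blast
    obtain C2 where C2: "\<And>x. \<bar>x ^ 2 * (deriv ^^ k) g x\<bar> \<le> C2" using dec by blast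
    show ?thesis
    proof (intro exI[of _ "\<bar>C0\<bar> + \<bar>C2\<bar> + 1"] conjI allI)
      fix x
      have "(1 + x^2) * \<bar>(deriv ^^ k) g x\<bar> = \<bar>x ^ 0 * (deriv ^^ k) g x\<bar> + \<bar>x ^ 2 * (deriv ^^ k) g x\<bar>"
        by (simp add: abs_mult distrib_right)
      also have "\<dots> \<le> \<bar>C0\<bar> + \<bar>C2\<bar> + 1" using C0[of x] C2[of x] by linarith
      finally show "\<bar>(deriv ^^ k) g x\<bar> \<le> (\<bar>C0\<bar> + \<bar>C2\<bar> + 1) * cauchy_kernel x"
        unfolding cauchy_kernel_def by (simp add: field_simps add_pos_nonneg)
    qed linarith
  qed
  obtain A where A: "A > 0" "\<And>x. \<bar>g x\<bar> \<le> A * cauchy_kernel x" using bound[of 0] by auto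
  obtain B where B: "B > 0" "\<And>x. \<bar>deriv g x\<bar> \<le> B * cauchy_kernel x" using bound[of 1] by auto
  have der: "(g has_real_derivative deriv g x) (at x)" for x
    using diff[of 0 x] by (simp add: DERIV_deriv_iff_real_differentiable)
  \<comment> \<open>The factor 3 pays for moving the kernel by a distance of at most 1.\<close>
  define C where "C = 3 * (A + B)"
  show ?thesis
  proof
    show "C > 0" using A B by (simp add: C_def)
    have "A \<le> C" using A B by (simp add: C_def)
    then show "\<bar>g x\<bar> \<le> C * cauchy_kernel x" for x
      using A(2)[of x] mult_right_mono[of A C "cauchy_kernel x"] cauchy_kernel_pos[of x] by linarith
    show "\<bar>g x\<bar> \<le> C * cauchy_kernel y" if "\<bar>x - y\<bar> \<le> 1" for x y
    proof -
      have "A * cauchy_kernel x \<le> A * (3 * cauchy_kernel y)"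
        using cauchy_kernel_shift[OF that] A(1) by (intro mult_left_mono) auto
      also have "\<dots> \<le> C * cauchy_kernel y"
        using B(1) cauchy_kernel_pos[of y] by (simp add: C_def algebra_simps)
      finally show ?thesis using A(2)[of x] by linarith
    qed
    show "\<bar>g x - g y\<bar> \<le> C * \<bar>x - y\<bar> * cauchy_kernel y" if xy: "\<bar>x - y\<bar> \<le> 1" for x y
    proof -
      have "norm (g x - g y) \<le> (C * cauchy_kernel y) * norm (x - y)"
      proof (rule field_differentiable_bound[where S = "closed_segment x y" and f' = "deriv g"])
        show "convex (closed_segment x y)" by simp
        show "(g has_field_derivative deriv g z) (at z within closed_segment x y)" for z
          using der by (rule has_field_derivative_at_within)
        show "norm (deriv g z) \<le> C * cauchy_kernel y" if z: "z \<in> closed_segment x y" for z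
        proof -
          have "\<bar>z - y\<bar> \<le> 1" using z xy unfolding closed_segment_eq_real_ivl by (auto split: if_splits)
          then have "B * cauchy_kernel z \<le> B * (3 * cauchy_kernel y)"
            using cauchy_kernel_shift B(1) by (intro mult_left_mono) auto
          also have "\<dots> \<le> C * cauchy_kernel y"
            using A(1) cauchy_kernel_pos[of y] by (simp add: C_def algebra_simps)
          finally show ?thesis using B(2)[of z] by simp
        qed
      qed simp_all
      then show ?thesis by (simp add: ac_simps)
    qed
    show "continuous_on UNIV g"
      using der by (meson DERIV_isCont continuous_at_imp_continuous_on)
  qed
qed

lemma integrable_cauchy_kernel: "integrable lborel cauchy_kernel"
proof -
  have "set_integrable lborel (einterval (- \<infinity>) \<infinity>) cauchy_kernel"
  proof (rule interval_integral_FTC_nonneg[where F = arctan and A = "- pi / 2" and B = "pi / 2"])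
    show "(arctan has_real_derivative cauchy_kernel x) (at x)" for x
      unfolding cauchy_kernel_def by (auto intro!: derivative_eq_intros simp: inverse_eq_divide)
    show "isCont cauchy_kernel x" for x
      unfolding cauchy_kernel_def[abs_def] by (intro continuous_intros) (simp add: add_nonneg_eq_0_iff)
    show "((arctan \<circ> real_of_ereal) \<longlongrightarrow> - pi / 2) (at_right (- \<infinity>))"
      using tendsto_arctan_at_bot by (simp add: ereal_tendsto_simps)
    show "((arctan \<circ> real_of_ereal) \<longlongrightarrow> pi / 2) (at_left \<infinity>)"
      using tendsto_arctan_at_top by (simp add: ereal_tendsto_simps)
  qed (auto intro!: AE_I2 less_imp_le[OF cauchy_kernel_pos])
  then show ?thesis by (simp add: set_integrable_def einterval_def)
qed

lemma integrable_of_cauchy_bound: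
  assumes "continuous_on UNIV g" "\<And>x. \<bar>g x\<bar> \<le> C * cauchy_kernel x"
  shows "integrable lborel g"
proof (rule Bochner_Integration.integrable_bound[OF integrable_mult_right[OF integrable_cauchy_kernel, of C]])
  show "g \<in> borel_measurable lborel" using assms(1) borel_measurable_continuous_onI by simp
  show "AE x in lborel. norm (g x) \<le> norm (C * cauchy_kernel x)"
    using assms(2) by (intro AE_I2) (metis abs_ge_self order_trans real_norm_def)
qed

text \<open>By the mean value theorem the increment of arctan over a cell of length 1/N is 1/N times
  the kernel at an inner point, within distance 1 of the left end. Telescoping leaves a total
  increment of at most pi.\<close>

lemma sum_cauchy_kernel_le:
  assumes N: "N \<ge> 1" and "finite X"
  shows "(\<Sum>x\<in>X. cauchy_kernel (of_int x / N)) \<le> 3 * pi * N"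
proof -
  obtain m :: nat where m: "X \<subseteq> {- int m..<int m}"
  proof -
    define m where "m = nat (\<Sum>x\<in>X. \<bar>x\<bar>) + 1"
    have "\<bar>x\<bar> \<le> (\<Sum>x\<in>X. \<bar>x\<bar>)" if "x \<in> X" for x
      using that assms(2) by (intro member_le_sum) auto
    then have "X \<subseteq> {- int m..<int m}" unfolding m_def by force
    then show ?thesis using that by blast
  qed
  have step: "cauchy_kernel (of_int x / N) \<le> 3 * N * (arctan (of_int (x + 1) / N) - arctan (of_int x / N))" for x
  proof -
    have lt: "of_int x / N < of_int (x + 1) / N" using N by (simp add: divide_strict_right_mono)
    obtain z where z: "of_int x / N < z" "z < of_int (x + 1) / N"
      "arctan (of_int (x + 1) / N) - arctan (of_int x / N) = (of_int (x + 1) / N - of_int x / N) * inverse (1 + z^2)"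
      using MVT2[OF lt, of arctan "\<lambda>z. inverse (1 + z^2)"] by (auto intro: DERIV_arctan)
    have d: "of_int (x + 1) / N - of_int x / N = 1 / N" by (simp add: diff_divide_distrib[symmetric])
    have "1 / N \<le> 1" using N by simp
    then have "\<bar>of_int x / N - z\<bar> \<le> 1" using z d by linarith
    then have "cauchy_kernel (of_int x / N) \<le> 3 * cauchy_kernel z" by (rule cauchy_kernel_shift)
    also have "\<dots> = 3 * N * (arctan (of_int (x + 1) / N) - arctan (of_int x / N))"
      unfolding z(3) d using N by (simp add: cauchy_kernel_def inverse_eq_divide)
    finally show ?thesis .
  qed
  have tele: "(\<Sum>x\<in>{- int m..<int m}. arctan (of_int (x + 1) / N) - arctan (of_int x / N)) =
      arctan (of_nat m / N) - arctan (- of_nat m / N)"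
  proof (induction m)
    case 0
    then show ?case by simp
  next
    case (Suc m)
    have "{- int (Suc m)..<int (Suc m)} = insert (int m) (insert (- int (Suc m)) {- int m..<int m})" by auto
    then show ?case using Suc by (simp add: add.commute)
  qed
  have "(\<Sum>x\<in>X. cauchy_kernel (of_int x / N)) \<le> (\<Sum>x\<in>{- int m..<int m}. cauchy_kernel (of_int x / N))"
    using m cauchy_kernel_pos by (intro sum_mono2) (auto intro: less_imp_le)
  also have "\<dots> \<le> (\<Sum>x\<in>{- int m..<int m}. 3 * N * (arctan (of_int (x + 1) / N) - arctan (of_int x / N)))"
    by (intro sum_mono step)
  also have "\<dots> = 3 * N * (arctan (of_nat m / N) - arctan (- of_nat m / N))"
    unfolding sum_distrib_left[symmetric] tele ..
  also have "\<dots> \<le> 3 * N * pi"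
    using arctan_bounded[of "of_nat m / N"] arctan_bounded[of "- of_nat m / N"] N by (intro mult_left_mono) auto
  finally show ?thesis by (simp add: ac_simps)
qed

lemma cauchy_kernel_summable:
  assumes N: "N \<ge> 1"
  shows "(\<lambda>x. cauchy_kernel (of_int x / N)) summable_on UNIV"
    and "(\<Sum>\<^sub>\<infinity>x. cauchy_kernel (of_int x / N)) \<le> 3 * pi * N"
proof -
  show s: "(\<lambda>x. cauchy_kernel (of_int x / N)) summable_on UNIV"
    using sum_cauchy_kernel_le[OF N] cauchy_kernel_pos
    by (intro nonneg_bdd_above_summable_on bdd_aboveI2[of _ _ "3 * pi * N"]) (auto intro: less_imp_le)
  then show "(\<Sum>\<^sub>\<infinity>x. cauchy_kernel (of_int x / N)) \<le> 3 * pi * N"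
    by (rule infsum_le_finite_sums) (rule sum_cauchy_kernel_le[OF N])
qed

text \<open>These intervals are cofinal among the finite sets of integers; the unordered sum becomes
  a limit that can be compared with integrals over growing intervals.\<close>

lemma centred_intervals_exhaust:
  fixes s :: "int \<Rightarrow> real"
  assumes "(s has_sum S) UNIV"
  shows "(\<lambda>m. \<Sum>x\<in>{- int m..<int m}. s x) \<longlonglongrightarrow> S"
proof -
  have "filterlim (\<lambda>m. {- int m..<int m}) (finite_subsets_at_top UNIV) sequentially"
    unfolding filterlim_finite_subsets_at_top
  proof (intro allI impI)
    fix X :: "int set" assume "finite X \<and> X \<subseteq> UNIV"
    then have X: "finite X" by simp
    define m where "m = nat (\<Sum>x\<in>X. \<bar>x\<bar>) + 1"
    have m: "\<bar>x\<bar> < int m" if "x \<in> X" for x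
    proof -
      have "\<bar>x\<bar> \<le> (\<Sum>x\<in>X. \<bar>x\<bar>)" using that X by (intro member_le_sum) auto
      then show ?thesis by (simp add: m_def)
    qed
    show "\<forall>\<^sub>F k in sequentially. finite {- int k..<int k} \<and> X \<subseteq> {- int k..<int k} \<and> {- int k..<int k} \<subseteq> UNIV"
      using eventually_ge_at_top[of m] by eventually_elim (use m in force)
  qed
  then show ?thesis using assms unfolding has_sum_def by (rule filterlim_compose[rotated])
qed

text \<open>On a cell of length 1/N the Lipschitz bound gives the error C/N times the kernel, and
  the kernel sums to at most 3 pi N over all cells. The two factors N cancel, so the error stays
  bounded as N grows.\<close>

lemma riemann_sum_error:
  assumes N: "N \<ge> 1" and C: "C > 0" and cont: "continuous_on UNIV g" and nn: "\<And>x. g x \<ge> 0"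
    and bd: "\<And>x. \<bar>g x\<bar> \<le> C * cauchy_kernel x"
    and lip: "\<And>x y. \<bar>x - y\<bar> \<le> 1 \<Longrightarrow> \<bar>g x - g y\<bar> \<le> C * \<bar>x - y\<bar> * cauchy_kernel y"
  shows "(\<lambda>x. g (of_int x / N)) summable_on UNIV"
    and "\<bar>(\<Sum>\<^sub>\<infinity>x. g (of_int x / N)) - N * (LINT t|lborel. g t)\<bar> \<le> 3 * pi * C"
proof -
  have meas: "g \<in> borel_measurable borel" using cont by (rule borel_measurable_continuous_onI)
  have int_g: "integrable lborel g" using cont bd by (rule integrable_of_cauchy_bound)
  have "(\<lambda>x. C * cauchy_kernel (of_int x / N)) summable_on UNIV"
    using cauchy_kernel_summable(1)[OF N] by (rule summable_on_cmult_right)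
  then show summ: "(\<lambda>x. g (of_int x / N)) summable_on UNIV"
    by (rule summable_on_comparison_test) (use bd nn in \<open>auto dest: abs_le_D1\<close>)
  let ?I = "\<lambda>x::int. {of_int x / N..<of_int (x + 1) / N}"
  have len: "of_int (x + 1) / N - of_int x / N = 1 / N" "of_int x / N \<le> of_int (x + 1) / N" for x
    using N by (simp_all add: diff_divide_distrib[symmetric] divide_right_mono)
  have int_ind: "integrable lborel (\<lambda>t. indicator (?I x) t * g t)" for x
    using integrable_real_mult_indicator[OF _ int_g, of "?I x"] by (simp add: mult.commute)
  have ind: "(LINT t|lborel. indicator (?I x) t) = 1 / N" "integrable lborel (indicator (?I x) :: real \<Rightarrow> real)" for x
    using len[of x] N by (simp_all add: emeasure_lborel_Ico measure_def)
  have cell: "\<bar>g (of_int x / N) - N * (LINT t|lborel. indicator (?I x) t * g t)\<bar> \<le> C / N * cauchy_kernel (of_int x / N)" for x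
  proof -
    define y where "y = of_int x / N"
    have d: "(LINT t|lborel. indicator (?I x) t * g t) - g y / N = (LINT t|lborel. indicator (?I x) t * (g t - g y))"
    proof -
      have "(LINT t|lborel. indicator (?I x) t * (g t - g y)) =
          (LINT t|lborel. indicator (?I x) t * g t - g y * indicator (?I x) t)"
        by (intro Bochner_Integration.integral_cong refl) (simp add: algebra_simps)
      also have "\<dots> = (LINT t|lborel. indicator (?I x) t * g t) - g y * (LINT t|lborel. indicator (?I x) t)"
        using int_ind[of x] ind(2)[of x] by (subst Bochner_Integration.integral_diff) auto
      finally show ?thesis using ind(1)[of x] by simp
    qed
    have "\<bar>LINT t|lborel. indicator (?I x) t * (g t - g y)\<bar> \<le> (LINT t|lborel. C / N * cauchy_kernel y * indicator (?I x) t)"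
    proof (rule order_trans[OF integral_abs_bound], rule integral_mono)
      show "integrable lborel (\<lambda>t. \<bar>indicator (?I x) t * (g t - g y)\<bar>)"
      proof (rule integrable_abs)
        have "integrable lborel (\<lambda>t. indicator (?I x) t * g t - g y * indicator (?I x) t)"
          using int_ind[of x] ind(2)[of x] by auto
        then show "integrable lborel (\<lambda>t. indicator (?I x) t * (g t - g y))" by (simp add: algebra_simps)
      qed
      show "integrable lborel (\<lambda>t. C / N * cauchy_kernel y * indicator (?I x) t)" using ind(2)[of x] by auto
      show "\<bar>indicator (?I x) t * (g t - g y)\<bar> \<le> C / N * cauchy_kernel y * indicator (?I x) t" for t
      proof (cases "t \<in> ?I x")
        case True
        then have ty: "\<bar>t - y\<bar> \<le> 1 / N" using len[of x] unfolding y_def by auto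
        moreover have "1 / N \<le> 1" using N by simp
        ultimately have "\<bar>g t - g y\<bar> \<le> C * \<bar>t - y\<bar> * cauchy_kernel y" by (intro lip) linarith
        also have "\<dots> \<le> C * (1 / N) * cauchy_kernel y"
          using ty C cauchy_kernel_pos[of y] by (intro mult_right_mono mult_left_mono) auto
        finally show ?thesis using True by simp
      qed simp
    qed
    also have "\<dots> = C / N * cauchy_kernel y * (1 / N)" using ind(1)[of x] by simp
    finally have "N * \<bar>(LINT t|lborel. indicator (?I x) t * g t) - g y / N\<bar> \<le> N * (C / N * cauchy_kernel y * (1 / N))"
      unfolding d using N by (intro mult_left_mono) auto
    also have "N * \<bar>(LINT t|lborel. indicator (?I x) t * g t) - g y / N\<bar> = \<bar>N * ((LINT t|lborel. indicator (?I x) t * g t) - g y / N)\<bar>"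
      using N by (simp add: abs_mult)
    also have "N * ((LINT t|lborel. indicator (?I x) t * g t) - g y / N) = N * (LINT t|lborel. indicator (?I x) t * g t) - g y"
      using N by (simp add: algebra_simps)
    finally show ?thesis using N unfolding y_def[symmetric] by (simp add: abs_minus_commute)
  qed
  have union: "(\<Sum>x\<in>{- int m..<int m}. indicator (?I x) t) = (indicator {- of_nat m / N..<of_nat m / N} t :: real)" for m t
  proof (induction m)
    case 0
    then show ?case by simp
  next
    case (Suc m)
    have "{- int (Suc m)..<int (Suc m)} = insert (int m) (insert (- int (Suc m)) {- int m..<int m})" by auto
    then have "(\<Sum>x\<in>{- int (Suc m)..<int (Suc m)}. indicator (?I x) t) =
        indicator (?I (int m)) t + (indicator (?I (- int (Suc m))) t + (indicator {- of_nat m / N..<of_nat m / N} t :: real))"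
      using Suc by simp
    also have "\<dots> = indicator {- of_nat (Suc m) / N..<of_nat (Suc m) / N} t"
    proof -
      have 1: "- (1 + real m) / N \<le> - real m / N" "- real m / N \<le> real m / N" "real m / N \<le> (1 + real m) / N"
        by (rule divide_right_mono; use N in simp)+
      show ?thesis using 1 by (auto simp: indicator_def add.commute)
    qed
    finally show ?case .
  qed
  have lim1: "(\<lambda>m. \<Sum>x\<in>{- int m..<int m}. g (of_int x / N)) \<longlonglongrightarrow> (\<Sum>\<^sub>\<infinity>x. g (of_int x / N))"
    using summ by (intro centred_intervals_exhaust has_sum_infsum)
  have lim2: "(\<lambda>m. LINT t|lborel. indicator {- of_nat m / N..<of_nat m / N} t * g t) \<longlonglongrightarrow> (LINT t|lborel. g t)"
  proof (rule integral_dominated_convergence[where w = "\<lambda>t. \<bar>g t\<bar>"])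
    show "integrable lborel (\<lambda>t. \<bar>g t\<bar>)" using int_g by simp
    show "AE t in lborel. (\<lambda>m. indicator {- of_nat m / N..<of_nat m / N} t * g t) \<longlonglongrightarrow> g t"
    proof (rule AE_I2)
      fix t :: real
      obtain m0 :: nat where m0: "N * (\<bar>t\<bar> + 1) \<le> of_nat m0" using real_arch_simple by blast
      have "\<forall>\<^sub>F m in sequentially. indicator {- of_nat m / N..<of_nat m / N} t * g t = g t"
        using eventually_ge_at_top[of m0]
      proof eventually_elim
        case (elim m)
        have "N * (\<bar>t\<bar> + 1) \<le> real m" using m0 elim by linarith
        then have "\<bar>t\<bar> + 1 \<le> real m / N" using N by (simp add: field_simps)
        then have "t \<in> {- of_nat m / N..<of_nat m / N}" by auto
        then show ?case by simp
      qed
      then show "(\<lambda>m. indicator {- of_nat m / N..<of_nat m / N} t * g t) \<longlonglongrightarrow> g t"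
        by (rule tendsto_eventually)
    qed
  qed (use meas in \<open>auto intro!: AE_I2 simp: abs_mult indicator_def\<close>)
  have "\<bar>(\<Sum>x\<in>{- int m..<int m}. g (of_int x / N)) - N * (LINT t|lborel. indicator {- of_nat m / N..<of_nat m / N} t * g t)\<bar> \<le> 3 * pi * C" for m
  proof -
    have "(LINT t|lborel. indicator {- of_nat m / N..<of_nat m / N} t * g t) = (\<Sum>x\<in>{- int m..<int m}. LINT t|lborel. indicator (?I x) t * g t)"
      unfolding union[symmetric] sum_distrib_right by (rule Bochner_Integration.integral_sum) (rule int_ind)
    then have "(\<Sum>x\<in>{- int m..<int m}. g (of_int x / N)) - N * (LINT t|lborel. indicator {- of_nat m / N..<of_nat m / N} t * g t) =
       (\<Sum>x\<in>{- int m..<int m}. g (of_int x / N) - N * (LINT t|lborel. indicator (?I x) t * g t))"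
      by (simp add: sum_subtractf sum_distrib_left)
    also have "\<bar>\<dots>\<bar> \<le> (\<Sum>x\<in>{- int m..<int m}. \<bar>g (of_int x / N) - N * (LINT t|lborel. indicator (?I x) t * g t)\<bar>)"
      by (rule sum_abs)
    also have "\<dots> \<le> (\<Sum>x\<in>{- int m..<int m}. C / N * cauchy_kernel (of_int x / N))"
      by (intro sum_mono cell)
    also have "\<dots> \<le> C / N * (3 * pi * N)"
      unfolding sum_distrib_left[symmetric] using sum_cauchy_kernel_le[OF N] C N by (intro mult_left_mono) auto
    also have "\<dots> = 3 * pi * C" using N by simp
    finally show ?thesis .
  qed
  then show "\<bar>(\<Sum>\<^sub>\<infinity>x. g (of_int x / N)) - N * (LINT t|lborel. g t)\<bar> \<le> 3 * pi * C"
    by (intro tendsto_upperbound[OF tendsto_rabs[OF tendsto_diff[OF lim1 tendsto_mult[OF tendsto_const lim2]]]]) auto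
qed

lemma
  fixes f1 :: "'a \<Rightarrow> real" and f2 :: "'b \<Rightarrow> real" and f3 :: "'c \<Rightarrow> real"
  assumes "f1 summable_on UNIV" "f2 summable_on UNIV" "f3 summable_on UNIV"
    and nn: "\<And>x. f1 x \<ge> 0" "\<And>x. f2 x \<ge> 0" "\<And>x. f3 x \<ge> 0"
  shows summable_on_triple_product: "(\<lambda>(x, y, z). f1 x * f2 y * f3 z) summable_on UNIV"
    and infsum_triple_product: "(\<Sum>\<^sub>\<infinity>(x, y, z). f1 x * f2 y * f3 z) = infsum f1 UNIV * infsum f2 UNIV * infsum f3 UNIV"
proof -
  have two: "((\<lambda>(x, y). g x * h y) has_sum (infsum g UNIV * infsum h UNIV)) UNIV"
    if "g summable_on UNIV" "h summable_on UNIV" "\<And>x. g x \<ge> 0" "\<And>x. h x \<ge> 0"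
    for g :: "'x \<Rightarrow> real" and h :: "'y \<Rightarrow> real"
  proof -
    have inner: "((\<lambda>y. g x * h y) has_sum (g x * infsum h UNIV)) UNIV" for x
      by (intro has_sum_cmult_right has_sum_infsum that)
    have s: "(\<lambda>(x, y). g x * h y) summable_on (UNIV \<times> UNIV)"
      using inner that by (intro summable_on_SigmaI[where g = "\<lambda>x. g x * infsum h UNIV"] summable_on_cmult_left) auto
    have "infsum (\<lambda>(x, y). g x * h y) (UNIV \<times> UNIV) = (\<Sum>\<^sub>\<infinity>x. \<Sum>\<^sub>\<infinity>y. g x * h y)"
      using infsum_Sigma'_banach[OF s] by simp
    also have "\<dots> = infsum g UNIV * infsum h UNIV"
      using infsumI[OF inner] by (simp add: infsum_cmult_left')
    finally show ?thesis using has_sum_infsum[OF s] by simp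
  qed
  have inner: "((\<lambda>(y, z). f2 y * f3 z) has_sum (infsum f2 UNIV * infsum f3 UNIV)) UNIV"
    by (intro two assms)
  have "((\<lambda>(x, w). f1 x * (case w of (y, z) \<Rightarrow> f2 y * f3 z)) has_sum
      (infsum f1 UNIV * infsum (\<lambda>(y, z). f2 y * f3 z) UNIV)) UNIV"
    using inner assms by (intro two) (auto simp: summable_on_def)
  then have "((\<lambda>(x, y, z). f1 x * f2 y * f3 z) has_sum (infsum f1 UNIV * (infsum f2 UNIV * infsum f3 UNIV))) UNIV"
    using infsumI[OF inner] by (simp add: case_prod_unfold mult.assoc)
  then show "(\<lambda>(x, y, z). f1 x * f2 y * f3 z) summable_on UNIV"
    "(\<Sum>\<^sub>\<infinity>(x, y, z). f1 x * f2 y * f3 z) = infsum f1 UNIV * infsum f2 UNIV * infsum f3 UNIV"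
    by (auto simp: summable_on_def mult.assoc dest: infsumI)
qed

lemma has_sum_finite_sum:
  fixes f :: "'a \<Rightarrow> 'b \<Rightarrow> real"
  assumes "finite T" "\<And>\<tau>. \<tau> \<in> T \<Longrightarrow> (f \<tau> has_sum s \<tau>) A"
  shows "((\<lambda>x. \<Sum>\<tau>\<in>T. f \<tau> x) has_sum (\<Sum>\<tau>\<in>T. s \<tau>)) A"
  using assms by (induction T rule: finite_induct) (auto intro!: has_sum_add has_sum_0)

text \<open>If \<open>S\<close> has density about \<open>\<kappa>\<close> in all translates of a small weighted box, then sums over \<open>S\<close>
  of functions that vary little on that box are about \<open>\<kappa>\<close> times the full sums.\<close>

lemma sum_over_equidistributed:
  fixes S :: "int \<times> int \<times> int \<Rightarrow> bool" and f G :: "int \<times> int \<times> int \<Rightarrow> real"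
  assumes T: "finite T" "T \<noteq> {}"
    and dens: "\<And>u. \<bar>(\<Sum>\<tau>\<in>T. of_bool (S (translate u (d \<tau>)))) / real (card T) - \<kappa>\<bar> \<le> \<eta>"
    and f: "f summable_on UNIV" "\<And>u. f u \<ge> 0" and G: "G summable_on UNIV" "\<And>u. G u \<ge> 0"
    and var: "\<And>u \<tau>. \<tau> \<in> T \<Longrightarrow> \<bar>f (translate u (d \<tau>)) - f u\<bar> \<le> \<delta> * G u" and "\<delta> \<ge> 0"
  shows "\<bar>(\<Sum>\<^sub>\<infinity>v\<in>{v. S v}. f v) - \<kappa> * (\<Sum>\<^sub>\<infinity>u. f u)\<bar> \<le> \<eta> * (\<Sum>\<^sub>\<infinity>u. f u) + \<delta> * (\<kappa> + \<eta>) * (\<Sum>\<^sub>\<infinity>u. G u)"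
proof -
  define c where "c = real (card T)"
  have c: "c > 0" using T by (simp add: c_def card_gt_0_iff)
  define X where "X = (\<Sum>\<^sub>\<infinity>v\<in>{v. S v}. f v)"
  have X: "((\<lambda>v. of_bool (S v) * f v) has_sum X) UNIV"
  proof -
    have "(f has_sum X) {v. S v}"
      unfolding X_def using f(1) by (intro has_sum_infsum) (rule summable_on_subset_banach, auto)
    then show ?thesis by (rule has_sum_cong_neutral[THEN iffD1, rotated -1]) auto
  qed
  \<comment> \<open>Translations permute the lattice, so averaging the summand over shifts preserves
    its total.\<close>
  have shifted: "((\<lambda>u. of_bool (S (translate u w)) * f (translate u w)) has_sum X) UNIV" for w
  proof -
    have "bij (\<lambda>u. translate u w)"
      by (rule bij_betw_byWitness[where f' = "\<lambda>u. translate u (neg3 w)"])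
        (auto simp: translate_def neg3_def split: prod.splits)
    then show ?thesis using X has_sum_reindex_bij_betw[of "\<lambda>u. translate u w" UNIV UNIV "\<lambda>v. of_bool (S v) * f v" X] by simp
  qed
  define A where "A u = (\<Sum>\<tau>\<in>T. of_bool (S (translate u (d \<tau>))) * f (translate u (d \<tau>))) / c" for u
  define W where "W u = (\<Sum>\<tau>\<in>T. of_bool (S (translate u (d \<tau>)))) / c" for u
  have "((\<lambda>u. \<Sum>\<tau>\<in>T. of_bool (S (translate u (d \<tau>))) * f (translate u (d \<tau>))) has_sum (\<Sum>\<tau>\<in>T. X)) UNIV"
    using T(1) shifted by (intro has_sum_finite_sum)
  then have "((\<lambda>u. (1 / c) * (\<Sum>\<tau>\<in>T. of_bool (S (translate u (d \<tau>))) * f (translate u (d \<tau>)))) has_sum ((1 / c) * (\<Sum>\<tau>\<in>T. X))) UNIV"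
    by (rule has_sum_cmult_right)
  then have A: "(A has_sum X) UNIV" using c unfolding A_def[abs_def] by (simp add: c_def)
  have F: "(f has_sum (\<Sum>\<^sub>\<infinity>u. f u)) UNIV" and Gs: "(G has_sum (\<Sum>\<^sub>\<infinity>u. G u)) UNIV"
    using f(1) G(1) by (auto intro: has_sum_infsum)
  \<comment> \<open>Replace f at the shifted point by f u, which costs \<delta> G u weighted by the
    local density \<open>W u\<close>, at most \<kappa> + \<eta>; then replace \<open>W u\<close> by
    \<kappa>.\<close>
  have ptw: "\<bar>A u - \<kappa> * f u\<bar> \<le> \<eta> * f u + \<delta> * (\<kappa> + \<eta>) * G u" for u
  proof -
    have W: "\<bar>W u - \<kappa>\<bar> \<le> \<eta>" using dens unfolding W_def c_def .
    have "A u - W u * f u = (\<Sum>\<tau>\<in>T. of_bool (S (translate u (d \<tau>))) * (f (translate u (d \<tau>)) - f u)) / c"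
      unfolding A_def W_def by (simp add: sum_subtractf right_diff_distrib sum_distrib_right diff_divide_distrib)
    also have "\<bar>\<dots>\<bar> \<le> (\<Sum>\<tau>\<in>T. \<bar>of_bool (S (translate u (d \<tau>))) * (f (translate u (d \<tau>)) - f u)\<bar>) / c"
      using c by (simp add: abs_divide divide_right_mono)
    also have "\<dots> \<le> (\<Sum>\<tau>\<in>T. of_bool (S (translate u (d \<tau>))) * (\<delta> * G u)) / c"
      using c var by (intro divide_right_mono sum_mono) (auto simp: abs_mult)
    also have "\<dots> = W u * (\<delta> * G u)" unfolding W_def by (simp add: sum_distrib_right)
    also have "\<dots> \<le> (\<kappa> + \<eta>) * (\<delta> * G u)"
      using W G(2)[of u] \<open>\<delta> \<ge> 0\<close> by (intro mult_right_mono) auto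
    finally have 1: "\<bar>A u - W u * f u\<bar> \<le> \<delta> * (\<kappa> + \<eta>) * G u" by (simp add: ac_simps)
    have "\<bar>W u * f u - \<kappa> * f u\<bar> = \<bar>W u - \<kappa>\<bar> * f u"
      using f(2)[of u] by (simp add: left_diff_distrib[symmetric] abs_mult)
    also have "\<dots> \<le> \<eta> * f u" using W f(2) by (intro mult_right_mono) auto
    finally show ?thesis using 1 by linarith
  qed
  have D: "((\<lambda>u. A u - \<kappa> * f u) has_sum (X - \<kappa> * (\<Sum>\<^sub>\<infinity>u. f u))) UNIV"
    using has_sum_add[OF A has_sum_uminusI[OF has_sum_cmult_right[OF F, of \<kappa>]]] by simp
  have E: "((\<lambda>u. \<eta> * f u + \<delta> * (\<kappa> + \<eta>) * G u) has_sum (\<eta> * (\<Sum>\<^sub>\<infinity>u. f u) + \<delta> * (\<kappa> + \<eta>) * (\<Sum>\<^sub>\<infinity>u. G u))) UNIV"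
    using F Gs by (intro has_sum_add has_sum_cmult_right)
  have "X - \<kappa> * (\<Sum>\<^sub>\<infinity>u. f u) \<le> \<eta> * (\<Sum>\<^sub>\<infinity>u. f u) + \<delta> * (\<kappa> + \<eta>) * (\<Sum>\<^sub>\<infinity>u. G u)"
    using ptw by (intro has_sum_mono[OF D E]) (simp add: abs_le_iff)
  moreover have "- (X - \<kappa> * (\<Sum>\<^sub>\<infinity>u. f u)) \<le> \<eta> * (\<Sum>\<^sub>\<infinity>u. f u) + \<delta> * (\<kappa> + \<eta>) * (\<Sum>\<^sub>\<infinity>u. G u)"
    using ptw by (intro has_sum_mono[OF has_sum_uminusI[OF D] E]) (simp add: abs_le_iff)
  ultimately show ?thesis unfolding X_def by (simp add: abs_le_iff)
qed

section \<open>The asymptotic formula\<close>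

lemma triple_product_variation:
  fixes a1 a2 a3 b1 b2 b3 k1 k2 k3 C l :: real
  assumes A: "\<bar>a1 - b1\<bar> \<le> C * l * k1" "\<bar>a2 - b2\<bar> \<le> C * l * k2" "\<bar>a3 - b3\<bar> \<le> C * l * k3"
    and B: "\<bar>a2\<bar> \<le> C * k2" "\<bar>a3\<bar> \<le> C * k3" "\<bar>b1\<bar> \<le> C * k1" "\<bar>b2\<bar> \<le> C * k2"
  shows "\<bar>a1 * a2 * a3 - b1 * b2 * b3\<bar> \<le> 3 * C ^ 3 * l * (k1 * k2 * k3)"
proof -
  have m: "\<bar>u * v * w\<bar> \<le> U * V * W" if "\<bar>u\<bar> \<le> U" "\<bar>v\<bar> \<le> V" "\<bar>w\<bar> \<le> W" for u v w U V W :: real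
  proof -
    have U: "0 \<le> U" "0 \<le> V" using that order_trans[OF abs_ge_zero] by blast+
    then have "\<bar>u\<bar> * \<bar>v\<bar> \<le> U * V" by (intro mult_mono that abs_ge_zero)
    then show ?thesis unfolding abs_mult using U by (intro mult_mono that mult_nonneg_nonneg abs_ge_zero)
  qed
  have "a1 * a2 * a3 - b1 * b2 * b3 = (a1 - b1) * a2 * a3 + b1 * (a2 - b2) * a3 + b1 * b2 * (a3 - b3)"
    by (simp add: algebra_simps)
  moreover have "\<bar>(a1 - b1) * a2 * a3\<bar> \<le> (C * l * k1) * (C * k2) * (C * k3)"
    by (intro m A B)
  moreover have "\<bar>b1 * (a2 - b2) * a3\<bar> \<le> (C * k1) * (C * l * k2) * (C * k3)"
    by (intro m A B)
  moreover have "\<bar>b1 * b2 * (a3 - b3)\<bar> \<le> (C * k1) * (C * k2) * (C * l * k3)"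
    by (intro m A B)
  ultimately have "\<bar>a1 * a2 * a3 - b1 * b2 * b3\<bar> \<le>
      (C * l * k1) * (C * k2) * (C * k3) + (C * k1) * (C * l * k2) * (C * k3) + (C * k1) * (C * k2) * (C * l * k3)"
    by linarith
  also have "\<dots> = 3 * C ^ 3 * l * (k1 * k2 * k3)" by (simp add: power3_eq_cube)
  finally show ?thesis .
qed

text \<open>By continuity a positive value persists on an interval and makes the integral positive.
  This serves the degenerate case of the asymptotics, in which the predicted main term is
  zero.\<close>

lemma nonneg_integral_eq_0:
  fixes g :: "real \<Rightarrow> real"
  assumes "continuous_on UNIV g" "integrable lborel g" "\<And>x. g x \<ge> 0" "(LINT x|lborel. g x) = 0"
  shows "g x = 0"
proof (rule ccontr)
  assume "g x \<noteq> 0"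
  then have pos: "g x > 0" using assms(3)[of x] by linarith
  have "isCont g x" using assms(1) by (simp add: continuous_on_eq_continuous_at)
  then obtain e where e: "e > 0" "\<And>y. \<bar>y - x\<bar> < e \<Longrightarrow> \<bar>g y - g x\<bar> < g x / 2"
    using pos unfolding continuous_at_eps_delta dist_real_def by (metis half_gt_zero)
  have "(LINT y|lborel. g x / 2 * indicator {x - e<..<x + e} y) \<le> (LINT y|lborel. g y)"
  proof (rule integral_mono)
    show "integrable lborel (\<lambda>y. g x / 2 * indicator {x - e<..<x + e} y)"
      using e(1) by (intro integrable_mult_right) (simp add: integrable_real_indicator)
    show "g x / 2 * indicator {x - e<..<x + e} y \<le> g y" for y
    proof (cases "y \<in> {x - e<..<x + e}")
      case True
      then have "\<bar>y - x\<bar> < e" by auto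
      then have "\<bar>g y - g x\<bar> < g x / 2" by (rule e(2))
      then have "g x / 2 \<le> g y" by linarith
      then show ?thesis using True by simp
    qed (use assms(3) in simp)
  qed (rule assms(2))
  moreover have "(LINT y|lborel. g x / 2 * indicator {x - e<..<x + e} y) = g x / 2 * (2 * e)"
    using e(1) by simp
  moreover have "g x / 2 * (2 * e) > 0" using pos e(1) by (intro mult_pos_pos) auto
  ultimately show False using assms(4) by linarith
qed

context form_mod_prime
begin

text \<open>\<open>l\<close> bounds the ratio of the box side r H to the scale N. Moving a point
  inside the box changes the product of three \<Phi>-values by a multiple of l times a product of
  kernels, and these kernels sum to at most (3 pi N)^3.\<close>

lemma smooth_count_bound:
  fixes \<Phi> :: "real \<Rightarrow> real" and x0 y0 z0 :: int
  assumes nn: "\<And>t. \<Phi> t \<ge> 0" and C: "C > 0" and N: "N \<ge> 1"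
    and cont: "continuous_on UNIV \<Phi>"
    and bd: "\<And>t. \<bar>\<Phi> t\<bar> \<le> C * cauchy_kernel t"
    and near: "\<And>s t. \<bar>s - t\<bar> \<le> 1 \<Longrightarrow> \<bar>\<Phi> s\<bar> \<le> C * cauchy_kernel t"
    and lip: "\<And>s t. \<bar>s - t\<bar> \<le> 1 \<Longrightarrow> \<bar>\<Phi> s - \<Phi> t\<bar> \<le> C * \<bar>s - t\<bar> * cauchy_kernel t"
    and H: "H \<ge> 1" "real (r * H) \<le> l * N" "0 \<le> l" "l \<le> 1"
    and dens: "\<And>u. \<bar>(\<Sum>\<tau>\<in>tuples r H \<times> tuples r H \<times> tuples r H. of_bool (sol n (translate u (shift3 (tuple_sum r) \<tau>))))
        / real (card (tuples r H)) ^ 3 - \<kappa>\<bar> \<le> \<eta>"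
    and "\<kappa> \<ge> 0"
  defines "Y \<equiv> \<Sum>\<^sub>\<infinity>x. \<Phi> (of_int x / N)"
  shows "\<bar>(\<Sum>\<^sub>\<infinity>(x, y, z)\<in>{v. sol n v}. \<Phi> (of_int (x - x0) / N) * \<Phi> (of_int (y - y0) / N) * \<Phi> (of_int (z - z0) / N)) - \<kappa> * Y ^ 3\<bar>
    \<le> \<eta> * Y ^ 3 + 3 * C ^ 3 * l * (\<kappa> + \<eta>) * (3 * pi * N) ^ 3"
proof -
  let ?T = "tuples r H"
  let ?f = "\<lambda>(x, y, z). \<Phi> (of_int (x - x0) / N) * \<Phi> (of_int (y - y0) / N) * \<Phi> (of_int (z - z0) / N)"
  let ?k = "\<lambda>m x. cauchy_kernel (of_int (x - m) / N)"
  let ?G = "\<lambda>(x, y, z). ?k x0 x * ?k y0 y * ?k z0 z"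
  have \<eta>: "\<eta> \<ge> 0" using order_trans[OF abs_ge_zero dens] .
  have k0: "0 \<le> cauchy_kernel t" for t using cauchy_kernel_pos[of t] by simp
  have bij: "bij_betw (\<lambda>x::int. x - m) UNIV UNIV" for m
    by (rule bij_betw_byWitness[where f' = "\<lambda>x. x + m"]) auto
  have sPhi: "(\<lambda>x. \<Phi> (of_int x / N)) summable_on UNIV"
    using riemann_sum_error(1)[OF N C cont nn bd lip] by blast
  have sf: "(\<lambda>x. \<Phi> (of_int (x - m) / N)) summable_on UNIV" "(\<Sum>\<^sub>\<infinity>x. \<Phi> (of_int (x - m) / N)) = Y" for m
    using summable_on_reindex_bij_betw[OF bij[of m], of "\<lambda>x. \<Phi> (of_int x / N)"] sPhi
      infsum_reindex_bij_betw[OF bij[of m], of "\<lambda>x. \<Phi> (of_int x / N)"] by (simp_all add: Y_def)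
  have sk: "(\<lambda>x. ?k m x) summable_on UNIV" "(\<Sum>\<^sub>\<infinity>x. ?k m x) \<le> 3 * pi * N" for m
    using summable_on_reindex_bij_betw[OF bij[of m], of "\<lambda>x. cauchy_kernel (of_int x / N)"] cauchy_kernel_summable[OF N]
      infsum_reindex_bij_betw[OF bij[of m], of "\<lambda>x. cauchy_kernel (of_int x / N)"] by simp_all
  have sk0: "0 \<le> (\<Sum>\<^sub>\<infinity>x. ?k m x)" for m using k0 by (intro infsum_nonneg) auto
  have f_sum: "?f summable_on UNIV" "infsum ?f UNIV = Y ^ 3"
    using summable_on_triple_product[OF sf(1)[of x0] sf(1)[of y0] sf(1)[of z0]]
      infsum_triple_product[OF sf(1)[of x0] sf(1)[of y0] sf(1)[of z0]] nn
    by (simp_all add: sf(2) power3_eq_cube del: of_int_diff)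
  have G_sum: "?G summable_on UNIV" "infsum ?G UNIV = infsum (?k x0) UNIV * infsum (?k y0) UNIV * infsum (?k z0) UNIV"
    using summable_on_triple_product[OF sk(1)[of x0] sk(1)[of y0] sk(1)[of z0]]
      infsum_triple_product[OF sk(1)[of x0] sk(1)[of y0] sk(1)[of z0]] k0
    by (simp_all del: of_int_diff)
  have G_le: "infsum ?G UNIV \<le> (3 * pi * N) ^ 3"
    unfolding G_sum(2) power3_eq_cube using N by (intro mult_mono sk mult_nonneg_nonneg sk0) auto
  have fin: "finite (?T \<times> ?T \<times> ?T)" by simp
  have ne: "?T \<times> ?T \<times> ?T \<noteq> {}"
  proof -
    have "?T \<noteq> {}"
    proof
      assume "?T = {}"
      then have "H ^ r = 0" using card_tuples[of r H] by simp
      then show False using H(1) by simp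
    qed
    then show ?thesis by simp
  qed
  have card3: "real (card (?T \<times> ?T \<times> ?T)) = real (card ?T) ^ 3"
    by (simp add: card_cartesian_product power3_eq_cube)
  \<comment> \<open>A shift by s changes the argument by at most l, and l is at most 1, so the local
    bounds apply with the kernel taken at the unshifted point.\<close>
  have one: "\<bar>\<Phi> (of_int (x + s - m) / N) - \<Phi> (of_int (x - m) / N)\<bar> \<le> C * l * ?k m x"
    "\<bar>\<Phi> (of_int (x + s - m) / N)\<bar> \<le> C * ?k m x" if s: "0 \<le> s" "s \<le> int (r * H)" for x s m
  proof -
    have d: "of_int (x + s - m) / N - of_int (x - m) / N = of_int s / N"
      by (simp add: diff_divide_distrib[symmetric])
    have "real_of_int s \<le> real (r * H)" using s(2) by linarith
    then have "of_int s / N \<le> l" using H(2) N by (simp add: field_simps)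
    then have b: "\<bar>of_int (x + s - m) / N - of_int (x - m) / N\<bar> \<le> l" unfolding d using s(1) N by simp
    then have b1: "\<bar>of_int (x + s - m) / N - of_int (x - m) / N\<bar> \<le> 1" using H(4) by linarith
    show "\<bar>\<Phi> (of_int (x + s - m) / N)\<bar> \<le> C * ?k m x" by (rule near[OF b1])
    have "C * \<bar>of_int (x + s - m) / N - of_int (x - m) / N\<bar> * ?k m x \<le> C * l * ?k m x"
      using b C k0 by (intro mult_right_mono mult_left_mono) auto
    then show "\<bar>\<Phi> (of_int (x + s - m) / N) - \<Phi> (of_int (x - m) / N)\<bar> \<le> C * l * ?k m x"
      using lip[OF b1] by linarith
  qed
  have "\<bar>(\<Sum>\<^sub>\<infinity>v\<in>{v. sol n v}. ?f v) - \<kappa> * infsum ?f UNIV\<bar> \<le>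
      \<eta> * infsum ?f UNIV + (3 * C ^ 3 * l) * (\<kappa> + \<eta>) * infsum ?G UNIV"
  proof (rule sum_over_equidistributed[OF fin ne, where d = "shift3 (tuple_sum r)"])
    show "\<bar>(\<Sum>\<tau>\<in>?T \<times> ?T \<times> ?T. of_bool (sol n (translate u (shift3 (tuple_sum r) \<tau>)))) / real (card (?T \<times> ?T \<times> ?T)) - \<kappa>\<bar> \<le> \<eta>" for u
      unfolding card3 by (rule dens)
    show "0 \<le> ?f u" for u using nn by (simp add: case_prod_unfold)
    show "0 \<le> ?G u" for u using k0 by (simp add: case_prod_unfold)
    show "0 \<le> 3 * C ^ 3 * l" using C H by simp
    show "\<bar>?f (translate u (shift3 (tuple_sum r) \<tau>)) - ?f u\<bar> \<le> 3 * C ^ 3 * l * ?G u"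
      if \<tau>: "\<tau> \<in> ?T \<times> ?T \<times> ?T" for u \<tau>
    proof -
      obtain x y z i j k where v: "u = (x, y, z)" "\<tau> = (i, j, k)" by (metis prod_cases3)
      have T: "i \<in> ?T" "j \<in> ?T" "k \<in> ?T" using \<tau> unfolding v by auto
      note I = one[OF tuple_sum_bounds[OF T(1)]] and J = one[OF tuple_sum_bounds[OF T(2)]] and K = one[OF tuple_sum_bounds[OF T(3)]]
      show ?thesis
        unfolding v translate_def shift3_def prod.case
        by (rule triple_product_variation[OF I(1) J(1) K(1) J(2) K(2) bd bd])
    qed
  qed (rule f_sum(1) G_sum(1))+
  also have "\<dots> \<le> \<eta> * infsum ?f UNIV + (3 * C ^ 3 * l) * (\<kappa> + \<eta>) * (3 * pi * N) ^ 3"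
    using G_le C H \<eta> \<open>\<kappa> \<ge> 0\<close> by (intro add_left_mono mult_left_mono) auto
  finally show ?thesis unfolding f_sum(2) .
qed

lemma zero_set_mod_eq: "zero_set_mod p (p ^ n) Q = {v. sol n v}"
  by (auto simp: zero_set_mod_def coprime_p_iff cong_0_iff)

text \<open>Two comparisons: equidistribution in boxes much shorter than N replaces the count by
  \<kappa>/q times the full lattice sum Y^3, and the Riemann sum estimate replaces Y by N times the
  integral. As a limit, rather than an equivalence, this remains valid when the integral is
  zero.\<close>

lemma smooth_count_asymptotics:
  fixes \<Phi> :: "real \<Rightarrow> real" and N :: "nat \<Rightarrow> real" and x0 y0 z0 :: int
  assumes \<epsilon>: "\<epsilon> > 0" and \<Phi>: "schwartz \<Phi>" "\<And>x. \<Phi> x \<ge> 0"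
    and N: "\<forall>\<^sub>F n in sequentially. N n \<ge> real (p ^ n) powr (1/2 + \<epsilon>)"
  shows "(\<lambda>n. (\<Sum>\<^sub>\<infinity>(x, y, z) \<in> zero_set_mod p (p ^ n) Q.
       \<Phi> (of_int (x - x0) / N n) * \<Phi> (of_int (y - y0) / N n) * \<Phi> (of_int (z - z0) / N n)) * real (p ^ n) / N n ^ 3)
    \<longlonglongrightarrow> density_const p a b c * (LINT x|lborel. \<Phi> x) ^ 3"
proof -
  define I where "I = (LINT x|lborel. \<Phi> x)"
  define \<kappa> where "\<kappa> = density_const p a b c"
  define X where "X n = (\<Sum>\<^sub>\<infinity>(x, y, z) \<in> zero_set_mod p (p ^ n) Q.
       \<Phi> (of_int (x - x0) / N n) * \<Phi> (of_int (y - y0) / N n) * \<Phi> (of_int (z - z0) / N n))" for n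
  define Y where "Y n = (\<Sum>\<^sub>\<infinity>x. \<Phi> (of_int x / N n))" for n
  define q where "q n = real (p ^ n)" for n
  have \<kappa>0: "\<kappa> > 0" using density_const_pos by (simp add: \<kappa>_def)
  obtain C where C: "C > 0" "\<And>x. \<bar>\<Phi> x\<bar> \<le> C * cauchy_kernel x"
    "\<And>x y. \<bar>x - y\<bar> \<le> 1 \<Longrightarrow> \<bar>\<Phi> x\<bar> \<le> C * cauchy_kernel y"
    "\<And>x y. \<bar>x - y\<bar> \<le> 1 \<Longrightarrow> \<bar>\<Phi> x - \<Phi> y\<bar> \<le> C * \<bar>x - y\<bar> * cauchy_kernel y"
    "continuous_on UNIV \<Phi>"
    using schwartz_bounds[OF \<Phi>(1)] by metis
  have I0: "I \<ge> 0" unfolding I_def using \<Phi>(2) by (intro integral_nonneg_AE AE_I2)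
  \<comment> \<open>2 \<delta> \<le> \<epsilon> leaves a factor q^\<delta> between the interval
    length q^(1/2+\<delta>) and N; the minimum with 1 keeps \<delta> \<le> 1.\<close>
  define \<delta> where "\<delta> = min \<epsilon> 1 / 2"
  have \<delta>: "0 < \<delta>" "\<delta> \<le> 1" "2 * \<delta> \<le> \<epsilon>" using \<epsilon> by (auto simp: \<delta>_def)
  define r where "r = nat \<lceil>10 / \<delta>\<rceil>"
  have r: "real r \<ge> 10 / \<delta>" unfolding r_def by linarith
  define H where "H n = nat \<lceil>q n powr (1/2 + \<delta>)\<rceil>" for n
  have q_lim: "filterlim q at_top sequentially" unfolding q_def[abs_def] by (rule filterlim_prime_power)
  have q1: "\<forall>\<^sub>F n in sequentially. q n \<ge> 1" using q_lim unfolding filterlim_at_top by blast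
  have Hge: "real (H n) \<ge> q n powr (1/2 + \<delta>)" for n unfolding H_def by linarith
  \<comment> \<open>Ratio of box side to N: r comes from the number of summed intervals, 2 from
    rounding the length up.\<close>
  define l where "l n = 2 * real r * q n powr (- \<delta>)" for n
  have l_lim: "l \<longlonglongrightarrow> 0"
  proof -
    have "((\<lambda>x. 2 * real r * x powr (- \<delta>)) \<longlongrightarrow> 2 * real r * 0) at_top"
      by (intro tendsto_mult tendsto_const) (use \<delta>(1) in real_asymp)
    then show ?thesis unfolding l_def[abs_def] using filterlim_compose[OF _ q_lim] by simp
  qed
  have l_le: "\<forall>\<^sub>F n in sequentially. l n \<le> 1" using order_tendstoD(2)[OF l_lim, of 1] by (auto elim: eventually_mono)
  have N_ev: "\<forall>\<^sub>F n in sequentially. N n \<ge> 1 \<and> N n \<ge> q n powr (1/2 + \<epsilon>) \<and> real (r * H n) \<le> l n * N n \<and> H n \<ge> 1"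
    using N q1
  proof eventually_elim
    case (elim n)
    have q0: "q n > 0" using elim by simp
    have N1: "N n \<ge> q n powr (1/2 + \<epsilon>)" using elim unfolding q_def by simp
    have "q n powr (1/2 + \<epsilon>) \<ge> 1" using elim \<epsilon> by (intro ge_one_powr_ge_zero) auto
    then have N2: "N n \<ge> 1" using N1 by linarith
    have P1: "q n powr (1/2 + \<delta>) \<ge> 1" using elim \<delta> by (intro ge_one_powr_ge_zero) auto
    then have H1: "real (H n) \<le> 2 * q n powr (1/2 + \<delta>)" "H n \<ge> 1" unfolding H_def by linarith+
    have "q n powr (1/2 + \<delta>) = q n powr (- \<delta>) * q n powr (1/2 + 2 * \<delta>)"
      by (simp add: powr_add[symmetric] add.commute)
    also have "\<dots> \<le> q n powr (- \<delta>) * N n"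
    proof (rule mult_left_mono)
      have "q n powr (1/2 + 2 * \<delta>) \<le> q n powr (1/2 + \<epsilon>)" using elim \<delta> by (intro powr_mono) auto
      then show "q n powr (1/2 + 2 * \<delta>) \<le> N n" using N1 by linarith
    qed simp
    finally have "2 * q n powr (1/2 + \<delta>) \<le> 2 * (q n powr (- \<delta>) * N n)" by simp
    then have "real (H n) \<le> 2 * (q n powr (- \<delta>) * N n)" using H1 by linarith
    then have "real r * real (H n) \<le> real r * (2 * (q n powr (- \<delta>) * N n))" by (intro mult_left_mono) auto
    then have "real (r * H n) \<le> l n * N n" by (simp add: l_def ac_simps)
    then show ?case using N1 N2 H1 by simp
  qed
  have N_lim: "filterlim N at_top sequentially"
  proof (rule filterlim_at_top_mono)
    have "filterlim (\<lambda>x. x powr (1/2 + \<epsilon>)) at_top at_top" using \<epsilon> by real_asymp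
    then show "filterlim (\<lambda>n. q n powr (1/2 + \<epsilon>)) at_top sequentially" using q_lim by (rule filterlim_compose)
    show "\<forall>\<^sub>F n in sequentially. q n powr (1/2 + \<epsilon>) \<le> N n" using N_ev by (rule eventually_mono) simp
  qed
  have Y_lim: "(\<lambda>n. Y n / N n) \<longlonglongrightarrow> I"
  proof (rule LIM_zero_cancel, rule Lim_null_comparison)
    show "(\<lambda>n. 3 * pi * C / N n) \<longlonglongrightarrow> 0" by (intro real_tendsto_divide_at_top[OF tendsto_const N_lim])
    show "\<forall>\<^sub>F n in sequentially. norm (Y n / N n - I) \<le> 3 * pi * C / N n"
      using N_ev
    proof eventually_elim
      case (elim n)
      have "\<bar>Y n - N n * I\<bar> \<le> 3 * pi * C"
        using riemann_sum_error(2)[of "N n" C \<Phi>] elim C \<Phi>(2) unfolding Y_def I_def by blast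
      then have "\<bar>Y n - N n * I\<bar> / N n \<le> 3 * pi * C / N n" using elim by (intro divide_right_mono) auto
      moreover have "Y n / N n - I = (Y n - N n * I) / N n" using elim by (simp add: field_simps)
      ultimately show ?case using elim by (simp add: abs_divide)
    qed
  qed
  have Y3: "(\<lambda>n. \<kappa> * (Y n / N n) ^ 3) \<longlonglongrightarrow> \<kappa> * I ^ 3" by (intro tendsto_intros Y_lim)
  define K where "K = 3 * C ^ 3 * (\<kappa> + 1) * (3 * pi) ^ 3"
  have K: "K \<ge> 0" using C \<kappa>0 by (simp add: K_def)
  have "(\<lambda>n. X n * q n / N n ^ 3 - \<kappa> * (Y n / N n) ^ 3) \<longlonglongrightarrow> 0"
  proof (rule tendstoI)
    fix e :: real assume e: "e > 0"
    \<comment> \<open>The density error is multiplied by (Y/N)^3, eventually below I^3 + 1, and so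
      uses half of e. The bound \<eta> \<le> 1 makes the constant \<open>K\<close> independent of
      e.\<close>
    define \<eta> where "\<eta> = min 1 (e / (2 * (I ^ 3 + 1)))"
    have I3: "I ^ 3 + 1 > 0" using I0 by (simp add: add_nonneg_pos)
    have \<eta>: "\<eta> > 0" "\<eta> \<le> 1" using e I3 by (auto simp: \<eta>_def)
    have "\<eta> \<le> e / (2 * (I ^ 3 + 1))" unfolding \<eta>_def by (rule min.cobounded2)
    then have \<eta>e: "\<eta> * (I ^ 3 + 1) \<le> e / 2" using I3 by (simp add: field_simps)
    have ev1: "\<forall>\<^sub>F n in sequentially. (Y n / N n) ^ 3 < I ^ 3 + 1"
      by (rule order_tendstoD(2)[OF tendsto_power[OF Y_lim]]) simp
    have "(\<lambda>n. K * l n) \<longlonglongrightarrow> K * 0" by (intro tendsto_intros l_lim)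
    then have ev2: "\<forall>\<^sub>F n in sequentially. K * l n < e / 2" using e by (intro order_tendstoD(2)) auto
    show "\<forall>\<^sub>F n in sequentially. dist (X n * q n / N n ^ 3 - \<kappa> * (Y n / N n) ^ 3) 0 < e"
      using equidistribution[OF \<delta>(1,2) r \<eta>(1)] ev1 ev2 l_le q1 N_ev
    proof eventually_elim
      case (elim n)
      have q0: "q n > 0" using elim by simp
      have N1: "N n \<ge> 1" using elim by simp
      have l0: "l n \<ge> 0" by (simp add: l_def)
      have "\<bar>X n - \<kappa> / q n * Y n ^ 3\<bar> \<le> \<eta> / q n * Y n ^ 3 + 3 * C ^ 3 * l n * (\<kappa> / q n + \<eta> / q n) * (3 * pi * N n) ^ 3"
        unfolding X_def Y_def zero_set_mod_eq
      proof (rule smooth_count_bound[OF \<Phi>(2) C(1) N1 C(5) C(2,3,4)])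
        show "\<bar>(\<Sum>\<tau>\<in>tuples r (H n) \<times> tuples r (H n) \<times> tuples r (H n). of_bool (sol n (translate u (shift3 (tuple_sum r) \<tau>))))
          / real (card (tuples r (H n))) ^ 3 - \<kappa> / q n\<bar> \<le> \<eta> / q n" for u
          using elim(1) Hge[of n] unfolding \<kappa>_def q_def by blast
      qed (use elim l0 \<kappa>0 q0 in auto)
      then have "q n / N n ^ 3 * \<bar>X n - \<kappa> / q n * Y n ^ 3\<bar> \<le> q n / N n ^ 3 *
          (\<eta> / q n * Y n ^ 3 + 3 * C ^ 3 * l n * (\<kappa> / q n + \<eta> / q n) * (3 * pi * N n) ^ 3)"
        using q0 N1 by (intro mult_left_mono) auto
      also have "q n / N n ^ 3 * \<bar>X n - \<kappa> / q n * Y n ^ 3\<bar> = \<bar>q n / N n ^ 3 * (X n - \<kappa> / q n * Y n ^ 3)\<bar>"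
        using q0 N1 by (simp add: abs_mult)
      also have "q n / N n ^ 3 * (X n - \<kappa> / q n * Y n ^ 3) = X n * q n / N n ^ 3 - \<kappa> * (Y n / N n) ^ 3"
        using q0 N1 by (simp add: field_simps)
      also have "q n / N n ^ 3 * (\<eta> / q n * Y n ^ 3 + 3 * C ^ 3 * l n * (\<kappa> / q n + \<eta> / q n) * (3 * pi * N n) ^ 3) =
          \<eta> * (Y n / N n) ^ 3 + 3 * C ^ 3 * l n * (\<kappa> + \<eta>) * (3 * pi) ^ 3"
        using q0 N1 by (simp add: field_simps)
      also have "\<dots> \<le> \<eta> * (I ^ 3 + 1) + 3 * C ^ 3 * l n * (\<kappa> + 1) * (3 * pi) ^ 3"
        using elim \<eta> C(1) l0 \<kappa>0 by (intro add_mono mult_left_mono mult_right_mono) auto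
      also have "\<dots> = \<eta> * (I ^ 3 + 1) + K * l n" by (simp add: K_def)
      also have "\<dots> < e" using \<eta>e elim by linarith
      finally show ?case by (simp add: dist_real_def)
    qed
  qed
  from tendsto_add[OF this Y3] show ?thesis unfolding X_def q_def I_def \<kappa>_def by simp
qed

end

lemma form_mod_primeI:
  assumes "prime p" "odd p" "\<not> int p dvd a * (4*a*c - b^2) * \<lfloor>4 * form_det a b c d e f\<rfloor>"
  shows "form_mod_prime p a b c d e f"
proof -
  have "\<lfloor>4 * form_det a b c d e f\<rfloor> = 4*a*c*f + b*d*e - a*e^2 - c*d^2 - f*b^2"
    unfolding four_form_det by (rule floor_of_int)
  with assms show ?thesis by unfold_locales auto
qed

theorem theorem1:
  fixes \<epsilon> :: real and p :: nat and a b c d e f x0 y0 z0 :: int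
    and \<Phi> :: "real \<Rightarrow> real" and N :: "nat \<Rightarrow> real"
  assumes "\<epsilon> > 0"
    and "prime p" and "odd p"
    and "\<not> int p dvd a * (4*a*c - b^2) * \<lfloor>4 * form_det a b c d e f\<rfloor>"
    and "schwartz \<Phi>" and "\<And>x. \<Phi> x \<ge> 0"
    and "\<forall>\<^sub>F n in sequentially. N n \<ge> real (p ^ n) powr (1/2 + \<epsilon>)"
  shows "(\<lambda>n. complex_of_real
            (\<Sum>\<^sub>\<infinity>(x, y, z) \<in> zero_set_mod p (p ^ n) (ternary_form a b c d e f).
               \<Phi> (of_int (x - x0) / N n) * \<Phi> (of_int (y - y0) / N n) * \<Phi> (of_int (z - z0) / N n)))
         \<sim>[sequentially]
         (\<lambda>n. fourier_transform \<Phi> 0 ^ 3 *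
            complex_of_real (density_const p a b c * (N n ^ 3 / real (p ^ n))))"
proof -
  interpret form_mod_prime p a b c d e f by (rule form_mod_primeI[OF assms(2-4)])
  define I where "I = (LINT x|lborel. \<Phi> x)"
  define \<kappa> where "\<kappa> = density_const p a b c"
  define X where "X n = (\<Sum>\<^sub>\<infinity>(x, y, z) \<in> zero_set_mod p (p ^ n) Q.
       \<Phi> (of_int (x - x0) / N n) * \<Phi> (of_int (y - y0) / N n) * \<Phi> (of_int (z - z0) / N n))" for n
  have FT: "fourier_transform \<Phi> 0 = complex_of_real I"
    by (simp add: fourier_transform_def I_def)
  have \<kappa>0: "\<kappa> > 0" using density_const_pos by (simp add: \<kappa>_def)
  show ?thesis
  proof (cases "I = 0")
    \<comment> \<open>If the integral vanishes, \<Phi> is identically zero and so are both sides;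
      asymptotic equivalence counts the quotient 0/0 as 1.\<close>
    case True
    obtain C where "\<And>x. \<bar>\<Phi> x\<bar> \<le> C * cauchy_kernel x" "continuous_on UNIV \<Phi>"
      using schwartz_bounds[OF assms(5)] by metis
    then have "\<Phi> x = 0" for x
      using nonneg_integral_eq_0[of \<Phi> x] integrable_of_cauchy_bound[of \<Phi> C] assms(6) True unfolding I_def by blast
    then show ?thesis unfolding FT True by (simp add: case_prod_unfold)
  next
    case False
    have "(\<lambda>n. X n * real (p ^ n) / N n ^ 3) \<longlonglongrightarrow> \<kappa> * I ^ 3"
      unfolding X_def \<kappa>_def I_def by (rule smooth_count_asymptotics[OF assms(1,5,6,7)])
    then have "(\<lambda>n. X n * real (p ^ n) / N n ^ 3 / (\<kappa> * I ^ 3)) \<longlonglongrightarrow> \<kappa> * I ^ 3 / (\<kappa> * I ^ 3)"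
      using False \<kappa>0 by (intro tendsto_divide tendsto_const) auto
    then have "(\<lambda>n. complex_of_real (X n * real (p ^ n) / N n ^ 3 / (\<kappa> * I ^ 3))) \<longlonglongrightarrow> complex_of_real 1"
      using False \<kappa>0 by (intro tendsto_of_real) simp
    moreover have "complex_of_real (X n * real (p ^ n) / N n ^ 3 / (\<kappa> * I ^ 3)) =
        complex_of_real (X n) / (fourier_transform \<Phi> 0 ^ 3 * complex_of_real (\<kappa> * (N n ^ 3 / real (p ^ n))))" for n
      unfolding FT by (simp add: ac_simps)
    ultimately have "(\<lambda>n. complex_of_real (X n) / (fourier_transform \<Phi> 0 ^ 3 *
        complex_of_real (\<kappa> * (N n ^ 3 / real (p ^ n))))) \<longlonglongrightarrow> 1" by (simp only: of_real_1)
    then show ?thesis unfolding X_def \<kappa>_def by (rule asymp_equivI')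
  qed
qed

end
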